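(* Let $m\ge 1$, $N=1+m$, $\lambda\ge 1$, let $\Omega\subset\mathbb{R}^{N}$ be a $\Lambda$-connected bounded open set, and let $f\in L^1(\Omega)$ be a nonnegative function which is not identically zero. Then the Dirichlet problem $$-\Delta_\lambda u=\frac{f}{u}\ \text{ in }\Omega,\qquad u>0\ \text{ in }\Omega,\qquad u=0\ \text{ on }\partial\Omega$$ has a unique weak solution, i.e. there is exactly one $u\in H^{1,\lambda}_0(\Omega)$ such that for every $\Omega'\Subset\Omega$ there is a constant $C(\Omega')>0$ with $u\ge C(\Omega')$ a.e. in $\Omega'$, and $$\int_\Omega\langle A\nabla^*u,\nabla v\rangle\,dX=\int_\Omega\frac{fv}{u}\,dX\quad\text{for all }v\in C^1_0(\Omega).$$
   Context: Points of $\mathbb{R}^N=\mathbb{R}^{1+m}$ are written $X=(x,y)$ with $x\in\mathbb{R}$, $y\in\mathbb{R}^m$. The Grushin operator is $\Delta_\lambda u=u_{xx}+|x|^{2\lambda}\Delta_y u=\operatorname{div}(A\nabla u)$, where $A(X)=\operatorname{diag}(1,|x|^{2\lambda}I_m)$. An open set $\Omega$ is $\Lambda$-connected if any two points of $\Omega$ can be joined by a continuous curve lying in $\Omega$ which is piecewise an integral curve of the vector fields $\pm\partial_x,\pm|x|^\lambda\partial_{y_1},\dots,\pm|x|^\lambda\partial_{y_m}$. $\Omega'\Subset\Omega$ means that $\overline{\Omega'}$ is a compact subset of $\Omega$. $C^1_0(\Omega)$ is the space of $C^1$ functions with compact support in $\Omega$. Function spaces: let $V_A(\Omega)$ be the set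 of $u\in C^1(\Omega)$ with $\|u\|^2:=\int_\Omega|u|^2dX+\int_\Omega\langle A\nabla u,\nabla u\rangle dX<\infty$. $H^{1,\lambda}(\Omega)$ is the completion of $(V_A(\Omega),\|\cdot\|)$, and $H^{1,\lambda}_0(\Omega)$ is the completion of $C^1_0(\Omega)$ under $\|u\|_0:=(\int_\Omega\langle A\nabla u,\nabla u\rangle dX)^{1/2}$ (equivalent to $\|\cdot\|$ on $C^1_0(\Omega)$ by a Poincaré inequality). An element represented by a Cauchy sequence $\{u_n\}$ is identified with $u=\lim u_n$ in $L^2(\Omega)$; setting $U=\lim\sqrt{A}\nabla u_n$ in $L^2(\Omega)^N$ (which is uniquely determined by $u$), the weak quasi-gradient is $\nabla^*u:=(\sqrt{A})^{-1}U$, defined a.e. in $\Omega$. *)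

theory Defs
  imports "HOL-Analysis.Analysis"
begin

text \<open>
  A point \<open>X = (x, y)\<close> of \<open>R \<times> R^m\<close> has type \<open>real \<times> (real ^ 'm)\<close>; the index type
  \<open>'m :: finite\<close> is nonempty, so \<open>m = CARD('m) \<ge> 1\<close>.  The diagonal matrices below are given by
  their action on vectors.
\<close>

definition grushin_A :: "real \<Rightarrow> real \<times> (real ^ 'm) \<Rightarrow> real \<times> (real ^ 'm) \<Rightarrow> real \<times> (real ^ 'm)" where
  "grushin_A l X p = (fst p, (\<bar>fst X\<bar> powr (2 * l)) *\<^sub>R snd p)"

definition grushin_sqrtA :: "real \<Rightarrow> real \<times> (real ^ 'm) \<Rightarrow> real \<times> (real ^ 'm) \<Rightarrow> real \<times> (real ^ 'm)" where
  "grushin_sqrtA l X p = (fst p, (\<bar>fst X\<bar> powr l) *\<^sub>R snd p)"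

text \<open>The inverse of \<open>grushin_sqrtA l X\<close>, meaningful off the null set \<open>x = 0\<close>.\<close>

definition grushin_sqrtA_inv :: "real \<Rightarrow> real \<times> (real ^ 'm) \<Rightarrow> real \<times> (real ^ 'm) \<Rightarrow> real \<times> (real ^ 'm)" where
  "grushin_sqrtA_inv l X p = (fst p, (\<bar>fst X\<bar> powr (- l)) *\<^sub>R snd p)"

lemma grushin_sqrtA_sqrtA: "grushin_sqrtA l X (grushin_sqrtA l X p) = grushin_A l X p"
  by (simp add: grushin_sqrtA_def grushin_A_def flip: powr_add)

lemma grushin_sqrtA_inverse:
  assumes "fst X \<noteq> 0"
  shows "grushin_sqrtA l X (grushin_sqrtA_inv l X p) = p"
    and "grushin_sqrtA_inv l X (grushin_sqrtA l X p) = p"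
  using assms by (simp_all add: grushin_sqrtA_def grushin_sqrtA_inv_def flip: powr_add)

definition grushin_fields :: "real \<Rightarrow> (real \<times> (real ^ 'm) \<Rightarrow> real \<times> (real ^ 'm)) set" where
  "grushin_fields l =
     {(\<lambda>X. (s, 0)) | s. s \<in> {1, -1}} \<union>
     {(\<lambda>X. (0, (s * \<bar>fst X\<bar> powr l) *\<^sub>R axis j 1)) | s j. s \<in> {1, -1}}"

text \<open>The break points of the curve are \<open>t 0 < \<dots> < t k\<close>; derivatives at them are one-sided.\<close>

definition Lambda_connected :: "real \<Rightarrow> (real \<times> (real ^ 'm)) set \<Rightarrow> bool" where
  "Lambda_connected l \<Omega> \<longleftrightarrow>
     (\<forall>P\<in>\<Omega>. \<forall>Q\<in>\<Omega>. \<exists>\<gamma> (t :: nat \<Rightarrow> real) k.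
        continuous_on {t 0..t k} \<gamma> \<and> \<gamma> ` {t 0..t k} \<subseteq> \<Omega> \<and> \<gamma> (t 0) = P \<and> \<gamma> (t k) = Q \<and>
        (\<forall>i<k. t i < t (Suc i) \<and>
           (\<exists>V\<in>grushin_fields l. \<forall>s\<in>{t i..t (Suc i)}.
              (\<gamma> has_vector_derivative V (\<gamma> s)) (at s within {t i..t (Suc i)}))))"

definition compactly_contained :: "'a::topological_space set \<Rightarrow> 'a set \<Rightarrow> bool" where
  "compactly_contained \<Omega>' \<Omega> \<longleftrightarrow> compact (closure \<Omega>') \<and> closure \<Omega>' \<subseteq> \<Omega>"

definition grad :: "('a::euclidean_space \<Rightarrow> real) \<Rightarrow> 'a \<Rightarrow> 'a" where
  "grad u X = (THE D. GDERIV u X :> D)"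

text \<open>\<open>C^1\<close> functions with compact support in \<open>\<Omega>\<close>, extended by zero to the whole space.\<close>

definition C10 :: "'a::euclidean_space set \<Rightarrow> ('a \<Rightarrow> real) set" where
  "C10 \<Omega> = {v. (\<forall>X. v differentiable at X) \<and> continuous_on UNIV (grad v) \<and>
               compactly_contained {X. v X \<noteq> 0} \<Omega>}"

definition L2_fun :: "'a::euclidean_space set \<Rightarrow> ('a \<Rightarrow> 'b::euclidean_space) \<Rightarrow> bool" where
  "L2_fun \<Omega> g \<longleftrightarrow> g \<in> borel_measurable (lebesgue_on \<Omega>) \<and>
                  integrable (lebesgue_on \<Omega>) (\<lambda>X. (norm (g X))\<^sup>2)"

definition L2_lim :: "'a::euclidean_space set \<Rightarrow> (nat \<Rightarrow> 'a \<Rightarrow> 'b::euclidean_space) \<Rightarrow> ('a \<Rightarrow> 'b) \<Rightarrow> bool" where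
  "L2_lim \<Omega> g h \<longleftrightarrow> (\<forall>n. L2_fun \<Omega> (g n)) \<and> L2_fun \<Omega> h \<and>
     (\<lambda>n. \<integral>X. (norm (g n X - h X))\<^sup>2 \<partial>lebesgue_on \<Omega>) \<longlonglongrightarrow> 0"

definition norm0 :: "real \<Rightarrow> (real \<times> (real ^ 'm)) set \<Rightarrow> (real \<times> (real ^ 'm) \<Rightarrow> real) \<Rightarrow> real" where
  "norm0 l \<Omega> u = sqrt (\<integral>X. grushin_A l X (grad u X) \<bullet> grad u X \<partial>lebesgue_on \<Omega>)"

text \<open>The sequence \<open>\<phi>\<close> is \<open>norm0\<close>-Cauchy in \<open>C10 \<Omega>\<close> and represents the element of the completion
  that is identified with its \<open>L^2\<close>-limit \<open>u\<close>.  Functions are considered on \<open>\<Omega>\<close> up to null sets.\<close>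

definition H10_repr :: "real \<Rightarrow> (real \<times> (real ^ 'm)) set \<Rightarrow> (nat \<Rightarrow> real \<times> (real ^ 'm) \<Rightarrow> real) \<Rightarrow>
    (real \<times> (real ^ 'm) \<Rightarrow> real) \<Rightarrow> bool" where
  "H10_repr l \<Omega> \<phi> u \<longleftrightarrow>
     (\<forall>n. \<phi> n \<in> C10 \<Omega>) \<and>
     (\<forall>e>0. \<exists>M. \<forall>i\<ge>M. \<forall>j\<ge>M. norm0 l \<Omega> (\<lambda>X. \<phi> i X - \<phi> j X) < e) \<and>
     L2_lim \<Omega> \<phi> u"

definition H10 :: "real \<Rightarrow> (real \<times> (real ^ 'm)) set \<Rightarrow> (real \<times> (real ^ 'm) \<Rightarrow> real) set" where
  "H10 l \<Omega> = {u. \<exists>\<phi>. H10_repr l \<Omega> \<phi> u}"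

definition is_weak_quasi_grad :: "real \<Rightarrow> (real \<times> (real ^ 'm)) set \<Rightarrow> (real \<times> (real ^ 'm) \<Rightarrow> real) \<Rightarrow>
    (real \<times> (real ^ 'm) \<Rightarrow> real \<times> (real ^ 'm)) \<Rightarrow> bool" where
  "is_weak_quasi_grad l \<Omega> u G \<longleftrightarrow>
     (\<exists>\<phi> U. H10_repr l \<Omega> \<phi> u \<and>
        L2_lim \<Omega> (\<lambda>n X. grushin_sqrtA l X (grad (\<phi> n) X)) U \<and>
        (AE X in lebesgue_on \<Omega>. G X = grushin_sqrtA_inv l X (U X)))"

text \<open>The choice operator only selects a representative, since \<open>U\<close>, hence \<open>G\<close>, is determined by
  \<open>u\<close> up to null sets.\<close>

definition weak_quasi_grad :: "real \<Rightarrow> (real \<times> (real ^ 'm)) set \<Rightarrow> (real \<times> (real ^ 'm) \<Rightarrow> real) \<Rightarrow>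
    real \<times> (real ^ 'm) \<Rightarrow> real \<times> (real ^ 'm)" where
  "weak_quasi_grad l \<Omega> u = (SOME G. is_weak_quasi_grad l \<Omega> u G)"

text \<open>The boundary condition is encoded in \<open>u \<in> H10 l \<Omega>\<close>.\<close>

definition weak_solution :: "real \<Rightarrow> (real \<times> (real ^ 'm)) set \<Rightarrow> (real \<times> (real ^ 'm) \<Rightarrow> real) \<Rightarrow>
    (real \<times> (real ^ 'm) \<Rightarrow> real) \<Rightarrow> bool" where
  "weak_solution l \<Omega> f u \<longleftrightarrow>
     u \<in> H10 l \<Omega> \<and>
     (\<forall>\<Omega>'. compactly_contained \<Omega>' \<Omega> \<longrightarrow>
        (\<exists>C>0. AE X in lebesgue. X \<in> \<Omega>' \<longrightarrow> C \<le> u X)) \<and>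
     (\<forall>v\<in>C10 \<Omega>.
        (\<integral>X. grushin_A l X (weak_quasi_grad l \<Omega> u X) \<bullet> grad v X \<partial>lebesgue_on \<Omega>) =
        (\<integral>X. f X * v X / u X \<partial>lebesgue_on \<Omega>))"

end

theory Submission
  imports Defs
begin

text \<open>
  For existence, \<open>f\<close> is truncated at height \<open>n\<close> and \<open>1 / u\<close> is replaced by \<open>1 / (u + 1 / n)\<close>; the
  regularised problems are solved by minimising a uniformly convex energy.  Their solutions increase
  with \<open>n\<close> and converge in energy; the limit passes through the singular term because the
  first solution is bounded below on compact subsets.  This lower bound is a strong maximum principle
  for weak supersolutions.  Away from \<open>x = 0\<close>, testing with truncated near-fundamental solutions
  bounds all small ball averages of a nontrivial supersolution below, so it is positive on some ball.
  Positivity then spreads by comparison with barriers \<open>(R\<^sup>2 - dist\<^sup>2)\<^sup>k\<close> centred off \<open>x = 0\<close>, which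
  cross the degeneracy set, and connectedness of \<open>\<Omega>\<close> finishes the argument.  Uniqueness is the
  comparison principle, tested with functions supported where both solutions are bounded below.
\<close>

section \<open>Square integrable functions\<close>

text \<open>Two obstacles shape the proof. First, \<open>f / u\<close> is only known to be locally
  integrable, so it is not a functional on the energy space: the singular equation may be tested
  only with functions supported where \<open>u\<close> is bounded below. The regularised equations
  have L^2 right-hand sides and can be tested with their own solutions; as u times 1 / u is 1, this
  bounds the energies by the L^1 norm of \<open>f\<close>. Second, ellipticity degenerates on x = 0
  and supersolutions are mere L^2 classes without a continuous representative at hand. Near a point
  off x = 0, freezing the coefficient |x|^(2 l) leaves a Laplacian in dimension N = m + 1 with a
  Lipschitz error, and there an estimate of averages, converted by a covering argument, produces a
  first ball of positivity. The barriers that spread it meet x = 0 transversally, in the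
  nondegenerate x direction, so their centre is all that has to avoid this set. The energy space is
  a closure of \<open>C10\<close>; hence functions are carried as pairs of u and U, the latter being
  sqrt A applied to the gradient, no inverse weight occurs, and only C^1 operations are applied to
  them.\<close>

definition square_integrable :: "'a measure \<Rightarrow> ('a \<Rightarrow> 'b::euclidean_space) \<Rightarrow> bool" where
  "square_integrable M g \<longleftrightarrow> g \<in> borel_measurable M \<and> integrable M (\<lambda>x. (norm (g x))\<^sup>2)"

definition L2_tendsto :: "'a measure \<Rightarrow> (nat \<Rightarrow> 'a \<Rightarrow> 'b::euclidean_space) \<Rightarrow> ('a \<Rightarrow> 'b) \<Rightarrow> bool" where
  "L2_tendsto M g h \<longleftrightarrow> (\<forall>n. square_integrable M (g n)) \<and> square_integrable M h \<and>
     (\<lambda>n. \<integral>x. (norm (g n x - h x))\<^sup>2 \<partial>M) \<longlonglongrightarrow> 0"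

lemma square_integrable_measurable:
  "square_integrable M g \<Longrightarrow> g \<in> borel_measurable M"
  by (simp add: square_integrable_def)

lemma square_integrable_norm2: "square_integrable M g \<Longrightarrow> integrable M (\<lambda>x. (norm (g x))\<^sup>2)"
  by (simp add: square_integrable_def)

lemma norm_add_sq_le: "(norm (a + b))\<^sup>2 \<le> 2 * (norm a)\<^sup>2 + 2 * (norm (b::'a::real_inner))\<^sup>2"
proof -
  have "(norm (a + b))\<^sup>2 \<le> (norm a + norm b)\<^sup>2"
    by (intro power_mono norm_triangle_ineq) auto
  also have "\<dots> \<le> 2 * (norm a)\<^sup>2 + 2 * (norm b)\<^sup>2"
    using sum_squares_bound[of "norm a" "norm b"] by (simp add: power2_sum)
  finally show ?thesis .
qed

lemma square_integrable_add:
  assumes "square_integrable M g" "square_integrable M h"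
  shows "square_integrable M (\<lambda>x. g x + h x)"
  unfolding square_integrable_def
proof
  note [measurable] = assms[THEN square_integrable_measurable]
  show "(\<lambda>x. g x + h x) \<in> borel_measurable M" by measurable
  show "integrable M (\<lambda>x. (norm (g x + h x))\<^sup>2)"
    by (rule Bochner_Integration.integrable_bound
        [of _ "\<lambda>x. 2 * (norm (g x))\<^sup>2 + 2 * (norm (h x))\<^sup>2"])
      (use assms norm_add_sq_le in \<open>auto intro!: square_integrable_norm2\<close>)
qed

lemma square_integrable_bounded_mult:
  fixes m :: "'a \<Rightarrow> real"
  assumes "square_integrable M g" "m \<in> borel_measurable M" "\<And>x. x \<in> space M \<Longrightarrow> \<bar>m x\<bar> \<le> B"
  shows "square_integrable M (\<lambda>x. m x *\<^sub>R g x)"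
  unfolding square_integrable_def
proof
  note [measurable] = assms(2) assms(1)[THEN square_integrable_measurable]
  show "(\<lambda>x. m x *\<^sub>R g x) \<in> borel_measurable M" by measurable
  show "integrable M (\<lambda>x. (norm (m x *\<^sub>R g x))\<^sup>2)"
  proof (rule Bochner_Integration.integrable_bound[of _ "\<lambda>x. B\<^sup>2 * (norm (g x))\<^sup>2"])
    show "AE x in M. norm ((norm (m x *\<^sub>R g x))\<^sup>2) \<le> norm (B\<^sup>2 * (norm (g x))\<^sup>2)"
    proof (rule AE_I2)
      fix x assume "x \<in> space M"
      then have "(m x)\<^sup>2 \<le> B\<^sup>2" using assms(3) by (metis abs_ge_zero power2_abs power_mono)
      then show "norm ((norm (m x *\<^sub>R g x))\<^sup>2) \<le> norm (B\<^sup>2 * (norm (g x))\<^sup>2)"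
        by (simp add: power_mult_distrib mult_right_mono)
    qed
  qed (use assms(1) in \<open>auto intro!: square_integrable_norm2\<close>)
qed

lemma square_integrable_scaleR: "square_integrable M g \<Longrightarrow> square_integrable M (\<lambda>x. c *\<^sub>R g x)"
  by (rule square_integrable_bounded_mult[where B="\<bar>c\<bar>"]) auto

lemma square_integrable_minus: "square_integrable M g \<Longrightarrow> square_integrable M (\<lambda>x. - g x)"
  using square_integrable_scaleR[of M g "-1"] by simp

lemma square_integrable_diff:
  "square_integrable M g \<Longrightarrow> square_integrable M h \<Longrightarrow> square_integrable M (\<lambda>x. g x - h x)"
  using square_integrable_add[OF _ square_integrable_minus, of M g h] by simp

lemma square_integrable_inner:
  assumes "square_integrable M g" "square_integrable M h"
  shows "integrable M (\<lambda>x. g x \<bullet> h x)"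
proof (rule Bochner_Integration.integrable_bound[of _ "\<lambda>x. (norm (g x))\<^sup>2 + (norm (h x))\<^sup>2"])
  note [measurable] = assms[THEN square_integrable_measurable]
  show "(\<lambda>x. g x \<bullet> h x) \<in> borel_measurable M" by measurable
  show "AE x in M. norm (g x \<bullet> h x) \<le> norm ((norm (g x))\<^sup>2 + (norm (h x))\<^sup>2)"
  proof (rule AE_I2)
    fix x
    have "\<bar>g x \<bullet> h x\<bar> \<le> norm (g x) * norm (h x)" by (rule Cauchy_Schwarz_ineq2)
    also have "\<dots> \<le> (norm (g x))\<^sup>2 + (norm (h x))\<^sup>2"
      using sum_squares_bound[of "norm (g x)" "norm (h x)"]
        mult_nonneg_nonneg[OF norm_ge_zero[of "g x"] norm_ge_zero[of "h x"]] by linarith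
    finally show "norm (g x \<bullet> h x) \<le> norm ((norm (g x))\<^sup>2 + (norm (h x))\<^sup>2)" by simp
  qed
qed (use assms in \<open>auto intro!: square_integrable_norm2\<close>)

lemma square_integrable_mult:
  fixes g h :: "'a \<Rightarrow> real"
  shows "square_integrable M g \<Longrightarrow> square_integrable M h \<Longrightarrow> integrable M (\<lambda>x. g x * h x)"
  by (rule square_integrable_inner[of M g h, unfolded inner_real_def])

lemma square_integrable_const:
  "finite_measure M \<Longrightarrow> square_integrable M (\<lambda>x. c)"
  unfolding square_integrable_def by (intro conjI finite_measure.integrable_const) simp_all

lemma square_integrable_integrable:
  fixes g :: "'a \<Rightarrow> real"
  assumes "finite_measure M" "square_integrable M g"
  shows "integrable M g"
  using square_integrable_mult[OF assms(2) square_integrable_const[OF assms(1), of 1]]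
  unfolding mult_1_right .

text \<open>The squared norm as a quadratic polynomial in \<open>t\<close>. Its nonnegativity for
  every \<open>t\<close> is Cauchy-Schwarz, \<open>t = 1\<close> is polarisation, and
  \<open>t = -1\<close> compares the energies of two regularised solutions.\<close>

lemma integral_norm2_add:
  assumes "square_integrable M g" "square_integrable M h"
  shows "(\<integral>x. (norm (g x + t *\<^sub>R h x))\<^sup>2 \<partial>M) =
    (\<integral>x. (norm (g x))\<^sup>2 \<partial>M) + 2 * t * (\<integral>x. g x \<bullet> h x \<partial>M) + t\<^sup>2 * (\<integral>x. (norm (h x))\<^sup>2 \<partial>M)"
proof -
  note I = square_integrable_norm2[OF assms(1)] square_integrable_norm2[OF assms(2)]
    square_integrable_inner[OF assms]
  have "(norm (g x + t *\<^sub>R h x))\<^sup>2 = ((norm (g x))\<^sup>2 + 2 * t * (g x \<bullet> h x)) + t\<^sup>2 * (norm (h x))\<^sup>2" for x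
    by (simp add: power2_norm_eq_inner inner_add_left inner_add_right inner_commute
        power2_eq_square[of t])
  then show ?thesis using I by simp
qed

lemma L2_Cauchy_Schwarz:
  assumes "square_integrable M g" "square_integrable M h"
  shows "\<bar>\<integral>x. g x \<bullet> h x \<partial>M\<bar> \<le> sqrt (\<integral>x. (norm (g x))\<^sup>2 \<partial>M) * sqrt (\<integral>x. (norm (h x))\<^sup>2 \<partial>M)"
proof -
  define A B C where "A = (\<integral>x. (norm (g x))\<^sup>2 \<partial>M)" and "B = (\<integral>x. (norm (h x))\<^sup>2 \<partial>M)"
    and "C = (\<integral>x. g x \<bullet> h x \<partial>M)"
  have q: "0 \<le> A + 2 * t * C + t\<^sup>2 * B" for t
  proof -
    have "0 \<le> (\<integral>x. (norm (g x + t *\<^sub>R h x))\<^sup>2 \<partial>M)" by simp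
    then show ?thesis using integral_norm2_add[OF assms, of t] by (simp add: A_def B_def C_def)
  qed
  have B: "B \<ge> 0" and A: "A \<ge> 0" by (auto simp: A_def B_def)
  have "C\<^sup>2 \<le> A * B"
  proof (cases "B = 0")
    case True
    have "C = 0"
    proof (rule ccontr)
      assume "C \<noteq> 0"
      \<comment> \<open>With \<open>B = 0\<close> the polynomial is affine in \<open>t\<close>; at
        this \<open>t\<close> its value is -1.\<close>
      then show False using q[of "- (A + 1) / (2 * C)"] True by (simp add: field_simps)
    qed
    then show ?thesis using A B by simp
  next
    case False
    \<comment> \<open>The minimiser \<open>t = - C / B\<close>, multiplied through by
      \<open>B\<close>.\<close>
    have "0 \<le> B * (A + 2 * (- C / B) * C + (- C / B)\<^sup>2 * B)"
      by (rule mult_nonneg_nonneg[OF B q])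
    also have "\<dots> = A * B - C\<^sup>2" using False by (simp add: power2_eq_square algebra_simps)
    finally show ?thesis by simp
  qed
  then have "\<bar>C\<bar> \<le> sqrt (A * B)" by (simp add: real_le_rsqrt)
  then show ?thesis by (simp add: real_sqrt_mult A_def B_def C_def)
qed

lemma L2_triangle:
  assumes "square_integrable M g" "square_integrable M h"
  shows "sqrt (\<integral>x. (norm (g x + h x))\<^sup>2 \<partial>M) \<le>
     sqrt (\<integral>x. (norm (g x))\<^sup>2 \<partial>M) + sqrt (\<integral>x. (norm (h x))\<^sup>2 \<partial>M)"
proof (rule real_le_lsqrt)
  let ?A = "\<integral>x. (norm (g x))\<^sup>2 \<partial>M" and ?B = "\<integral>x. (norm (h x))\<^sup>2 \<partial>M"
  have "0 \<le> ?A" "0 \<le> ?B" by auto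
  then show "(\<integral>x. (norm (g x + h x))\<^sup>2 \<partial>M) \<le> (sqrt ?A + sqrt ?B)\<^sup>2"
    using integral_norm2_add[OF assms, of 1] L2_Cauchy_Schwarz[OF assms]
    by (simp add: power2_sum)
qed (auto intro!: add_nonneg_nonneg)

lemma L2_tendstoD:
  assumes "L2_tendsto M g h"
  shows "square_integrable M (g n)" "square_integrable M h"
    "(\<lambda>n. \<integral>x. (norm (g n x - h x))\<^sup>2 \<partial>M) \<longlonglongrightarrow> 0"
  using assms by (auto simp: L2_tendsto_def)

lemma L2_tendsto_bound:
  assumes "\<And>n. square_integrable M (g n)" "square_integrable M h"
    and "\<And>n. (\<integral>x. (norm (g n x - h x))\<^sup>2 \<partial>M) \<le> b n" "b \<longlonglongrightarrow> 0"
  shows "L2_tendsto M g h"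
  unfolding L2_tendsto_def
proof (intro conjI allI assms(1,2))
  show "(\<lambda>n. \<integral>x. (norm (g n x - h x))\<^sup>2 \<partial>M) \<longlonglongrightarrow> 0"
    by (rule tendsto_sandwich[OF _ _ tendsto_const assms(4)]) (simp_all add: assms(3))
qed

lemma L2_tendsto_const: "square_integrable M h \<Longrightarrow> L2_tendsto M (\<lambda>_. h) h"
  by (simp add: L2_tendsto_def)

lemma L2_tendsto_subseq: "L2_tendsto M g h \<Longrightarrow> strict_mono r \<Longrightarrow> L2_tendsto M (\<lambda>n. g (r n)) h"
  unfolding L2_tendsto_def
  using LIMSEQ_subseq_LIMSEQ[of "\<lambda>n. \<integral>x. (norm (g n x - h x))\<^sup>2 \<partial>M" 0 r]
  by (auto simp: o_def)

lemma L2_tendsto_add: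
  assumes "L2_tendsto M g h" "L2_tendsto M g' h'"
  shows "L2_tendsto M (\<lambda>n x. g n x + g' n x) (\<lambda>x. h x + h' x)"
proof (rule L2_tendsto_bound)
  note [simp] = L2_tendstoD[OF assms(1)] L2_tendstoD[OF assms(2)]
  note si = square_integrable_norm2 square_integrable_add square_integrable_diff
  show "(\<integral>x. (norm (g n x + g' n x - (h x + h' x)))\<^sup>2 \<partial>M)
    \<le> 2 * (\<integral>x. (norm (g n x - h x))\<^sup>2 \<partial>M) + 2 * (\<integral>x. (norm (g' n x - h' x))\<^sup>2 \<partial>M)" for n
  proof -
    have "(\<integral>x. (norm (g n x + g' n x - (h x + h' x)))\<^sup>2 \<partial>M)
      \<le> (\<integral>x. 2 * (norm (g n x - h x))\<^sup>2 + 2 * (norm (g' n x - h' x))\<^sup>2 \<partial>M)"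
    proof (rule integral_mono)
      show "(norm (g n x + g' n x - (h x + h' x)))\<^sup>2
          \<le> 2 * (norm (g n x - h x))\<^sup>2 + 2 * (norm (g' n x - h' x))\<^sup>2" for x
        using norm_add_sq_le[of "g n x - h x" "g' n x - h' x"] by (simp add: algebra_simps)
    qed (auto intro!: si Bochner_Integration.integrable_add)
    also have "\<dots> = 2 * (\<integral>x. (norm (g n x - h x))\<^sup>2 \<partial>M) + 2 * (\<integral>x. (norm (g' n x - h' x))\<^sup>2 \<partial>M)"
      by (subst Bochner_Integration.integral_add) (auto intro!: si)
    finally show ?thesis .
  qed
  show "(\<lambda>n. 2 * (\<integral>x. (norm (g n x - h x))\<^sup>2 \<partial>M) + 2 * (\<integral>x. (norm (g' n x - h' x))\<^sup>2 \<partial>M)) \<longlonglongrightarrow> 0"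
    by (auto intro!: tendsto_eq_intros L2_tendstoD(3)[OF assms(1)] L2_tendstoD(3)[OF assms(2)])
qed (auto intro!: square_integrable_add L2_tendstoD(1,2)[OF assms(1)] L2_tendstoD(1,2)[OF assms(2)])

lemma L2_tendsto_scaleR:
  assumes "L2_tendsto M g h"
  shows "L2_tendsto M (\<lambda>n x. c *\<^sub>R g n x) (\<lambda>x. c *\<^sub>R h x)"
  unfolding L2_tendsto_def
proof (intro conjI allI)
  have "(\<lambda>n. c\<^sup>2 * (\<integral>x. (norm (g n x - h x))\<^sup>2 \<partial>M)) \<longlonglongrightarrow> 0"
    using tendsto_mult_left[OF L2_tendstoD(3)[OF assms], of "c\<^sup>2"] by simp
  moreover have "(norm (c *\<^sub>R g n x - c *\<^sub>R h x))\<^sup>2 = c\<^sup>2 * (norm (g n x - h x))\<^sup>2" for n x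
    by (simp add: scaleR_diff_right[symmetric] power_mult_distrib del: scaleR_diff_right)
  ultimately show "(\<lambda>n. \<integral>x. (norm (c *\<^sub>R g n x - c *\<^sub>R h x))\<^sup>2 \<partial>M) \<longlonglongrightarrow> 0"
    by simp
qed (auto intro!: square_integrable_scaleR L2_tendstoD(1,2)[OF assms])

lemma L2_tendsto_norm:
  assumes "L2_tendsto M g h"
  shows "(\<lambda>n. sqrt (\<integral>x. (norm (g n x))\<^sup>2 \<partial>M)) \<longlonglongrightarrow> sqrt (\<integral>x. (norm (h x))\<^sup>2 \<partial>M)"
proof (rule LIM_zero_cancel, rule Lim_transform_bound)
  note T = L2_tendstoD[OF assms]
  show "\<forall>\<^sub>F n in sequentially. norm (sqrt (\<integral>x. (norm (g n x))\<^sup>2 \<partial>M) - sqrt (\<integral>x. (norm (h x))\<^sup>2 \<partial>M))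
      \<le> norm (sqrt (\<integral>x. (norm (g n x - h x))\<^sup>2 \<partial>M))"
  proof (intro always_eventually allI)
    fix n
    have "sqrt (\<integral>x. (norm (g n x))\<^sup>2 \<partial>M) \<le> sqrt (\<integral>x. (norm (g n x - h x))\<^sup>2 \<partial>M) + sqrt (\<integral>x. (norm (h x))\<^sup>2 \<partial>M)"
      using L2_triangle[OF square_integrable_diff[OF T(1) T(2)] T(2), of n] by simp
    moreover have "sqrt (\<integral>x. (norm (h x))\<^sup>2 \<partial>M) \<le> sqrt (\<integral>x. (norm (g n x - h x))\<^sup>2 \<partial>M) + sqrt (\<integral>x. (norm (g n x))\<^sup>2 \<partial>M)"
      using L2_triangle[OF square_integrable_diff[OF T(2) T(1)] T(1), of n n] by (simp add: norm_minus_commute)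
    ultimately show "norm (sqrt (\<integral>x. (norm (g n x))\<^sup>2 \<partial>M) - sqrt (\<integral>x. (norm (h x))\<^sup>2 \<partial>M))
      \<le> norm (sqrt (\<integral>x. (norm (g n x - h x))\<^sup>2 \<partial>M))" by simp
  qed
  have "(\<lambda>n. sqrt (\<integral>x. (norm (g n x - h x))\<^sup>2 \<partial>M)) \<longlonglongrightarrow> sqrt 0"
    by (intro tendsto_real_sqrt T)
  then show "(\<lambda>n. sqrt (\<integral>x. (norm (g n x - h x))\<^sup>2 \<partial>M)) \<longlonglongrightarrow> 0" by simp
qed

lemma L2_tendsto_norm2:
  assumes "L2_tendsto M g h"
  shows "(\<lambda>n. \<integral>x. (norm (g n x))\<^sup>2 \<partial>M) \<longlonglongrightarrow> (\<integral>x. (norm (h x))\<^sup>2 \<partial>M)"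
  using tendsto_power[OF L2_tendsto_norm[OF assms], of 2] by simp

lemma L2_tendsto_inner:
  assumes "L2_tendsto M g h" "L2_tendsto M g' h'"
  shows "(\<lambda>n. \<integral>x. g n x \<bullet> g' n x \<partial>M) \<longlonglongrightarrow> (\<integral>x. h x \<bullet> h' x \<partial>M)"
proof -
  have eq: "(\<integral>x. a x \<bullet> b x \<partial>M) = ((\<integral>x. (norm (a x + b x))\<^sup>2 \<partial>M) - (\<integral>x. (norm (a x))\<^sup>2 \<partial>M) - (\<integral>x. (norm (b x))\<^sup>2 \<partial>M)) / 2"
    if "square_integrable M a" "square_integrable M b" for a b :: "'a \<Rightarrow> 'b"
    using integral_norm2_add[OF that, of 1] by simp
  show ?thesis
    unfolding eq[OF L2_tendstoD(2)[OF assms(1)] L2_tendstoD(2)[OF assms(2)]]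
      eq[OF L2_tendstoD(1)[OF assms(1)] L2_tendstoD(1)[OF assms(2)]]
    by (intro tendsto_intros L2_tendsto_norm2 L2_tendsto_add assms) auto
qed

lemma integral_norm2_eq_0D:
  assumes "square_integrable M g" "(\<integral>x. (norm (g x))\<^sup>2 \<partial>M) = 0"
  shows "AE x in M. g x = 0"
proof -
  have "AE x in M. (norm (g x))\<^sup>2 = 0"
    using integral_nonneg_eq_0_iff_AE[OF square_integrable_norm2[OF assms(1)]] assms(2) by simp
  then show ?thesis by simp
qed

lemma L2_tendsto_AE_subseq:
  assumes "L2_tendsto M g h"
  shows "\<exists>r. strict_mono r \<and> (AE x in M. (\<lambda>n. g (r n) x) \<longlonglongrightarrow> h x)"
proof -
  note T = L2_tendstoD[OF assms]
  have "(\<lambda>n. \<integral>x. norm ((norm (g n x - h x))\<^sup>2) \<partial>M) \<longlonglongrightarrow> 0" using T(3) by simp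
  then obtain r :: "nat \<Rightarrow> nat" where r: "strict_mono r" "AE x in M. (\<lambda>n. (norm (g (r n) x - h x))\<^sup>2) \<longlonglongrightarrow> 0"
    using tendsto_L1_AE_subseq[of M "\<lambda>n x. (norm (g n x - h x))\<^sup>2"]
      square_integrable_norm2[OF square_integrable_diff[OF T(1) T(2)]] by blast
  have "(\<lambda>n. g (r n) x) \<longlonglongrightarrow> h x" if *: "(\<lambda>n. (norm (g (r n) x - h x))\<^sup>2) \<longlonglongrightarrow> 0" for x
  proof -
    have "(\<lambda>n. sqrt ((norm (g (r n) x - h x))\<^sup>2)) \<longlonglongrightarrow> sqrt 0"
      by (intro tendsto_real_sqrt *)
    then show ?thesis by (simp add: LIM_zero_iff tendsto_norm_zero_iff)
  qed
  then show ?thesis using r by auto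
qed

text \<open>Splits the difference into \<open>m n\<close> times \<open>g n - h\<close>, controlled
  by the bound \<open>B\<close>, and \<open>m n - m'\<close> times \<open>h\<close>, controlled by
  dominated convergence. A product limit in which one factor converges only almost everywhere is
  what the chain rule needs.\<close>

lemma L2_tendsto_bounded_mult:
  fixes m :: "nat \<Rightarrow> 'a \<Rightarrow> real"
  assumes "L2_tendsto M g h" and [measurable]: "\<And>n. m n \<in> borel_measurable M" "m' \<in> borel_measurable M"
    and B: "\<And>n x. x \<in> space M \<Longrightarrow> \<bar>m n x\<bar> \<le> B" "\<And>x. x \<in> space M \<Longrightarrow> \<bar>m' x\<bar> \<le> B"
    and lim: "AE x in M. (\<lambda>n. m n x) \<longlonglongrightarrow> m' x"
  shows "L2_tendsto M (\<lambda>n x. m n x *\<^sub>R g n x) (\<lambda>x. m' x *\<^sub>R h x)"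
proof -
  note T = L2_tendstoD[OF assms(1)]
  note [measurable] = T(1)[THEN square_integrable_measurable] T(2)[THEN square_integrable_measurable]
  have sh: "square_integrable M (\<lambda>x. m n x *\<^sub>R h x)" for n
    by (rule square_integrable_bounded_mult[OF T(2) _ B(1)]) auto
  have s1: "square_integrable M (\<lambda>x. m n x *\<^sub>R (g n x - h x))" for n
    by (rule square_integrable_bounded_mult[OF square_integrable_diff[OF T(1) T(2)] _ B(1)]) auto
  have sh': "square_integrable M (\<lambda>x. m' x *\<^sub>R h x)"
    by (rule square_integrable_bounded_mult[OF T(2) _ B(2)]) auto
  have A: "L2_tendsto M (\<lambda>n x. m n x *\<^sub>R (g n x - h x)) (\<lambda>x. 0)"
  proof (rule L2_tendsto_bound)
    show "(\<integral>x. (norm (m n x *\<^sub>R (g n x - h x) - 0))\<^sup>2 \<partial>M) \<le> B\<^sup>2 * (\<integral>x. (norm (g n x - h x))\<^sup>2 \<partial>M)" for n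
    proof -
      have "(\<integral>x. (norm (m n x *\<^sub>R (g n x - h x) - 0))\<^sup>2 \<partial>M) \<le> (\<integral>x. B\<^sup>2 * (norm (g n x - h x))\<^sup>2 \<partial>M)"
      proof (rule integral_mono)
        fix x assume "x \<in> space M"
        then have "(m n x)\<^sup>2 \<le> B\<^sup>2" using B(1) by (metis abs_ge_zero power2_abs power_mono)
        then show "(norm (m n x *\<^sub>R (g n x - h x) - 0))\<^sup>2 \<le> B\<^sup>2 * (norm (g n x - h x))\<^sup>2"
          by (simp add: power_mult_distrib mult_right_mono)
      next
        show "integrable M (\<lambda>x. (norm (m n x *\<^sub>R (g n x - h x) - 0))\<^sup>2)"
          using square_integrable_norm2[OF s1[of n]] by (simp only: diff_0_right)
        show "integrable M (\<lambda>x. B\<^sup>2 * (norm (g n x - h x))\<^sup>2)"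
          by (auto intro!: square_integrable_norm2 square_integrable_diff T)
      qed
      then show ?thesis by simp
    qed
    show "(\<lambda>n. B\<^sup>2 * (\<integral>x. (norm (g n x - h x))\<^sup>2 \<partial>M)) \<longlonglongrightarrow> 0"
      using tendsto_mult_left[OF T(3), of "B\<^sup>2"] by simp
  qed (rule s1 | simp add: square_integrable_def)+
  have "L2_tendsto M (\<lambda>n x. m n x *\<^sub>R h x) (\<lambda>x. m' x *\<^sub>R h x)"
    unfolding L2_tendsto_def
  proof (intro conjI allI sh sh')
    have "(\<lambda>n. \<integral>x. (norm (m n x *\<^sub>R h x - m' x *\<^sub>R h x))\<^sup>2 \<partial>M) \<longlonglongrightarrow> (\<integral>x. 0 \<partial>M)"
    proof (rule integral_dominated_convergence[where w="\<lambda>x. (2 * B)\<^sup>2 * (norm (h x))\<^sup>2"])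
      show "AE x in M. (\<lambda>n. (norm (m n x *\<^sub>R h x - m' x *\<^sub>R h x))\<^sup>2) \<longlonglongrightarrow> 0"
        using lim
      proof eventually_elim
        case (elim x)
        have "(\<lambda>n. (norm (m n x *\<^sub>R h x - m' x *\<^sub>R h x))\<^sup>2) \<longlonglongrightarrow> (norm (m' x *\<^sub>R h x - m' x *\<^sub>R h x))\<^sup>2"
          by (intro tendsto_intros elim)
        then show ?case by simp
      qed
      show "AE x in M. norm ((norm (m n x *\<^sub>R h x - m' x *\<^sub>R h x))\<^sup>2) \<le> (2 * B)\<^sup>2 * (norm (h x))\<^sup>2" for n
      proof (rule AE_I2)
        fix x assume "x \<in> space M"
        then have "\<bar>m n x - m' x\<bar> \<le> 2 * B" using B(1)[of x n] B(2)[of x] by linarith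
        then have "\<bar>m n x - m' x\<bar>\<^sup>2 \<le> (2 * B)\<^sup>2" by (intro power_mono) auto
        then show "norm ((norm (m n x *\<^sub>R h x - m' x *\<^sub>R h x))\<^sup>2) \<le> (2 * B)\<^sup>2 * (norm (h x))\<^sup>2"
          by (simp add: scaleR_diff_left[symmetric] power_mult_distrib mult_right_mono
              del: scaleR_diff_left)
      qed
    qed (use T in \<open>auto intro!: square_integrable_norm2\<close>)
    then show "(\<lambda>n. \<integral>x. (norm (m n x *\<^sub>R h x - m' x *\<^sub>R h x))\<^sup>2 \<partial>M) \<longlonglongrightarrow> 0" by simp
  qed
  from L2_tendsto_add[OF A this] show ?thesis by (simp add: algebra_simps)
qed

lemma summable_weighted_squares:
  fixes a :: "nat \<Rightarrow> real"
  assumes "summable (\<lambda>k. 2 ^ k * (a k)\<^sup>2)"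
  shows "summable a"
proof -
  have g: "summable (\<lambda>k. (1/2::real) ^ k)" by (rule summable_geometric) simp
  show ?thesis
  proof (rule summable_comparison_test'[OF summable_add[OF assms g], of 0])
    fix k
    define s where "s = (sqrt 2) ^ k"
    have s: "s > 0" "s\<^sup>2 = 2 ^ k"
      unfolding s_def power_mult[symmetric] mult.commute[of k 2] by (simp_all add: power_mult)
    \<comment> \<open>Arithmetic-geometric mean with s = 2^(k/2): the weight 2^k pays for the
      passage from squares to first powers, at the cost of a geometric series.\<close>
    have "2 * (s * \<bar>a k\<bar>) * (1 / s) \<le> (s * \<bar>a k\<bar>)\<^sup>2 + (1 / s)\<^sup>2"
      by (rule sum_squares_bound)
    then have "2 * \<bar>a k\<bar> \<le> 2 ^ k * (a k)\<^sup>2 + (1 / 2) ^ k"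
      using s by (simp add: power_mult_distrib power_divide)
    then show "norm (a k) \<le> 2 ^ k * (a k)\<^sup>2 + (1 / 2) ^ k" by simp
  qed
qed

text \<open>Riesz-Fischer for vector-valued functions: a rapidly Cauchy subsequence converges almost
  everywhere, and Fatou's lemma carries the Cauchy bound to the limit.\<close>

lemma L2_complete:
  fixes g :: "nat \<Rightarrow> 'a \<Rightarrow> 'b::euclidean_space"
  assumes si: "\<And>n. square_integrable M (g n)"
    and C: "\<And>e. e > 0 \<Longrightarrow> \<exists>N. \<forall>i\<ge>N. \<forall>j\<ge>N. (\<integral>x. (norm (g i x - g j x))\<^sup>2 \<partial>M) < e"
  shows "\<exists>h. L2_tendsto M g h"
proof -
  note [measurable] = si[THEN square_integrable_measurable]
  have I: "integrable M (\<lambda>x. (norm (g i x - g j x))\<^sup>2)" for i j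
    by (intro square_integrable_norm2 square_integrable_diff si)
  \<comment> \<open>The rate (1/4)^k leaves a summable (1/2)^k after multiplication by the weight
    2^k that \<open>summable_weighted_squares\<close> asks for.\<close>
  have "\<exists>N. \<forall>i\<ge>N. \<forall>j\<ge>N. (\<integral>x. (norm (g i x - g j x))\<^sup>2 \<partial>M) < (1/4) ^ k" for k
    using C[of "(1/4)^k"] by simp
  then obtain N where N: "\<And>k i j. i \<ge> N k \<Longrightarrow> j \<ge> N k \<Longrightarrow> (\<integral>x. (norm (g i x - g j x))\<^sup>2 \<partial>M) < (1/4) ^ k"
    by metis
  \<comment> \<open>Partial sums of \<open>N\<close> give an index that lies above all earlier
    thresholds at once.\<close>
  define r where "r k = (\<Sum>i\<le>k. N i)" for k
  have rN: "N j \<le> r k" if "j \<le> k" for j k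
    unfolding r_def using that by (intro member_le_sum) auto
  define d where "d k x = norm (g (r (Suc k)) x - g (r k) x)" for k x
  have [measurable]: "d k \<in> borel_measurable M" for k unfolding d_def by measurable
  have d: "(\<integral>\<^sup>+x. ennreal (2 ^ k * (d k x)\<^sup>2) \<partial>M) \<le> ennreal ((1/2) ^ k)" for k
  proof -
    have "(\<integral>\<^sup>+x. ennreal (2 ^ k * (d k x)\<^sup>2) \<partial>M) = ennreal (\<integral>x. 2 ^ k * (d k x)\<^sup>2 \<partial>M)"
      unfolding d_def by (rule nn_integral_eq_integral) (auto intro!: I)
    also have "\<dots> \<le> ennreal ((1/2) ^ k)"
    proof (rule ennreal_leI)
      have "(\<integral>x. (d k x)\<^sup>2 \<partial>M) \<le> (1/4) ^ k" unfolding d_def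
        using N[of k "r (Suc k)" "r k"] rN by (simp add: less_imp_le)
      then have "2 ^ k * (\<integral>x. (d k x)\<^sup>2 \<partial>M) \<le> 2 ^ k * (1/4) ^ k" by simp
      also have "\<dots> = (1/2::real) ^ k" by (simp add: power_mult_distrib[symmetric])
      finally show "(\<integral>x. 2 ^ k * (d k x)\<^sup>2 \<partial>M) \<le> (1/2) ^ k" by simp
    qed
    finally show ?thesis .
  qed
  have "(\<integral>\<^sup>+x. (\<Sum>k. ennreal (2 ^ k * (d k x)\<^sup>2)) \<partial>M) = (\<Sum>k. \<integral>\<^sup>+x. ennreal (2 ^ k * (d k x)\<^sup>2) \<partial>M)"
    by (rule nn_integral_suminf) measurable
  also have "\<dots> \<le> (\<Sum>k. ennreal ((1/2) ^ k))" by (intro suminf_le d) auto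
  also have "\<dots> = ennreal (\<Sum>k. (1/2) ^ k)"
    by (rule suminf_ennreal2) (auto intro: summable_geometric)
  finally have "(\<integral>\<^sup>+x. (\<Sum>k. ennreal (2 ^ k * (d k x)\<^sup>2)) \<partial>M) \<noteq> \<infinity>"
    by (auto simp: top_unique)
  then have "AE x in M. (\<Sum>k. ennreal (2 ^ k * (d k x)\<^sup>2)) \<noteq> \<infinity>"
    by (intro nn_integral_PInf_AE) measurable
  then have conv: "AE x in M. convergent (\<lambda>k. g (r k) x)"
  proof eventually_elim
    case (elim x)
    have "summable (\<lambda>k. 2 ^ k * (d k x)\<^sup>2)"
      using elim[unfolded infinity_ennreal_def] by (intro summable_suminf_not_top) simp_all
    then have "summable (\<lambda>k. norm (g (r (Suc k)) x - g (r k) x))"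
      unfolding d_def[symmetric] by (rule summable_weighted_squares)
    then have "summable (\<lambda>k. g (r (Suc k)) x - g (r k) x)" by (rule summable_norm_cancel)
    then have "convergent (\<lambda>n. (\<Sum>k<n. g (r (Suc k)) x - g (r k) x))"
      by (simp add: summable_iff_convergent)
    then have "convergent (\<lambda>n. g (r n) x - g (r 0) x)" by (simp only: sum_lessThan_telescope[of "\<lambda>k. g (r k) x"])
    then show ?case using convergent_add[of "\<lambda>n. g (r n) x - g (r 0) x" "\<lambda>_. g (r 0) x"]
      by (simp add: convergent_const)
  qed
  define h where "h x = lim (\<lambda>k. g (r k) x)" for x
  have [measurable]: "h \<in> borel_measurable M" unfolding h_def by measurable
  have conv: "AE x in M. (\<lambda>k. g (r k) x) \<longlonglongrightarrow> h x"
    using conv by eventually_elim (simp add: h_def convergent_LIMSEQ_iff)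
  \<comment> \<open>Fatou compares the limit with every \<open>g i\<close> past the threshold, so
    the whole sequence converges and not only the subsequence.\<close>
  have bd: "(\<integral>\<^sup>+x. ennreal ((norm (g i x - h x))\<^sup>2) \<partial>M) \<le> ennreal ((1/4) ^ k)" if "i \<ge> N k" for i k
  proof -
    have "(\<integral>\<^sup>+x. ennreal ((norm (g i x - h x))\<^sup>2) \<partial>M)
        = (\<integral>\<^sup>+x. liminf (\<lambda>j. ennreal ((norm (g i x - g (r j) x))\<^sup>2)) \<partial>M)"
    proof (rule nn_integral_cong_AE, use conv in eventually_elim)
      case (elim x)
      have "(\<lambda>j. ennreal ((norm (g i x - g (r j) x))\<^sup>2)) \<longlonglongrightarrow> ennreal ((norm (g i x - h x))\<^sup>2)"
        by (intro tendsto_ennrealI tendsto_intros elim)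
      then show ?case by (metis lim_imp_Liminf trivial_limit_sequentially)
    qed
    also have "\<dots> \<le> liminf (\<lambda>j. \<integral>\<^sup>+x. ennreal ((norm (g i x - g (r j) x))\<^sup>2) \<partial>M)"
      by (rule nn_integral_liminf) measurable
    also have "\<dots> \<le> limsup (\<lambda>j. \<integral>\<^sup>+x. ennreal ((norm (g i x - g (r j) x))\<^sup>2) \<partial>M)"
      by (rule Liminf_le_Limsup) simp
    also have "\<dots> \<le> ennreal ((1/4) ^ k)"
    proof (rule Limsup_bounded, rule eventually_sequentiallyI[of k])
      fix j assume "k \<le> j"
      then have "(\<integral>x. (norm (g i x - g (r j) x))\<^sup>2 \<partial>M) \<le> (1/4) ^ k"
        using N[of k i "r j"] that rN[of k j] by (simp add: less_imp_le)
      then show "(\<integral>\<^sup>+x. ennreal ((norm (g i x - g (r j) x))\<^sup>2) \<partial>M) \<le> ennreal ((1/4) ^ k)"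
        by (subst nn_integral_eq_integral) (auto intro!: I ennreal_leI)
    qed
    finally show ?thesis .
  qed
  have int: "integrable M (\<lambda>x. (norm (g i x - h x))\<^sup>2)" if "i \<ge> N k" for i k
    using bd[OF that] by (intro integrableI_bounded) (auto simp: le_less_trans)
  have "square_integrable M (\<lambda>x. g (N 0) x - h x)"
    using int[of 0 "N 0"] by (simp add: square_integrable_def)
  from square_integrable_diff[OF si[of "N 0"] this] have sh: "square_integrable M h" by simp
  have "(\<lambda>i. \<integral>x. (norm (g i x - h x))\<^sup>2 \<partial>M) \<longlonglongrightarrow> 0"
  proof (rule LIMSEQ_I)
    fix e :: real assume "e > 0"
    then obtain k where k: "(1/4) ^ k < e" using real_arch_pow_inv[of e "1/4"] by auto
    have "\<bar>\<integral>x. (norm (g i x - h x))\<^sup>2 \<partial>M\<bar> < e" if "i \<ge> N k" for i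
    proof -
      have "ennreal (\<integral>x. (norm (g i x - h x))\<^sup>2 \<partial>M) \<le> ennreal ((1/4) ^ k)"
        using bd[OF that] by (subst (asm) nn_integral_eq_integral) (auto intro!: int[OF that])
      then show ?thesis using k by (simp add: ennreal_le_iff)
    qed
    then show "\<exists>no. \<forall>i\<ge>no. norm ((\<integral>x. (norm (g i x - h x))\<^sup>2 \<partial>M) - 0) < e" by auto
  qed
  then show ?thesis using si sh by (auto simp: L2_tendsto_def)
qed

section \<open>Compactly supported \<open>C\<^sup>1\<close> functions\<close>

lemma GDERIV_unique:
  assumes "GDERIV u X :> D" "GDERIV u X :> D'"
  shows "D = D'"
proof -
  have "(\<lambda>h. inner h D) = (\<lambda>h. inner h D')"
    using assms unfolding gderiv_def by (rule has_derivative_unique)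
  then have "inner h (D - D') = 0" for h by (metis inner_diff_right right_minus_eq)
  from this[of "D - D'"] show ?thesis by simp
qed

lemma grad_eqI: "GDERIV u X :> D \<Longrightarrow> grad u X = D"
  unfolding grad_def by (rule the_equality) (auto intro: GDERIV_unique)

text \<open>The Riesz representative of the derivative gives the definite description in
  \<open>grad\<close> its value.\<close>

lemma GDERIV_grad:
  fixes u :: "'a::euclidean_space \<Rightarrow> real"
  assumes "u differentiable at X"
  shows "GDERIV u X :> grad u X"
proof -
  obtain f' where f': "(u has_derivative f') (at X)" using assms by (auto simp: differentiable_def)
  then have lin: "linear f'" by (rule has_derivative_linear)
  define D where "D = (\<Sum>b\<in>Basis. f' b *\<^sub>R b)"
  have "f' h = inner h D" for h
  proof -
    have "f' h = f' (\<Sum>b\<in>Basis. (h \<bullet> b) *\<^sub>R b)" by (simp add: euclidean_representation)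
    also have "\<dots> = (\<Sum>b\<in>Basis. (h \<bullet> b) * f' b)"
      by (simp add: linear_sum[OF lin] linear_scale[OF lin])
    also have "\<dots> = inner h D" by (simp add: D_def inner_sum_right mult.commute)
    finally show ?thesis .
  qed
  then have "f' = (\<lambda>h. inner h D)" by auto
  then have "GDERIV u X :> D" using f' by (simp add: gderiv_def)
  then show ?thesis using grad_eqI by metis
qed

lemma GDERIV_continuous: "GDERIV u X :> D \<Longrightarrow> isCont u X"
  unfolding gderiv_def by (rule has_derivative_continuous)

lemma GDERIV_cong_open:
  assumes "GDERIV u X :> D" "open S" "X \<in> S" "\<And>Y. Y \<in> S \<Longrightarrow> u Y = v Y"
  shows "GDERIV v X :> D"
  using assms unfolding gderiv_def by (meson has_derivative_transform_within_open)

lemma GDERIV_DERIV_line: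
  assumes "GDERIV u (X + t *\<^sub>R e) :> D"
  shows "((\<lambda>t. u (X + t *\<^sub>R e)) has_field_derivative (D \<bullet> e)) (at t)"
proof -
  have "((\<lambda>t. X + t *\<^sub>R e) has_derivative (\<lambda>s. s *\<^sub>R e)) (at t)"
    by (auto intro!: derivative_eq_intros)
  from has_derivative_compose[OF this assms[unfolded gderiv_def]]
  show ?thesis by (simp add: has_field_derivative_def inner_commute mult_commute_abs)
qed

lemma C10_GDERIV: "v \<in> C10 \<Omega> \<Longrightarrow> GDERIV v X :> grad v X"
  by (simp add: C10_def GDERIV_grad)

lemma C10_continuous: "v \<in> C10 \<Omega> \<Longrightarrow> continuous_on UNIV v"
  using C10_GDERIV GDERIV_continuous by (metis continuous_at_imp_continuous_on)

lemma C10_grad_continuous: "v \<in> C10 \<Omega> \<Longrightarrow> continuous_on UNIV (grad v)"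
  by (simp add: C10_def)

lemma C10I:
  fixes v :: "'a::euclidean_space \<Rightarrow> real"
  assumes D: "\<And>X. GDERIV v X :> D X" "continuous_on UNIV D"
    and K: "compact K" "K \<subseteq> \<Omega>" "\<And>X. X \<notin> K \<Longrightarrow> v X = 0"
  shows "v \<in> C10 \<Omega>" "grad v = D"
proof -
  show g: "grad v = D" using D(1) grad_eqI by blast
  have d: "v differentiable at X" for X using D(1) unfolding gderiv_def differentiable_def by blast
  have sub: "closure {X. v X \<noteq> 0} \<subseteq> K"
    using K by (intro closure_minimal compact_imp_closed) auto
  have c: "compact (closure {X. v X \<noteq> 0})"
    using compact_Int_closed[OF K(1) closed_closure, of "{X. v X \<noteq> 0}"] sub
    by (simp add: inf_absorb2)
  show "v \<in> C10 \<Omega>"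
    unfolding C10_def compactly_contained_def mem_Collect_eq g
    by (intro conjI allI d D(2) c subset_trans[OF sub K(2)])
qed

lemma C10_support:
  assumes "v \<in> C10 \<Omega>"
  obtains K where "compact K" "K \<subseteq> \<Omega>" "\<And>X. X \<notin> K \<Longrightarrow> v X = 0" "\<And>X. X \<notin> K \<Longrightarrow> grad v X = 0"
proof
  let ?K = "closure {X. v X \<noteq> 0}"
  show "compact ?K" "?K \<subseteq> \<Omega>" using assms by (auto simp: C10_def compactly_contained_def)
  show *: "v X = 0" if "X \<notin> ?K" for X using that closure_subset[of "{X. v X \<noteq> 0}"] by auto
  show "grad v X = 0" if "X \<notin> ?K" for X
  proof (rule grad_eqI, rule GDERIV_cong_open[where u="\<lambda>_. 0" and S="- ?K"])
    show "open (- ?K)" by auto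
    show "GDERIV (\<lambda>_. 0) X :> 0" by (rule GDERIV_const)
    show "X \<in> - ?K" using that by simp
    show "0 = v Y" if "Y \<in> - ?K" for Y using *[of Y] that by simp
  qed
qed

lemma C10_mono: "v \<in> C10 \<Omega> \<Longrightarrow> \<Omega> \<subseteq> \<Omega>' \<Longrightarrow> v \<in> C10 \<Omega>'"
  by (auto simp: C10_def compactly_contained_def)

lemma C10_add:
  assumes "u \<in> C10 \<Omega>" "v \<in> C10 \<Omega>"
  shows "(\<lambda>X. u X + v X) \<in> C10 \<Omega>" "grad (\<lambda>X. u X + v X) = (\<lambda>X. grad u X + grad v X)"
proof -
  obtain K where K: "compact K" "K \<subseteq> \<Omega>" "\<And>X. X \<notin> K \<Longrightarrow> u X = 0" "\<And>X. X \<notin> K \<Longrightarrow> grad u X = 0"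
    by (rule C10_support[OF assms(1)], rule that)
  obtain L where L: "compact L" "L \<subseteq> \<Omega>" "\<And>X. X \<notin> L \<Longrightarrow> v X = 0" "\<And>X. X \<notin> L \<Longrightarrow> grad v X = 0"
    by (rule C10_support[OF assms(2)], rule that)
  note I = C10I[of "\<lambda>X. u X + v X" "\<lambda>X. grad u X + grad v X" "K \<union> L" \<Omega>]
  have "GDERIV (\<lambda>X. u X + v X) X :> grad u X + grad v X" for X
    by (intro GDERIV_add C10_GDERIV[OF assms(1)] C10_GDERIV[OF assms(2)])
  moreover have "continuous_on UNIV (\<lambda>X. grad u X + grad v X)"
    by (intro continuous_intros C10_grad_continuous[OF assms(1)] C10_grad_continuous[OF assms(2)])
  ultimately show "(\<lambda>X. u X + v X) \<in> C10 \<Omega>" "grad (\<lambda>X. u X + v X) = (\<lambda>X. grad u X + grad v X)"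
    using I K L by auto
qed

lemma C10_mult:
  assumes "u \<in> C10 \<Omega>" "\<And>X. GDERIV v X :> D X" "continuous_on UNIV D"
  shows "(\<lambda>X. u X * v X) \<in> C10 \<Omega>" "grad (\<lambda>X. u X * v X) = (\<lambda>X. u X *\<^sub>R D X + v X *\<^sub>R grad u X)"
proof -
  obtain K where K: "compact K" "K \<subseteq> \<Omega>" "\<And>X. X \<notin> K \<Longrightarrow> u X = 0" "\<And>X. X \<notin> K \<Longrightarrow> grad u X = 0"
    by (rule C10_support[OF assms(1)], rule that)
  note I = C10I[of "\<lambda>X. u X * v X" "\<lambda>X. u X *\<^sub>R D X + v X *\<^sub>R grad u X" K \<Omega>]
  have "GDERIV (\<lambda>X. u X * v X) X :> u X *\<^sub>R D X + v X *\<^sub>R grad u X" for X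
    by (intro GDERIV_mult C10_GDERIV[OF assms(1)] assms(2))
  moreover have "continuous_on UNIV (\<lambda>X. u X *\<^sub>R D X + v X *\<^sub>R grad u X)"
    using GDERIV_continuous[OF assms(2)]
    by (intro continuous_intros C10_grad_continuous[OF assms(1)] C10_continuous[OF assms(1)] assms(3)
      continuous_at_imp_continuous_on) auto
  ultimately show "(\<lambda>X. u X * v X) \<in> C10 \<Omega>"
    "grad (\<lambda>X. u X * v X) = (\<lambda>X. u X *\<^sub>R D X + v X *\<^sub>R grad u X)"
    using I K by auto
qed

lemma C10_cmult:
  assumes "u \<in> C10 \<Omega>"
  shows "(\<lambda>X. c * u X) \<in> C10 \<Omega>" "grad (\<lambda>X. c * u X) = (\<lambda>X. c *\<^sub>R grad u X)"
  using C10_mult[OF assms GDERIV_const[of c], OF continuous_on_const] by (simp_all add: mult.commute)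

lemma C10_diff:
  assumes "u \<in> C10 \<Omega>" "v \<in> C10 \<Omega>"
  shows "(\<lambda>X. u X - v X) \<in> C10 \<Omega>" "grad (\<lambda>X. u X - v X) = (\<lambda>X. grad u X - grad v X)"
  using C10_add[OF assms(1) C10_cmult(1)[OF assms(2)], of "-1"] C10_cmult(2)[OF assms(2), of "-1"] by simp_all

lemma C10_mult_C10:
  assumes "u \<in> C10 \<Omega>" "v \<in> C10 \<Omega>"
  shows "(\<lambda>X. u X * v X) \<in> C10 \<Omega>" "grad (\<lambda>X. u X * v X) = (\<lambda>X. u X *\<^sub>R grad v X + v X *\<^sub>R grad u X)"
  by (rule C10_mult[OF assms(1) C10_GDERIV[OF assms(2)] C10_grad_continuous[OF assms(2)]])+

lemma C10_compose:
  assumes "u \<in> C10 \<Omega>" "\<And>t::real. (\<beta> has_field_derivative \<beta>' t) (at t)" "continuous_on UNIV \<beta>'" "\<beta> 0 = 0"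
  shows "(\<lambda>X. \<beta> (u X)) \<in> C10 \<Omega>" "grad (\<lambda>X. \<beta> (u X)) = (\<lambda>X. \<beta>' (u X) *\<^sub>R grad u X)"
proof -
  obtain K where K: "compact K" "K \<subseteq> \<Omega>" "\<And>X. X \<notin> K \<Longrightarrow> u X = 0" "\<And>X. X \<notin> K \<Longrightarrow> grad u X = 0"
    by (rule C10_support[OF assms(1)], rule that)
  note I = C10I[of "\<lambda>X. \<beta> (u X)" "\<lambda>X. \<beta>' (u X) *\<^sub>R grad u X" K \<Omega>]
  have "GDERIV (\<lambda>X. \<beta> (u X)) X :> \<beta>' (u X) *\<^sub>R grad u X" for X
    by (intro GDERIV_DERIV_compose C10_GDERIV[OF assms(1)] assms(2))
  moreover have "continuous_on UNIV (\<lambda>X. \<beta>' (u X) *\<^sub>R grad u X)"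
    by (intro continuous_intros C10_grad_continuous[OF assms(1)]
      continuous_on_compose2[OF assms(3) C10_continuous[OF assms(1)]]) auto
  ultimately show "(\<lambda>X. \<beta> (u X)) \<in> C10 \<Omega>" "grad (\<lambda>X. \<beta> (u X)) = (\<lambda>X. \<beta>' (u X) *\<^sub>R grad u X)"
    using I K assms(4) by auto
qed

lemma C10_zero: "(\<lambda>_. 0) \<in> C10 \<Omega>" "grad (\<lambda>_. 0) = (\<lambda>_. 0)"
  by (rule C10I[of "\<lambda>_. 0" "\<lambda>_. 0" "{}"]; simp add: GDERIV_const)+

lemma continuous_bounded_on_ball:
  fixes f :: "'a::euclidean_space \<Rightarrow> 'b::real_normed_vector"
  assumes "continuous_on UNIV f"
  obtains B where "B \<ge> 0" "\<And>X. X \<in> cball 0 r \<Longrightarrow> norm (f X) \<le> B"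
proof -
  have "compact (f ` cball 0 r)"
    by (intro compact_continuous_image continuous_on_subset[OF assms]) auto
  then have "bounded (f ` cball 0 r)" by (rule compact_imp_bounded)
  then obtain B where "B > 0" "\<And>X. X \<in> cball 0 r \<Longrightarrow> norm (f X) \<le> B"
    by (auto simp: bounded_pos)
  then show ?thesis using that[of B] by auto
qed

lemma C10_bounded:
  assumes "v \<in> C10 \<Omega>"
  obtains B where "B \<ge> 0" "\<And>X. \<bar>v X\<bar> \<le> B" "\<And>X. norm (grad v X) \<le> B"
proof -
  obtain K where K: "compact K" "K \<subseteq> \<Omega>" "\<And>X. X \<notin> K \<Longrightarrow> v X = 0" "\<And>X. X \<notin> K \<Longrightarrow> grad v X = 0"
    by (rule C10_support[OF assms], rule that)
  obtain r where r: "K \<subseteq> cball 0 r" using compact_imp_bounded[OF K(1)] by (force simp: bounded_iff)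
  obtain A where A: "A \<ge> 0" "\<And>X. X \<in> cball 0 r \<Longrightarrow> norm (v X) \<le> A"
    by (rule continuous_bounded_on_ball[where r=r, OF C10_continuous[OF assms]], rule that)
  obtain B where B: "B \<ge> 0" "\<And>X. X \<in> cball 0 r \<Longrightarrow> norm (grad v X) \<le> B"
    by (rule continuous_bounded_on_ball[where r=r, OF C10_grad_continuous[OF assms]], rule that)
  show ?thesis
  proof (rule that[of "A + B"])
    fix X
    have *: "X \<in> K \<Longrightarrow> X \<in> cball 0 r" using r by auto
    show "\<bar>v X\<bar> \<le> A + B"
    proof (cases "X \<in> K")
      case True
      then show ?thesis using A(2)[OF *] B(1) by simp
    qed (use A B K(3) in simp)
    show "norm (grad v X) \<le> A + B"
    proof (cases "X \<in> K")
      case True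
      then show ?thesis using B(2)[OF *] A(1) by simp
    qed (use A B K(4) in simp)
  qed (use A B in auto)
qed

section \<open>Integrals of derivatives against invariant weights\<close>

lemma integral_lborel_shift:
  fixes f :: "'a::euclidean_space \<Rightarrow> real"
  assumes "continuous_on UNIV f"
  shows "(\<integral>X. f (X + c) \<partial>lborel) = (\<integral>X. f X \<partial>lborel)"
proof -
  have "(\<integral>X. f X \<partial>lborel) = (\<integral>X. f X \<partial>distr lborel borel ((+) c))"
    by (simp add: lborel_distr_plus)
  also have "\<dots> = (\<integral>X. f (c + X) \<partial>lborel)"
    by (rule integral_distr) (use assms in \<open>auto intro: borel_measurable_continuous_onI\<close>)
  finally show ?thesis by (simp add: add.commute)
qed

lemma integrable_lborel_compact_support:
  fixes f :: "'a::euclidean_space \<Rightarrow> real"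
  assumes "continuous_on UNIV f" "\<And>X. X \<notin> cball 0 r \<Longrightarrow> f X = 0"
  shows "integrable lborel f"
proof -
  obtain B where B: "B \<ge> 0" "\<And>X. X \<in> cball 0 r \<Longrightarrow> norm (f X) \<le> B"
    by (rule continuous_bounded_on_ball[where r=r, OF assms(1)], rule that)
  have "integrable lborel (\<lambda>X::'a. indicator (cball 0 r) X * B)"
    using emeasure_lborel_cball_finite[of "0::'a" r] by (intro integrable_mult_left integrable_real_indicator) auto
  then show ?thesis
    by (rule Bochner_Integration.integrable_bound)
      (use assms B in \<open>auto intro!: borel_measurable_continuous_onI AE_I2 split: split_indicator\<close>)
qed

text \<open>Integrating the difference quotients and using translation invariance of \<open>lborel\<close> replaces
  Fubini's theorem here.\<close>

lemma integral_weight_derivative_eq_0: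
  fixes F :: "'a::euclidean_space \<Rightarrow> real"
  assumes F: "F \<in> C10 UNIV" and w: "continuous_on UNIV w" and inv: "\<And>X t. w (X + t *\<^sub>R e) = w X"
  shows "(\<integral>X. w X * (grad F X \<bullet> e) \<partial>lborel) = 0"
proof -
  obtain K where K: "compact K" "K \<subseteq> UNIV" "\<And>X. X \<notin> K \<Longrightarrow> F X = 0" "\<And>X. X \<notin> K \<Longrightarrow> grad F X = 0"
    by (rule C10_support[OF F], rule that)
  obtain r where r: "K \<subseteq> cball 0 r" using compact_imp_bounded[OF K(1)] by (force simp: bounded_iff)
  obtain B where B: "B \<ge> 0" "\<And>X. \<bar>F X\<bar> \<le> B" "\<And>X. norm (grad F X) \<le> B" by (rule C10_bounded[OF F], rule that)
  \<comment> \<open>A ball containing the supports of all translates by \<open>h n\<close>, since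
    \<open>h n \<le> 1\<close>.\<close>
  define R where "R = r + norm e"
  obtain W where W: "W \<ge> 0" "\<And>X. X \<in> cball 0 R \<Longrightarrow> norm (w X) \<le> W"
    by (rule continuous_bounded_on_ball[where r=R, OF w], rule that)
  define h where "h n = 1 / (real n + 1)" for n :: nat
  have h: "h n > 0" "h n \<le> 1" for n by (auto simp: h_def)
  have h0: "h \<longlonglongrightarrow> 0"
    using LIMSEQ_inverse_real_of_nat by (simp add: h_def[abs_def] inverse_eq_divide add.commute)
  define a where "a n X = (F (X + h n *\<^sub>R e) - F X) / h n" for n X
  note cF = C10_continuous[OF F] and cG = C10_grad_continuous[OF F]
  have cs: "continuous_on UNIV (\<lambda>X. F (X + c))" for c
    by (rule continuous_on_compose2[OF cF]) (auto intro!: continuous_intros)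
  have ca: "continuous_on UNIV (a n)" for n
    unfolding a_def using h[of n] by (intro continuous_intros cs cF) auto
  have lim: "(\<lambda>n. a n X) \<longlonglongrightarrow> grad F X \<bullet> e" for X
  proof -
    have "((\<lambda>t. F (X + t *\<^sub>R e)) has_field_derivative (grad F X \<bullet> e)) (at 0)"
      using GDERIV_DERIV_line[of F X 0 e] C10_GDERIV[OF F] by simp
    then have "((\<lambda>t. (F (X + t *\<^sub>R e) - F X) / t) \<longlongrightarrow> grad F X \<bullet> e) (at 0)"
      by (simp add: DERIV_def)
    then show ?thesis unfolding a_def
      by (rule filterlim_compose) (use h0 h in \<open>auto simp: filterlim_at intro!: always_eventually\<close>, metis less_irrefl)
  qed
  have bd: "\<bar>a n X\<bar> \<le> B * norm e" for n X
  proof -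
    have "\<exists>z. 0 < z \<and> z < h n \<and> F (X + h n *\<^sub>R e) - F (X + 0 *\<^sub>R e) = (h n - 0) * (grad F (X + z *\<^sub>R e) \<bullet> e)"
      by (rule MVT2[OF h(1)]) (rule GDERIV_DERIV_line[OF C10_GDERIV[OF F]])
    then obtain z where "F (X + h n *\<^sub>R e) - F X = h n * (grad F (X + z *\<^sub>R e) \<bullet> e)" by auto
    then have "a n X = grad F (X + z *\<^sub>R e) \<bullet> e" using h[of n] by (simp add: a_def)
    also have "\<bar>\<dots>\<bar> \<le> norm (grad F (X + z *\<^sub>R e)) * norm e" by (rule Cauchy_Schwarz_ineq2)
    also have "\<dots> \<le> B * norm e" using B by (intro mult_right_mono) auto
    finally show ?thesis .
  qed
  have z: "F (X + t *\<^sub>R e) = 0" if "X \<notin> cball 0 R" "0 \<le> t" "t \<le> 1" for X t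
  proof (rule K(3), rule)
    assume "X + t *\<^sub>R e \<in> K"
    then have "norm (X + t *\<^sub>R e) \<le> r" using r by auto
    moreover have "norm X \<le> norm (X + t *\<^sub>R e) + norm (t *\<^sub>R e)"
      by (metis add_diff_cancel_right' norm_triangle_ineq4)
    moreover have "norm (t *\<^sub>R e) \<le> norm e" using that by (simp add: mult_left_le_one_le)
    ultimately show False using that by (simp add: R_def)
  qed
  have za: "a n X = 0" if "X \<notin> cball 0 R" for n X
    using z[OF that, of "h n"] z[OF that, of 0] h[of n] by (simp add: a_def)
  have int0: "(\<integral>X. w X * a n X \<partial>lborel) = 0" for n
  proof -
    have i1: "integrable lborel (\<lambda>X. w X * F (X + h n *\<^sub>R e))"
      by (rule integrable_lborel_compact_support[where r=R])
        (use z[of _ "h n"] h[of n] in \<open>auto intro!: continuous_intros cs w\<close>)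
    have i2: "integrable lborel (\<lambda>X. w X * F X)"
      by (rule integrable_lborel_compact_support[where r=R])
        (use z[of _ 0] in \<open>auto intro!: continuous_intros cF w\<close>)
    \<comment> \<open>The weight is constant along \<open>e\<close>, so it can be translated
      together with \<open>F\<close>; the integral of the weighted difference quotient then vanishes
      exactly.\<close>
    have "(\<integral>X. w X * F (X + h n *\<^sub>R e) \<partial>lborel) = (\<integral>X. w (X + h n *\<^sub>R e) * F (X + h n *\<^sub>R e) \<partial>lborel)"
      by (simp add: inv)
    also have "\<dots> = (\<integral>X. w X * F X \<partial>lborel)"
      by (rule integral_lborel_shift) (intro continuous_intros w cF)
    finally have "(\<integral>X. w X * F (X + h n *\<^sub>R e) - w X * F X \<partial>lborel) = 0" using i1 i2 by simp
    then have "(\<integral>X. (w X * F (X + h n *\<^sub>R e) - w X * F X) / h n \<partial>lborel) = 0"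
      by (simp only: integral_divide_zero div_0)
    then show ?thesis by (simp add: a_def diff_divide_distrib right_diff_distrib)
  qed
  have "(\<lambda>n. \<integral>X. w X * a n X \<partial>lborel) \<longlonglongrightarrow> (\<integral>X. w X * (grad F X \<bullet> e) \<partial>lborel)"
  proof (rule integral_dominated_convergence[where w="\<lambda>X. indicator (cball 0 R) X * (W * (B * norm e))"])
    show "integrable lborel (\<lambda>X::'a. indicator (cball 0 R) X * (W * (B * norm e)) :: real)"
      using emeasure_lborel_cball_finite[of "0::'a" R] by (intro integrable_mult_left integrable_real_indicator) auto
    show "AE X in lborel. norm (w X * a n X) \<le> indicator (cball 0 R) X * (W * (B * norm e))" for n
    proof (rule AE_I2)
      fix X
      show "norm (w X * a n X) \<le> indicator (cball 0 R) X * (W * (B * norm e))"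
        by (cases "X \<in> cball 0 R") (use za W bd in \<open>auto simp: abs_mult intro!: mult_mono\<close>)
    qed
    show "AE X in lborel. (\<lambda>n. w X * a n X) \<longlonglongrightarrow> w X * (grad F X \<bullet> e)"
      by (intro AE_I2 tendsto_mult lim tendsto_const)
    show "(\<lambda>X. w X * (grad F X \<bullet> e)) \<in> borel_measurable lborel"
      by (auto intro!: borel_measurable_continuous_onI continuous_intros w cG)
    show "(\<lambda>X. w X * a n X) \<in> borel_measurable lborel" for n
      by (auto intro!: borel_measurable_continuous_onI continuous_intros w ca)
  qed
  then show ?thesis by (simp add: int0 LIMSEQ_const_iff)
qed

text \<open>Stone-Weierstrass approximants have to be admissible in the integration by parts, which
  asks for a continuous gradient.\<close>

lemma real_polynomial_function_C1:
  fixes p :: "'a::euclidean_space \<Rightarrow> real"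
  assumes "real_polynomial_function p"
  shows "\<exists>D. (\<forall>X. GDERIV p X :> D X) \<and> continuous_on UNIV D"
  using assms
proof induction
  case (linear f)
  then have d: "(f has_derivative f) (at X)" for X by (rule bounded_linear_imp_has_derivative)
  then have g: "GDERIV f X :> grad f X" for X by (intro GDERIV_grad) (auto simp: differentiable_def)
  have "(\<lambda>h. inner h (grad f X)) = f" for X
    using d[of X] g[of X] unfolding gderiv_def by (intro has_derivative_unique)
  then have "GDERIV f X :> grad f 0" for X using d[of X] by (simp add: gderiv_def)
  then show ?case by (intro exI[of _ "\<lambda>_. grad f 0"]) auto
next
  case (const c)
  then show ?case by (intro exI[of _ "\<lambda>_. 0"]) (auto intro: GDERIV_const)
next
  case (add f g)
  then obtain D E where "\<forall>X. GDERIV f X :> D X" "continuous_on UNIV D"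
    "\<forall>X. GDERIV g X :> E X" "continuous_on UNIV E" by auto
  then show ?case by (intro exI[of _ "\<lambda>X. D X + E X"]) (auto intro!: GDERIV_add continuous_intros)
next
  case (mult f g)
  then obtain D E where *: "\<forall>X. GDERIV f X :> D X" "continuous_on UNIV D"
    "\<forall>X. GDERIV g X :> E X" "continuous_on UNIV E" by auto
  moreover have "continuous_on UNIV f" "continuous_on UNIV g"
    using * GDERIV_continuous by (metis continuous_at_imp_continuous_on)+
  ultimately show ?case
    by (intro exI[of _ "\<lambda>X. f X *\<^sub>R E X + g X *\<^sub>R D X"]) (auto intro!: GDERIV_mult continuous_intros)
qed

section \<open>The energy space\<close>

text \<open>The exponent starts at 2, where powers of the positive part become continuously
  differentiable: at 0 the difference quotient is at most \<open>\<bar>h\<bar> ^ (n + 1)\<close>.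
  All cut-offs, barriers and \<open>gam\<close> are built from these powers.\<close>

lemma max_power_has_derivative:
  "((\<lambda>t::real. (max 0 t) ^ (n + 2)) has_field_derivative (real n + 2) * (max 0 t) ^ (n + 1)) (at t)"
proof (cases t "0::real" rule: linorder_cases)
  case less
  have "((\<lambda>t. 0) has_field_derivative 0) (at t)" by (rule DERIV_const)
  then have "((\<lambda>t::real. (max 0 t) ^ (n + 2)) has_field_derivative 0) (at t)"
    by (rule DERIV_cong_ev[THEN iffD1, OF refl _ refl, rotated])
      (use less in \<open>auto simp: eventually_nhds intro!: exI[of _ "{..<0}"]\<close>)
  then show ?thesis using less by simp
next
  case greater
  have "((\<lambda>t. t ^ (n + 2)) has_field_derivative (real n + 2) * t ^ (n + 1)) (at t)"
    using DERIV_pow[of "n + 2" t] by (simp add: add.commute)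
  then have "((\<lambda>t::real. (max 0 t) ^ (n + 2)) has_field_derivative (real n + 2) * t ^ (n + 1)) (at t)"
    by (rule DERIV_cong_ev[THEN iffD1, OF refl _ refl, rotated])
      (use greater in \<open>auto simp: eventually_nhds intro!: exI[of _ "{0<..}"]\<close>)
  then show ?thesis using greater by simp
next
  case equal
  have "((\<lambda>h::real. (max 0 h) ^ (n + 2) / h) \<longlongrightarrow> 0) (at 0)"
  proof (rule Lim_null_comparison[of _ "\<lambda>h. \<bar>h\<bar> ^ (n + 1)"])
    have "norm ((max 0 h) ^ (n + 2) / h) \<le> \<bar>h\<bar> ^ (n + 1)" for h :: real
    proof (cases "h > 0")
      case True
      then show ?thesis by simp
    next
      case False
      then have z: "max 0 h = 0" by simp
      show ?thesis unfolding z by simp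
    qed
    then show "\<forall>\<^sub>F h in at 0. norm ((max 0 h) ^ (n + 2) / h) \<le> \<bar>h\<bar> ^ (n + 1)"
      by (rule always_eventually[OF allI])
    have "((\<lambda>h::real. \<bar>h\<bar> ^ (n + 1)) \<longlongrightarrow> \<bar>0\<bar> ^ (n + 1)) (at 0)"
      by (intro tendsto_intros)
    then show "((\<lambda>h::real. \<bar>h\<bar> ^ (n + 1)) \<longlongrightarrow> 0) (at 0)" by simp
  qed
  then show ?thesis using equal by (simp add: DERIV_def)
qed

text \<open>A bounded \<open>C\<^sup>1\<close> substitute for the positive part: testing with \<open>gam z\<close> detects the sign of
  \<open>z\<close> and needs no chain rule for Lipschitz functions.\<close>

definition gam :: "real \<Rightarrow> real" where "gam t = (max 0 t)\<^sup>2 / (1 + (max 0 t)\<^sup>2)"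

definition gam' :: "real \<Rightarrow> real" where "gam' t = 2 * max 0 t / (1 + (max 0 t)\<^sup>2)\<^sup>2"

lemma gam_has_derivative: "(gam has_field_derivative gam' t) (at t)"
proof -
  have p: "1 + (max 0 t)\<^sup>2 \<noteq> 0" by (smt (verit) zero_le_power2)
  have s: "((\<lambda>t::real. (max 0 t)\<^sup>2) has_field_derivative 2 * max 0 t) (at t)"
    using max_power_has_derivative[of 0 t] by (simp add: power2_eq_square)
  have "((\<lambda>t. (max 0 t)\<^sup>2 / (1 + (max 0 t)\<^sup>2)) has_field_derivative
     (2 * max 0 t * (1 + (max 0 t)\<^sup>2) - (max 0 t)\<^sup>2 * (0 + 2 * max 0 t)) / ((1 + (max 0 t)\<^sup>2) * (1 + (max 0 t)\<^sup>2))) (at t)"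
    by (intro DERIV_divide DERIV_add DERIV_const s p)
  then show ?thesis unfolding gam_def[abs_def] gam'_def by (simp add: algebra_simps power2_eq_square)
qed

lemma gam_continuous: "continuous_on A gam" "continuous_on A gam'"
proof -
  have p: "1 + (max 0 t)\<^sup>2 \<noteq> 0" for t :: real by (smt (verit) zero_le_power2)
  show "continuous_on A gam" "continuous_on A gam'"
    unfolding gam_def[abs_def] gam'_def[abs_def] using p by (auto intro!: continuous_intros)
qed

lemma gam_bounds: "0 \<le> gam t" "gam t \<le> 1" "0 \<le> gam' t" "gam' t \<le> 1"
proof -
  define s where "s = max 0 t"
  have s: "s \<ge> 0" by (simp add: s_def)
  have p: "1 + s\<^sup>2 > 0" by (smt (verit) zero_le_power2)
  show "0 \<le> gam t" "gam t \<le> 1" unfolding gam_def s_def[symmetric] using p by auto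
  show "0 \<le> gam' t" unfolding gam'_def s_def[symmetric] using s by auto
  have "2 * s \<le> 1 + s\<^sup>2" using sum_squares_bound[of s 1] by simp
  also have "\<dots> * 1 \<le> (1 + s\<^sup>2) * (1 + s\<^sup>2)" using p by (intro mult_left_mono) auto
  finally have "2 * s \<le> (1 + s\<^sup>2)\<^sup>2" by (simp add: power2_eq_square)
  then show "gam' t \<le> 1" unfolding gam'_def s_def[symmetric] using p by simp
qed

lemma gam_nonpos: "t \<le> 0 \<Longrightarrow> gam t = 0" "t \<le> 0 \<Longrightarrow> gam' t = 0"
  by (simp_all add: gam_def gam'_def)

lemma gam_pos: "t > 0 \<Longrightarrow> gam t > 0" "t > 0 \<Longrightarrow> gam' t > 0"
proof -
  assume t: "t > 0"
  have "1 + t\<^sup>2 > 0" by (smt (verit) zero_le_power2)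
  then show "gam t > 0" "gam' t > 0" using t by (auto simp: gam_def gam'_def)
qed

text \<open>The diagonal entry of sqrt A in direction \<open>b\<close>: a basis vector of R x R^m
  has \<open>fst b = 0\<close> exactly when it is a y direction.\<close>

definition wt :: "real \<Rightarrow> real \<times> (real ^ 'm) \<Rightarrow> real \<times> (real ^ 'm) \<Rightarrow> real" where
  "wt l b X = (if fst b = 0 then \<bar>fst X\<bar> powr l else 1)"

text \<open>The integrand of the energy. Limits of this quantity are taken in L^2, whereas the weak
  quasi-gradient carries an inverse power of |x|.\<close>

definition qgrad :: "real \<Rightarrow> (real \<times> (real ^ 'm) \<Rightarrow> real) \<Rightarrow> real \<times> (real ^ 'm) \<Rightarrow> real \<times> (real ^ 'm)" where
  "qgrad l u X = grushin_sqrtA l X (grad u X)"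

lemma grushin_sqrtA_inner:
  assumes "b \<in> Basis"
  shows "grushin_sqrtA l X p \<bullet> b = wt l b X * (p \<bullet> b)"
  using assms by (auto simp: Basis_prod_def grushin_sqrtA_def wt_def inner_prod_def)

lemma qgrad_inner: "b \<in> Basis \<Longrightarrow> qgrad l u X \<bullet> b = wt l b X * (grad u X \<bullet> b)"
  by (simp add: qgrad_def grushin_sqrtA_inner)

text \<open>The structural property of the Grushin fields: |x|^l multiplies only y derivatives, so
  each weight is constant along its own direction and is never differentiated in an integration by
  parts.\<close>

lemma wt_shift:
  assumes "b \<in> Basis"
  shows "wt l b (X + t *\<^sub>R b) = wt l b X"
  using assms by (auto simp: wt_def Basis_prod_def)

lemma continuous_on_wt: "l \<ge> 1 \<Longrightarrow> continuous_on UNIV (wt l b)"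
  unfolding wt_def by (cases "fst b = 0") (auto intro!: continuous_intros continuous_on_powr')

lemma grushin_sqrtA_linear:
  "grushin_sqrtA l X (p + q) = grushin_sqrtA l X p + grushin_sqrtA l X q"
  "grushin_sqrtA l X (c *\<^sub>R p) = c *\<^sub>R grushin_sqrtA l X p"
  "grushin_sqrtA l X (p - q) = grushin_sqrtA l X p - grushin_sqrtA l X q"
  "grushin_sqrtA l X 0 = 0"
  by (auto simp: grushin_sqrtA_def algebra_simps zero_prod_def)

locale grushin_domain =
  fixes l :: real and \<Omega> :: "(real \<times> (real ^ 'm)) set"
  assumes l: "l \<ge> 1" and op: "open \<Omega>" and bd: "bounded \<Omega>"
begin

abbreviation M where "M \<equiv> lebesgue_on \<Omega>"

lemma Omega_sets: "\<Omega> \<in> sets lebesgue"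
  using op by auto

lemma finite_M: "finite_measure M"
proof (rule finite_measureI)
  have "\<Omega> \<in> lmeasurable" using bd op by (rule lmeasurable_open)
  then have "emeasure lebesgue \<Omega> \<noteq> \<infinity>"
    unfolding infinity_ennreal_def by (rule fmeasurableD2)
  then show "emeasure M (space M) \<noteq> \<infinity>"
    using Omega_sets by (simp add: emeasure_restrict_space space_restrict_space)
qed

lemma space_M: "space M = \<Omega>" by (simp add: space_restrict_space)

lemma ball_ex: "\<exists>r>0. \<Omega> \<subseteq> cball 0 r"
  using bd bounded_pos[of \<Omega>] by (auto simp: subset_iff)

lemma borel_M: "f \<in> borel_measurable borel \<Longrightarrow> f \<in> borel_measurable M"
  by (intro measurable_restrict_space1 measurable_completion) simp

lemma continuous_M: 
  fixes f :: "real \<times> (real ^ 'm) \<Rightarrow> 'b::euclidean_space"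
  shows "continuous_on UNIV f \<Longrightarrow> f \<in> borel_measurable M"
  by (intro borel_M borel_measurable_continuous_onI)

lemma square_integrable_bounded:
  fixes f :: "real \<times> (real ^ 'm) \<Rightarrow> 'b::euclidean_space"
  assumes "f \<in> borel_measurable M" "\<And>X. X \<in> \<Omega> \<Longrightarrow> norm (f X) \<le> B"
  shows "square_integrable M f"
  unfolding square_integrable_def
proof
  note [measurable] = assms(1)
  show "integrable M (\<lambda>X. (norm (f X))\<^sup>2)"
  proof (rule finite_measure.integrable_const_bound[OF finite_M, of _ "B\<^sup>2"])
    show "AE X in M. norm ((norm (f X))\<^sup>2) \<le> B\<^sup>2"
      using assms(2) by (intro AE_I2) (auto simp: space_M intro!: power_mono)
  qed simp
qed (rule assms(1))

lemma square_integrable_continuous: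
  fixes f :: "real \<times> (real ^ 'm) \<Rightarrow> 'b::euclidean_space"
  assumes "continuous_on UNIV f"
  shows "square_integrable M f"
proof -
  obtain r where r: "\<Omega> \<subseteq> cball 0 r" using ball_ex by auto
  obtain B where "B \<ge> 0" "\<And>X. X \<in> cball 0 r \<Longrightarrow> norm (f X) \<le> B"
    by (rule continuous_bounded_on_ball[where r=r, OF assms], rule that)
  then show ?thesis using r
    by (intro square_integrable_bounded[of f B] continuous_M assms) auto
qed

lemma integrable_continuous:
  fixes f :: "real \<times> (real ^ 'm) \<Rightarrow> real"
  shows "continuous_on UNIV f \<Longrightarrow> integrable M f"
  by (intro square_integrable_integrable finite_M square_integrable_continuous)

lemma integral_M_eq:
  fixes f :: "real \<times> (real ^ 'm) \<Rightarrow> real"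
  assumes "continuous_on UNIV f" "\<And>X. X \<notin> \<Omega> \<Longrightarrow> f X = 0"
  shows "(\<integral>X. f X \<partial>M) = (\<integral>X. f X \<partial>lborel)"
proof -
  have "(\<integral>X. f X \<partial>M) = (\<integral>X. indicator \<Omega> X *\<^sub>R f X \<partial>lebesgue)"
    using Omega_sets by (intro integral_restrict_space) auto
  also have "\<dots> = (\<integral>X. f X \<partial>lebesgue)"
    by (rule Bochner_Integration.integral_cong) (use assms(2) in \<open>auto split: split_indicator\<close>)
  also have "\<dots> = (\<integral>X. f X \<partial>lborel)"
    by (intro integral_completion) (simp add: borel_measurable_continuous_onI assms(1))
  finally show ?thesis .
qed

lemma qgrad_continuous: "v \<in> C10 \<Omega> \<Longrightarrow> continuous_on UNIV (qgrad l v)"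
  unfolding qgrad_def grushin_sqrtA_def using l C10_grad_continuous[of v \<Omega>]
  by (intro continuous_intros continuous_on_powr') auto

lemma C10_square_integrable:
  assumes "v \<in> C10 \<Omega>"
  shows "square_integrable M v" "square_integrable M (qgrad l v)"
  using assms by (auto intro!: square_integrable_continuous qgrad_continuous intro: C10_continuous)

lemma qgrad_add: "u \<in> C10 \<Omega> \<Longrightarrow> v \<in> C10 \<Omega> \<Longrightarrow> qgrad l (\<lambda>X. u X + v X) = (\<lambda>X. qgrad l u X + qgrad l v X)"
  by (simp add: qgrad_def[abs_def] C10_add(2) grushin_sqrtA_linear)

lemma qgrad_diff: "u \<in> C10 \<Omega> \<Longrightarrow> v \<in> C10 \<Omega> \<Longrightarrow> qgrad l (\<lambda>X. u X - v X) = (\<lambda>X. qgrad l u X - qgrad l v X)"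
  by (simp add: qgrad_def[abs_def] C10_diff(2) grushin_sqrtA_linear)

lemma qgrad_cmult: "u \<in> C10 \<Omega> \<Longrightarrow> qgrad l (\<lambda>X. c * u X) = (\<lambda>X. c *\<^sub>R qgrad l u X)"
  by (simp add: qgrad_def[abs_def] C10_cmult(2) grushin_sqrtA_linear)

lemma qgrad_mult: "u \<in> C10 \<Omega> \<Longrightarrow> v \<in> C10 \<Omega> \<Longrightarrow>
   qgrad l (\<lambda>X. u X * v X) = (\<lambda>X. u X *\<^sub>R qgrad l v X + v X *\<^sub>R qgrad l u X)"
  by (simp add: qgrad_def[abs_def] C10_mult_C10(2) grushin_sqrtA_linear)

text \<open>The factor \<open>w\<close> is kept apart from \<open>g\<close> because it will be a
  second copy of \<open>wt l b\<close>, which for \<open>l = 1\<close> can be |x| and thus not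
  differentiable. Being constant along \<open>b\<close>, it passes through undifferentiated.\<close>

lemma integration_by_parts_weighted:
  assumes phi: "\<phi> \<in> C10 \<Omega>" and g: "\<And>X. GDERIV g X :> D X" "continuous_on UNIV D" and b: "b \<in> Basis"
    and w: "continuous_on UNIV w" "\<And>X t. w (X + t *\<^sub>R b) = w X"
  shows "(\<integral>X. (qgrad l \<phi> X \<bullet> b) * (w X * g X) \<partial>M) = - (\<integral>X. \<phi> X * (w X * (wt l b X * (D X \<bullet> b))) \<partial>M)"
proof -
  note F = C10_mult[OF phi g]
  have cg: "continuous_on UNIV g"
    using g(1) GDERIV_continuous by (metis continuous_at_imp_continuous_on)
  note C = C10_continuous[OF phi] C10_grad_continuous[OF phi] continuous_on_wt[OF l] cg g(2) w(1)
  obtain K where K: "compact K" "K \<subseteq> \<Omega>" "\<And>X. X \<notin> K \<Longrightarrow> \<phi> X = 0" "\<And>X. X \<notin> K \<Longrightarrow> grad \<phi> X = 0"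
    by (rule C10_support[OF phi], rule that)
  define w' where "w' X = w X * wt l b X" for X
  have cw: "continuous_on UNIV w'" unfolding w'_def by (intro continuous_intros C)
  have "0 = (\<integral>X. w' X * (grad (\<lambda>X. \<phi> X * g X) X \<bullet> b) \<partial>lborel)"
    by (rule integral_weight_derivative_eq_0[symmetric, OF C10_mono[OF F(1)] cw])
      (simp_all add: w'_def wt_shift b w)
  also have "\<dots> = (\<integral>X. w' X * (grad (\<lambda>X. \<phi> X * g X) X \<bullet> b) \<partial>M)"
  proof (rule integral_M_eq[symmetric])
    show "continuous_on UNIV (\<lambda>X. w' X * (grad (\<lambda>X. \<phi> X * g X) X \<bullet> b))"
      unfolding F(2) by (intro continuous_intros C cw)
    fix X assume "X \<notin> \<Omega>"
    then have "X \<notin> K" using K(2) by blast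
    from K(3,4)[OF this] show "w' X * (grad (\<lambda>X. \<phi> X * g X) X \<bullet> b) = 0" unfolding F(2) by simp
  qed
  also have "\<dots> = (\<integral>X. \<phi> X * (w X * (wt l b X * (D X \<bullet> b))) + (qgrad l \<phi> X \<bullet> b) * (w X * g X) \<partial>M)"
    unfolding F(2) qgrad_inner[OF b] w'_def
    by (intro Bochner_Integration.integral_cong) (auto simp: algebra_simps)
  also have "\<dots> = (\<integral>X. \<phi> X * (w X * (wt l b X * (D X \<bullet> b))) \<partial>M) + (\<integral>X. (qgrad l \<phi> X \<bullet> b) * (w X * g X) \<partial>M)"
    by (intro Bochner_Integration.integral_add integrable_continuous continuous_intros C qgrad_continuous phi)
  finally show ?thesis by simp
qed

lemma integration_by_parts:
  assumes "\<phi> \<in> C10 \<Omega>" "\<And>X. GDERIV g X :> D X" "continuous_on UNIV D" "b \<in> Basis"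
  shows "(\<integral>X. (qgrad l \<phi> X \<bullet> b) * g X \<partial>M) = - (\<integral>X. \<phi> X * (wt l b X * (D X \<bullet> b)) \<partial>M)"
  using integration_by_parts_weighted[OF assms, of "\<lambda>_. 1"] by simp

text \<open>Only the x direction enters, because its weight is 1: integrating by parts against
  \<open>fst X\<close> turns the integral of phi^2 into -2 times that of x phi phi_x, and |x| is at
  most \<open>r\<close>. The degeneracy is therefore invisible in the constant.\<close>

lemma poincare_C10:
  assumes phi: "\<phi> \<in> C10 \<Omega>" and r: "\<Omega> \<subseteq> cball 0 r"
  shows "(\<integral>X. (norm (\<phi> X))\<^sup>2 \<partial>M) \<le> 4 * r\<^sup>2 * (\<integral>X. (norm (qgrad l \<phi> X))\<^sup>2 \<partial>M)"
proof -
  define e :: "real \<times> (real ^ 'm)" where "e = (1, 0)"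
  have e: "e \<in> Basis" by (auto simp: e_def Basis_prod_def)
  have we: "wt l e X = 1" for X by (simp add: wt_def e_def)
  have ge: "GDERIV (\<lambda>X. fst X) X :> e" for X :: "real \<times> (real ^ 'm)"
    unfolding gderiv_def e_def by (auto intro!: derivative_eq_intros simp: inner_prod_def)
  note C = C10_continuous[OF phi] C10_grad_continuous[OF phi] qgrad_continuous[OF phi]
  define I where "I = (\<integral>X. fst X * \<phi> X * (qgrad l \<phi> X \<bullet> e) \<partial>M)"
  have "(\<integral>X. (qgrad l \<phi> X \<bullet> e) * (\<phi> X * fst X) \<partial>M)
     = - (\<integral>X. \<phi> X * (wt l e X * ((\<phi> X *\<^sub>R e + fst X *\<^sub>R grad \<phi> X) \<bullet> e)) \<partial>M)"
    by (rule integration_by_parts[OF phi _ _ e])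
      (auto intro!: GDERIV_mult C10_GDERIV[OF phi] ge continuous_intros C)
  also have "(\<integral>X. (qgrad l \<phi> X \<bullet> e) * (\<phi> X * fst X) \<partial>M) = I"
    unfolding I_def by (intro Bochner_Integration.integral_cong) auto
  also have "(\<integral>X. \<phi> X * (wt l e X * ((\<phi> X *\<^sub>R e + fst X *\<^sub>R grad \<phi> X) \<bullet> e)) \<partial>M)
     = (\<integral>X. (norm (\<phi> X))\<^sup>2 + fst X * \<phi> X * (qgrad l \<phi> X \<bullet> e) \<partial>M)"
    by (intro Bochner_Integration.integral_cong refl)
      (simp add: we qgrad_inner[OF e] inner_add_left inner_same_Basis[OF e] power2_eq_square algebra_simps)
  also have "\<dots> = (\<integral>X. (norm (\<phi> X))\<^sup>2 \<partial>M) + I"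
    unfolding I_def by (intro Bochner_Integration.integral_add integrable_continuous continuous_intros C)
  finally have eq: "(\<integral>X. (norm (\<phi> X))\<^sup>2 \<partial>M) = - 2 * I" by simp
  also have "- 2 * I = (\<integral>X. - 2 * (fst X * \<phi> X * (qgrad l \<phi> X \<bullet> e)) \<partial>M)"
    unfolding I_def by simp
  also have "\<dots> \<le> (\<integral>X. (norm (\<phi> X))\<^sup>2 / 2 + 2 * r\<^sup>2 * (norm (qgrad l \<phi> X))\<^sup>2 \<partial>M)"
  proof (rule integral_mono)
    fix X assume "X \<in> space M"
    then have "norm X \<le> r" using r by (auto simp: space_M)
    then have f: "\<bar>fst X\<bar> \<le> r" using norm_fst_le[of "fst X" "snd X"] by simp
    have q: "\<bar>qgrad l \<phi> X \<bullet> e\<bar> \<le> norm (qgrad l \<phi> X)" using e by (rule Basis_le_norm)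
    define a where "a = fst X * (qgrad l \<phi> X \<bullet> e)"
    have "\<bar>a\<bar> \<le> r * norm (qgrad l \<phi> X)" unfolding a_def abs_mult by (rule mult_mono'[OF f q]) auto
    then have "a\<^sup>2 \<le> (r * norm (qgrad l \<phi> X))\<^sup>2" by (rule abs_le_square_iff[THEN iffD1, OF order_trans]) simp
    \<comment> \<open>Young's inequality with half of phi^2 left over, which the left-hand side
      absorbs; this produces the factor 4.\<close>
    moreover have "- 2 * (\<phi> X * a) \<le> (\<phi> X)\<^sup>2 / 2 + 2 * a\<^sup>2"
      using zero_le_power2[of "\<phi> X / 2 + a"] by (simp add: power2_sum power_divide algebra_simps)
    ultimately show "- 2 * (fst X * \<phi> X * (qgrad l \<phi> X \<bullet> e)) \<le> (norm (\<phi> X))\<^sup>2 / 2 + 2 * r\<^sup>2 * (norm (qgrad l \<phi> X))\<^sup>2"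
      by (simp add: a_def power_mult_distrib algebra_simps)
  qed (auto intro!: integrable_continuous continuous_intros C)
  also have "\<dots> = (\<integral>X. (norm (\<phi> X))\<^sup>2 \<partial>M) / 2 + 2 * r\<^sup>2 * (\<integral>X. (norm (qgrad l \<phi> X))\<^sup>2 \<partial>M)"
    by (subst Bochner_Integration.integral_add) (auto intro!: integrable_continuous continuous_intros C)
  finally show ?thesis by simp
qed

text \<open>\<open>W u U\<close> says that \<open>u\<close> lies in \<open>H10 l \<Omega>\<close> and that \<open>U\<close> is \<open>sqrt A\<close> applied to its weak
  quasi-gradient.\<close>

definition W where
  "W u U \<longleftrightarrow> (\<exists>\<phi>. (\<forall>n. \<phi> n \<in> C10 \<Omega>) \<and> L2_tendsto M \<phi> u \<and> L2_tendsto M (\<lambda>n. qgrad l (\<phi> n)) U)"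

lemma W_square_integrable:
  assumes "W u U"
  shows "square_integrable M u" "square_integrable M U"
  using assms L2_tendstoD(2) unfolding W_def by blast+

lemma W_E:
  assumes "W u U"
  obtains \<phi> where "\<And>n. \<phi> n \<in> C10 \<Omega>" "L2_tendsto M \<phi> u" "L2_tendsto M (\<lambda>n. qgrad l (\<phi> n)) U"
    "AE X in M. (\<lambda>n. \<phi> n X) \<longlonglongrightarrow> u X"
proof -
  obtain \<phi> where p: "\<And>n. \<phi> n \<in> C10 \<Omega>" "L2_tendsto M \<phi> u" "L2_tendsto M (\<lambda>n. qgrad l (\<phi> n)) U"
    using assms unfolding W_def by blast
  obtain r where r: "strict_mono r" "AE X in M. (\<lambda>n. \<phi> (r n) X) \<longlonglongrightarrow> u X"
    using L2_tendsto_AE_subseq[OF p(2)] by blast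
  show ?thesis
    by (rule that[of "\<lambda>n. \<phi> (r n)"])
      (auto intro: p(1) r(2) L2_tendsto_subseq[OF p(2) r(1)] L2_tendsto_subseq[OF p(3) r(1)])
qed

lemma W_I:
  assumes "\<And>n. \<phi> n \<in> C10 \<Omega>" "L2_tendsto M \<phi> u" "L2_tendsto M (\<lambda>n. qgrad l (\<phi> n)) U"
  shows "W u U"
  using assms unfolding W_def by blast

lemma W_C10: "\<phi> \<in> C10 \<Omega> \<Longrightarrow> W \<phi> (qgrad l \<phi>)"
  by (rule W_I[of "\<lambda>_. \<phi>"]) (auto intro!: L2_tendsto_const C10_square_integrable)

lemma W_add:
  assumes "W u U" "W v V"
  shows "W (\<lambda>X. u X + v X) (\<lambda>X. U X + V X)"
proof -
  obtain \<phi> where p: "\<And>n. \<phi> n \<in> C10 \<Omega>" "L2_tendsto M \<phi> u" "L2_tendsto M (\<lambda>n. qgrad l (\<phi> n)) U"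
    using assms(1) unfolding W_def by blast
  obtain \<psi> where q: "\<And>n. \<psi> n \<in> C10 \<Omega>" "L2_tendsto M \<psi> v" "L2_tendsto M (\<lambda>n. qgrad l (\<psi> n)) V"
    using assms(2) unfolding W_def by blast
  show ?thesis
    by (rule W_I[of "\<lambda>n X. \<phi> n X + \<psi> n X"])
      (simp_all add: C10_add(1) qgrad_add p q L2_tendsto_add)
qed

lemma W_cmult:
  assumes "W u U"
  shows "W (\<lambda>X. c * u X) (\<lambda>X. c *\<^sub>R U X)"
proof -
  obtain \<phi> where p: "\<And>n. \<phi> n \<in> C10 \<Omega>" "L2_tendsto M \<phi> u" "L2_tendsto M (\<lambda>n. qgrad l (\<phi> n)) U"
    using assms(1) unfolding W_def by blast
  show ?thesis
    by (rule W_I[of "\<lambda>n X. c * \<phi> n X"])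
      (use L2_tendsto_scaleR[OF p(2), of c] L2_tendsto_scaleR[OF p(3), of c] in
        \<open>simp_all add: C10_cmult(1) qgrad_cmult p\<close>)
qed

lemma W_minus: "W u U \<Longrightarrow> W (\<lambda>X. - u X) (\<lambda>X. - U X)"
  using W_cmult[of u U "-1"] by simp

lemma W_diff: "W u U \<Longrightarrow> W v V \<Longrightarrow> W (\<lambda>X. u X - v X) (\<lambda>X. U X - V X)"
  using W_add[OF _ W_minus, of u U v V] by simp

lemma W_poincare:
  assumes "W u U" "\<Omega> \<subseteq> cball 0 r"
  shows "(\<integral>X. (norm (u X))\<^sup>2 \<partial>M) \<le> 4 * r\<^sup>2 * (\<integral>X. (norm (U X))\<^sup>2 \<partial>M)"
proof -
  obtain \<phi> where p: "\<And>n. \<phi> n \<in> C10 \<Omega>" "L2_tendsto M \<phi> u" "L2_tendsto M (\<lambda>n. qgrad l (\<phi> n)) U"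
    using assms(1) unfolding W_def by blast
  show ?thesis
    by (rule LIMSEQ_le[OF L2_tendsto_norm2[OF p(2)] tendsto_mult_left[OF L2_tendsto_norm2[OF p(3)]]])
      (use poincare_C10[OF p(1) assms(2)] in auto)
qed

lemma L2_tendsto_transform:
  assumes "\<And>n. square_integrable M (a n)" "L2_tendsto M b h"
    "\<And>n. (\<integral>X. (norm (a n X - b n X))\<^sup>2 \<partial>M) < 1 / (real n + 1)"
  shows "L2_tendsto M a h"
proof -
  have "L2_tendsto M (\<lambda>n X. a n X - b n X) (\<lambda>X. 0)"
  proof (rule L2_tendsto_bound)
    show "(\<lambda>n. 1 / (real n + 1)) \<longlonglongrightarrow> 0"
      using LIMSEQ_inverse_real_of_nat by (simp add: inverse_eq_divide add.commute)
    show "square_integrable M (\<lambda>X. a n X - b n X)" for n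
      by (intro square_integrable_diff assms(1) L2_tendstoD(1)[OF assms(2)])
    show "(\<integral>X. (norm (a n X - b n X - 0))\<^sup>2 \<partial>M) \<le> 1 / (real n + 1)" for n
      using assms(3)[of n] by simp
  qed (simp add: square_integrable_def)
  from L2_tendsto_add[OF this assms(2)] show ?thesis by simp
qed

text \<open>Diagonal choice: each \<open>u n\<close> is replaced by a function in \<open>C10\<close>
  at squared distance below \<open>1 / (n + 1)\<close>, and likewise for the gradient datum.\<close>

lemma W_closed:
  assumes W: "\<And>n. W (u n) (U n)" and lim: "L2_tendsto M u v" "L2_tendsto M U V"
  shows "W v V"
proof -
  have "\<exists>\<psi>\<in>C10 \<Omega>. (\<integral>X. (norm (\<psi> X - u n X))\<^sup>2 \<partial>M) < 1 / (real n + 1) \<and>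
     (\<integral>X. (norm (qgrad l \<psi> X - U n X))\<^sup>2 \<partial>M) < 1 / (real n + 1)" for n
  proof -
    obtain \<phi> where p: "\<And>n. \<phi> n \<in> C10 \<Omega>" "L2_tendsto M \<phi> (u n)" "L2_tendsto M (\<lambda>n. qgrad l (\<phi> n)) (U n)"
      using W[of n] unfolding W_def by blast
    have e: "0 < 1 / (real n + 1)" by simp
    have "\<forall>\<^sub>F k in sequentially. (\<integral>X. (norm (\<phi> k X - u n X))\<^sup>2 \<partial>M) < 1 / (real n + 1) \<and>
       (\<integral>X. (norm (qgrad l (\<phi> k) X - U n X))\<^sup>2 \<partial>M) < 1 / (real n + 1)"
      by (intro eventually_conj order_tendstoD(2)[OF L2_tendstoD(3)[OF p(2)] e] order_tendstoD(2)[OF L2_tendstoD(3)[OF p(3)] e])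
    then obtain k where "(\<integral>X. (norm (\<phi> k X - u n X))\<^sup>2 \<partial>M) < 1 / (real n + 1) \<and>
       (\<integral>X. (norm (qgrad l (\<phi> k) X - U n X))\<^sup>2 \<partial>M) < 1 / (real n + 1)"
      by (auto simp: eventually_sequentially)
    then show ?thesis using p(1)[of k] by blast
  qed
  then have "\<exists>\<psi>. \<forall>n. \<psi> n \<in> C10 \<Omega> \<and> (\<integral>X. (norm (\<psi> n X - u n X))\<^sup>2 \<partial>M) < 1 / (real n + 1) \<and>
     (\<integral>X. (norm (qgrad l (\<psi> n) X - U n X))\<^sup>2 \<partial>M) < 1 / (real n + 1)"
    by (intro choice allI) (simp add: Bex_def)
  then obtain \<psi> where psi: "\<And>n. \<psi> n \<in> C10 \<Omega>" "\<And>n. (\<integral>X. (norm (\<psi> n X - u n X))\<^sup>2 \<partial>M) < 1 / (real n + 1)"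
     "\<And>n. (\<integral>X. (norm (qgrad l (\<psi> n) X - U n X))\<^sup>2 \<partial>M) < 1 / (real n + 1)"
    by auto
  show ?thesis
  proof (rule W_I[of \<psi>, OF psi(1)])
    show "L2_tendsto M \<psi> v"
      by (rule L2_tendsto_transform[OF C10_square_integrable(1)[OF psi(1)] lim(1) psi(2)])
    show "L2_tendsto M (\<lambda>n. qgrad l (\<psi> n)) V"
      by (rule L2_tendsto_transform[OF C10_square_integrable(2)[OF psi(1)] lim(2) psi(3)])
  qed
qed

text \<open>Cauchy gradients are enough, since the Poincare inequality makes the functions Cauchy
  too.\<close>

lemma W_complete:
  assumes W: "\<And>n. W (u n) (U n)"
    and C: "\<And>e. e > 0 \<Longrightarrow> \<exists>N. \<forall>i\<ge>N. \<forall>j\<ge>N. (\<integral>X. (norm (U i X - U j X))\<^sup>2 \<partial>M) < e"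
  shows "\<exists>v V. W v V \<and> L2_tendsto M u v \<and> L2_tendsto M U V"
proof -
  obtain r where r: "r > 0" "\<Omega> \<subseteq> cball 0 r" using ball_ex by auto
  obtain V where V: "L2_tendsto M U V"
    using L2_complete[OF W_square_integrable(2)[OF W] C] by blast
  have C': "\<exists>N. \<forall>i\<ge>N. \<forall>j\<ge>N. (\<integral>X. (norm (u i X - u j X))\<^sup>2 \<partial>M) < e" if "e > 0" for e
  proof -
    have "e / (4 * r\<^sup>2) > 0" using that r by simp
    from C[OF this] obtain N where N: "\<forall>i\<ge>N. \<forall>j\<ge>N. (\<integral>X. (norm (U i X - U j X))\<^sup>2 \<partial>M) < e / (4 * r\<^sup>2)" by blast
    have "(\<integral>X. (norm (u i X - u j X))\<^sup>2 \<partial>M) < e" if "i \<ge> N" "j \<ge> N" for i j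
    proof -
      have "(\<integral>X. (norm (u i X - u j X))\<^sup>2 \<partial>M) \<le> 4 * r\<^sup>2 * (\<integral>X. (norm (U i X - U j X))\<^sup>2 \<partial>M)"
        by (rule W_poincare[OF W_diff[OF W W] r(2)])
      also have "\<dots> < 4 * r\<^sup>2 * (e / (4 * r\<^sup>2))" using N that r by (intro mult_strict_left_mono) auto
      finally show ?thesis using r by simp
    qed
    then show ?thesis by blast
  qed
  obtain v where v: "L2_tendsto M u v"
    using L2_complete[OF W_square_integrable(1)[OF W] C'] by blast
  show ?thesis using W_closed[OF W v V] v V by blast
qed

lemma W_zero_orthogonal:
  assumes W: "W (\<lambda>X. 0) D" and b: "b \<in> Basis" and g: "\<And>X. GDERIV g X :> G X" "continuous_on UNIV G"
  shows "(\<integral>X. (D X \<bullet> b) * g X \<partial>M) = 0"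
proof -
  obtain \<phi> where p: "\<And>n. \<phi> n \<in> C10 \<Omega>" "L2_tendsto M \<phi> (\<lambda>X. 0)" "L2_tendsto M (\<lambda>n. qgrad l (\<phi> n)) D"
    using W unfolding W_def by blast
  have cg: "continuous_on UNIV g"
    using g(1) GDERIV_continuous by (metis continuous_at_imp_continuous_on)
  have "(\<lambda>n. \<integral>X. qgrad l (\<phi> n) X \<bullet> (g X *\<^sub>R b) \<partial>M) \<longlonglongrightarrow> (\<integral>X. D X \<bullet> (g X *\<^sub>R b) \<partial>M)"
    by (intro L2_tendsto_inner p L2_tendsto_const square_integrable_continuous continuous_intros cg)
  then have "(\<lambda>n. - (\<integral>X. \<phi> n X \<bullet> (wt l b X * (G X \<bullet> b)) \<partial>M)) \<longlonglongrightarrow> (\<integral>X. (D X \<bullet> b) * g X \<partial>M)"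
    using integration_by_parts[OF p(1) g b] by (simp add: mult.commute)
  moreover have "(\<lambda>n. - (\<integral>X. \<phi> n X \<bullet> (wt l b X * (G X \<bullet> b)) \<partial>M)) \<longlonglongrightarrow> - (\<integral>X. 0 \<bullet> (wt l b X * (G X \<bullet> b)) \<partial>M)"
    by (intro tendsto_minus L2_tendsto_inner p L2_tendsto_const square_integrable_continuous
        continuous_intros g(2) continuous_on_wt[OF l])
  ultimately show ?thesis using LIMSEQ_unique by fastforce
qed

text \<open>Closability: polynomials are dense in \<open>C(closure \<Omega>)\<close>, and no boundary term appears when
  integrating against them since the approximating functions have compact support.\<close>

lemma W_zero_unique:
  assumes W: "W (\<lambda>X. 0) D"
  shows "AE X in M. D X = 0"
proof -
  note D = W_square_integrable(2)[OF W]
  have orth: "(\<integral>X. (D X \<bullet> b) * h X \<partial>M) = 0" if b: "b \<in> Basis" and h: "continuous_on UNIV h" for b h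
  proof -
    define A where "A = (\<integral>X. \<bar>D X \<bullet> b\<bar> \<partial>M)"
    have cb: "square_integrable M (\<lambda>X. b)" by (intro square_integrable_continuous continuous_intros)
    have iD: "integrable M (\<lambda>X. D X \<bullet> b)" by (intro square_integrable_inner D cb)
    have sD: "square_integrable M (\<lambda>X. D X \<bullet> b)"
    proof (unfold square_integrable_def, intro conjI)
      show "(\<lambda>X. D X \<bullet> b) \<in> borel_measurable M" using iD by auto
      show "integrable M (\<lambda>X. (norm (D X \<bullet> b))\<^sup>2)"
        by (rule Bochner_Integration.integrable_bound[OF square_integrable_norm2[OF D]])
          (use iD power_mono[OF Basis_le_norm[OF b], of _ 2] in \<open>auto intro!: AE_I2\<close>)
    qed
    have A: "A \<ge> 0" by (simp add: A_def)
    \<comment> \<open>A polynomial \<open>e\<close>-close to \<open>h\<close> on the closure is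
      orthogonal to the component of \<open>D\<close>, so only the error \<open>h - p\<close>
      contributes.\<close>
    have small: "\<bar>\<integral>X. (D X \<bullet> b) * h X \<partial>M\<bar> \<le> e * A" if e: "e > 0" for e
    proof -
      obtain p where p: "real_polynomial_function p" "\<And>X. X \<in> closure \<Omega> \<Longrightarrow> \<bar>h X - p X\<bar> < e"
        using Stone_Weierstrass_real_polynomial_function[of "closure \<Omega>" h e]
          continuous_on_subset[OF h] bd e by (auto simp: compact_closure)
      obtain G where G: "\<And>X. GDERIV p X :> G X" "continuous_on UNIV G"
        using real_polynomial_function_C1[OF p(1)] by blast
      have cp: "continuous_on UNIV p"
        using G(1) GDERIV_continuous by (metis continuous_at_imp_continuous_on)
      have ih: "integrable M (\<lambda>X. (D X \<bullet> b) * h X)" "integrable M (\<lambda>X. (D X \<bullet> b) * p X)"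
        by (intro square_integrable_mult sD square_integrable_continuous h cp)+
      have "(\<integral>X. (D X \<bullet> b) * h X \<partial>M) = (\<integral>X. (D X \<bullet> b) * h X \<partial>M) - (\<integral>X. (D X \<bullet> b) * p X \<partial>M)"
        using W_zero_orthogonal[OF W b G] by simp
      also have "\<dots> = (\<integral>X. (D X \<bullet> b) * (h X - p X) \<partial>M)"
        using ih by (simp add: right_diff_distrib)
      finally have "\<bar>\<integral>X. (D X \<bullet> b) * h X \<partial>M\<bar> = \<bar>\<integral>X. (D X \<bullet> b) * (h X - p X) \<partial>M\<bar>" by simp
      also have "\<dots> \<le> (\<integral>X. \<bar>(D X \<bullet> b) * (h X - p X)\<bar> \<partial>M)" by (rule integral_abs_bound)
      also have "\<dots> \<le> (\<integral>X. \<bar>D X \<bullet> b\<bar> * e \<partial>M)"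
      proof (rule integral_mono)
        have "integrable M (\<lambda>X. (D X \<bullet> b) * (h X - p X))" using ih by (simp add: right_diff_distrib)
        then show "integrable M (\<lambda>X. \<bar>(D X \<bullet> b) * (h X - p X)\<bar>)" by auto
        show "integrable M (\<lambda>X. \<bar>D X \<bullet> b\<bar> * e)" using iD by auto
        fix X assume "X \<in> space M"
        then have "X \<in> closure \<Omega>" using closure_subset by (auto simp: space_M)
        then have "\<bar>h X - p X\<bar> \<le> e" using p(2) by (simp add: less_imp_le)
        then show "\<bar>(D X \<bullet> b) * (h X - p X)\<bar> \<le> \<bar>D X \<bullet> b\<bar> * e"
          unfolding abs_mult by (intro mult_left_mono) auto
      qed
      finally show ?thesis by (simp add: A_def mult.commute)
    qed
    have "\<bar>\<integral>X. (D X \<bullet> b) * h X \<partial>M\<bar> \<le> 0"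
    proof (rule field_le_epsilon)
      fix e :: real assume "e > 0"
      have "e / (A + 1) * A \<le> e" using A \<open>e > 0\<close> by (simp add: field_simps)
      then show "\<bar>\<integral>X. (D X \<bullet> b) * h X \<partial>M\<bar> \<le> 0 + e"
        using small[of "e / (A + 1)"] A \<open>e > 0\<close> by simp
    qed
    then show ?thesis by simp
  qed
  have orth': "(\<integral>X. D X \<bullet> H X \<partial>M) = 0" if H: "continuous_on UNIV H" for H
  proof -
    have cH: "continuous_on UNIV (\<lambda>X. H X \<bullet> b)" for b by (intro continuous_intros H)
    have "(\<integral>X. D X \<bullet> H X \<partial>M) = (\<integral>X. (\<Sum>b\<in>Basis. (D X \<bullet> b) * (H X \<bullet> b)) \<partial>M)"
      by (intro Bochner_Integration.integral_cong refl) (rule euclidean_inner)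
    also have "\<dots> = (\<Sum>b\<in>Basis. \<integral>X. (D X \<bullet> b) * (H X \<bullet> b) \<partial>M)"
    proof (rule Bochner_Integration.integral_sum)
      fix b :: "real \<times> (real ^ 'm)" assume "b \<in> Basis"
      have "integrable M (\<lambda>X. D X \<bullet> ((H X \<bullet> b) *\<^sub>R b))"
        by (intro square_integrable_inner D square_integrable_continuous continuous_intros H)
      then show "integrable M (\<lambda>X. (D X \<bullet> b) * (H X \<bullet> b))" by (simp add: mult.commute)
    qed
    also have "\<dots> = 0" using orth[OF _ cH] by simp
    finally show ?thesis .
  qed
  obtain \<phi> where p: "\<And>n. \<phi> n \<in> C10 \<Omega>" "L2_tendsto M \<phi> (\<lambda>X. 0)" "L2_tendsto M (\<lambda>n. qgrad l (\<phi> n)) D"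
    using W unfolding W_def by blast
  \<comment> \<open>\<open>D\<close> is orthogonal to all continuous fields and is an L^2 limit of
    such fields, hence orthogonal to itself.\<close>
  have "(\<lambda>n. \<integral>X. D X \<bullet> qgrad l (\<phi> n) X \<partial>M) \<longlonglongrightarrow> (\<integral>X. D X \<bullet> D X \<partial>M)"
    by (intro L2_tendsto_inner p L2_tendsto_const D)
  then have "(\<integral>X. (norm (D X))\<^sup>2 \<partial>M) = 0"
    using orth'[OF qgrad_continuous[OF p(1)]] by (simp add: LIMSEQ_const_iff power2_norm_eq_inner)
  then show ?thesis by (rule integral_norm2_eq_0D[OF D])
qed

lemma W_unique:
  assumes "W u U" "W u U'"
  shows "AE X in M. U X = U' X"
proof -
  have "W (\<lambda>X. 0) (\<lambda>X. U X - U' X)" using W_diff[OF assms] by simp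
  from W_zero_unique[OF this] show ?thesis by simp
qed

text \<open>The values converge by the Lipschitz bound; the gradients converge because
  \<open>\<beta>' (\<phi> n X)\<close> is bounded and converges almost everywhere along a
  subsequence. Continuity of \<open>\<beta>'\<close> is what excludes the positive part
  itself.\<close>

lemma W_chain:
  assumes W: "W u U" and \<beta>: "\<And>t::real. (\<beta> has_field_derivative \<beta>' t) (at t)" "continuous_on UNIV \<beta>'"
     "\<beta> 0 = 0" "\<And>t. \<bar>\<beta>' t\<bar> \<le> B"
  shows "W (\<lambda>X. \<beta> (u X)) (\<lambda>X. \<beta>' (u X) *\<^sub>R U X)"
proof -
  obtain \<phi> where p: "\<And>n. \<phi> n \<in> C10 \<Omega>" "L2_tendsto M \<phi> u" "L2_tendsto M (\<lambda>n. qgrad l (\<phi> n)) U"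
    "AE X in M. (\<lambda>n. \<phi> n X) \<longlonglongrightarrow> u X"
    by (rule W_E[OF W], rule that)
  have c\<beta>: "continuous_on UNIV \<beta>" using \<beta>(1) by (meson DERIV_isCont continuous_at_imp_continuous_on)
  have mu[measurable]: "u \<in> borel_measurable M" by (rule square_integrable_measurable[OF W_square_integrable(1)[OF W]])
  have mp[measurable]: "\<phi> n \<in> borel_measurable M" for n by (rule square_integrable_measurable[OF L2_tendstoD(1)[OF p(2)]])
  have [measurable]: "\<beta> \<in> borel_measurable borel" "\<beta>' \<in> borel_measurable borel"
    using c\<beta> \<beta>(2) by (auto intro: borel_measurable_continuous_onI)
  have lip: "\<bar>\<beta> s - \<beta> t\<bar> \<le> B * \<bar>s - t\<bar>" for s t
  proof -
    have "norm (\<beta> s - \<beta> t) \<le> B * norm (s - t)"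
      by (rule field_differentiable_bound[of UNIV \<beta> \<beta>']) (use \<beta> in \<open>auto intro: has_field_derivative_at_within\<close>)
    then show ?thesis by simp
  qed
  have B: "B \<ge> 0" using \<beta>(4)[of 0] by linarith
  have lip2: "(\<beta> s - \<beta> t)\<^sup>2 \<le> B\<^sup>2 * (s - t)\<^sup>2" for s t
    using power_mono[OF lip[of s t], of 2] by (simp add: power_mult_distrib)
  have si: "square_integrable M (\<lambda>X. \<beta> (w X))" if w: "square_integrable M w" for w
  proof -
    have [measurable]: "w \<in> borel_measurable M" by (rule square_integrable_measurable[OF w])
    show ?thesis
      unfolding square_integrable_def
    proof
      show "(\<lambda>X. \<beta> (w X)) \<in> borel_measurable M" by measurable
      show "integrable M (\<lambda>X. (norm (\<beta> (w X)))\<^sup>2)"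
        by (rule Bochner_Integration.integrable_bound[of _ "\<lambda>X. B\<^sup>2 * (norm (w X))\<^sup>2"])
          (use square_integrable_norm2[OF w] lip2[of _ 0] \<beta>(3) in \<open>auto intro!: AE_I2\<close>)
    qed
  qed
  have 1: "L2_tendsto M (\<lambda>n X. \<beta> (\<phi> n X)) (\<lambda>X. \<beta> (u X))"
  proof (rule L2_tendsto_bound[where b="\<lambda>n. B\<^sup>2 * (\<integral>X. (norm (\<phi> n X - u X))\<^sup>2 \<partial>M)"])
    show "(\<lambda>n. B\<^sup>2 * (\<integral>X. (norm (\<phi> n X - u X))\<^sup>2 \<partial>M)) \<longlonglongrightarrow> 0"
      using tendsto_mult_left[OF L2_tendstoD(3)[OF p(2)], of "B\<^sup>2"] by simp
    show "(\<integral>X. (norm (\<beta> (\<phi> n X) - \<beta> (u X)))\<^sup>2 \<partial>M) \<le> B\<^sup>2 * (\<integral>X. (norm (\<phi> n X - u X))\<^sup>2 \<partial>M)" for n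
    proof -
      have "(\<integral>X. (norm (\<beta> (\<phi> n X) - \<beta> (u X)))\<^sup>2 \<partial>M) \<le> (\<integral>X. B\<^sup>2 * (norm (\<phi> n X - u X))\<^sup>2 \<partial>M)"
      proof (rule integral_mono)
        show "integrable M (\<lambda>X. (norm (\<beta> (\<phi> n X) - \<beta> (u X)))\<^sup>2)"
          by (intro square_integrable_norm2 square_integrable_diff si L2_tendstoD(1,2)[OF p(2)])
        show "integrable M (\<lambda>X. B\<^sup>2 * (norm (\<phi> n X - u X))\<^sup>2)"
          by (intro integrable_mult_right square_integrable_norm2 square_integrable_diff L2_tendstoD(1,2)[OF p(2)])
      qed (simp add: lip2)
      then show ?thesis by simp
    qed
  qed (intro si L2_tendstoD(1,2)[OF p(2)])+
  have 2: "L2_tendsto M (\<lambda>n X. \<beta>' (\<phi> n X) *\<^sub>R qgrad l (\<phi> n) X) (\<lambda>X. \<beta>' (u X) *\<^sub>R U X)"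
  proof (rule L2_tendsto_bounded_mult[where B=B, OF p(3)])
    show "AE X in M. (\<lambda>n. \<beta>' (\<phi> n X)) \<longlonglongrightarrow> \<beta>' (u X)"
      using p(4)
    proof eventually_elim
      case (elim X)
      show ?case by (rule continuous_on_tendsto_compose[OF \<beta>(2) elim]) auto
    qed
  qed (auto simp: \<beta>(4))
  show ?thesis
  proof (rule W_I[of "\<lambda>n X. \<beta> (\<phi> n X)"])
    show "(\<lambda>X. \<beta> (\<phi> n X)) \<in> C10 \<Omega>" for n by (rule C10_compose[OF p(1) \<beta>(1-3)])
    have "qgrad l (\<lambda>X. \<beta> (\<phi> n X)) = (\<lambda>X. \<beta>' (\<phi> n X) *\<^sub>R qgrad l (\<phi> n) X)" for n
      by (simp add: qgrad_def[abs_def] C10_compose(2)[OF p(1) \<beta>(1-3)] grushin_sqrtA_linear)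
    then show "L2_tendsto M (\<lambda>n. qgrad l (\<lambda>X. \<beta> (\<phi> n X))) (\<lambda>X. \<beta>' (u X) *\<^sub>R U X)" using 2 by simp
  qed (rule 1)
qed

lemma W_gam: "W u U \<Longrightarrow> W (\<lambda>X. gam (u X)) (\<lambda>X. gam' (u X) *\<^sub>R U X)"
  by (rule W_chain[where B=1]) (auto simp: gam_has_derivative gam_continuous gam_nonpos gam_bounds abs_le_iff
     intro: order_trans[OF _ gam_bounds(3)])

text \<open>\<open>gam z\<close> has the gradient datum \<open>gam' z\<close> times
  \<open>Z\<close>, which vanishes almost everywhere, so the Poincare inequality forces
  \<open>gam z = 0\<close>.\<close>

lemma W_nonpos:
  assumes W: "W z Z" and Z: "AE X in M. z X > 0 \<longrightarrow> Z X = 0"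
  shows "AE X in M. z X \<le> 0"
proof -
  obtain r where r: "\<Omega> \<subseteq> cball 0 r" using ball_ex by auto
  note G = W_gam[OF W]
  have "(\<integral>X. (norm (gam' (z X) *\<^sub>R Z X))\<^sup>2 \<partial>M) = (\<integral>X. 0 \<partial>M)"
  proof (rule integral_cong_AE)
    show "AE X in M. (norm (gam' (z X) *\<^sub>R Z X))\<^sup>2 = 0"
      using Z by eventually_elim (metis gam_nonpos(2) linorder_not_le norm_zero scaleR_zero_left scaleR_zero_right zero_power2)
  qed (use square_integrable_norm2[OF W_square_integrable(2)[OF G]] in auto)
  then have "(\<integral>X. (norm (gam (z X)))\<^sup>2 \<partial>M) \<le> 0" using W_poincare[OF G r] by simp
  then have "(\<integral>X. (norm (gam (z X)))\<^sup>2 \<partial>M) = 0" by (intro antisym) auto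
  from integral_norm2_eq_0D[OF W_square_integrable(1)[OF G] this]
  show ?thesis by eventually_elim (metis gam_pos(1) less_irrefl linorder_not_le)
qed

text \<open>The common end of several comparison arguments: subtracting two problems and testing
  with \<open>gam z\<close> yields this inequality, whose integrand is nonnegative and is positive
  where \<open>z > 0\<close> and \<open>Z \<noteq> 0\<close>.\<close>

lemma W_nonpos_energy:
  assumes W: "W z Z" and le: "(\<integral>X. Z X \<bullet> (gam' (z X) *\<^sub>R Z X) \<partial>M) \<le> 0"
  shows "AE X in M. z X \<le> 0"
proof (rule W_nonpos[OF W])
  note S = W_square_integrable[OF W] W_square_integrable[OF W_gam[OF W]]
  have nn: "Z X \<bullet> (gam' (z X) *\<^sub>R Z X) \<ge> 0" for X using gam_bounds by simp
  have "(\<integral>X. Z X \<bullet> (gam' (z X) *\<^sub>R Z X) \<partial>M) = 0"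
    using le nn by (intro antisym Bochner_Integration.integral_nonneg) auto
  then have "AE X in M. Z X \<bullet> (gam' (z X) *\<^sub>R Z X) = 0"
    using integral_nonneg_eq_0_iff_AE[OF square_integrable_inner[OF S(2,4)]] nn by auto
  then show "AE X in M. z X > 0 \<longrightarrow> Z X = 0"
    by eventually_elim (auto dest: gam_pos(2))
qed

text \<open>Density of \<open>C10\<close>, which relies on \<open>h\<close> being in L^2. It serves
  the regularised problems; the singular right-hand side is not known to admit such an
  extension.\<close>

lemma W_test:
  assumes h: "square_integrable M h" and U: "square_integrable M U"
    and eq: "\<And>v. v \<in> C10 \<Omega> \<Longrightarrow> (\<integral>X. U X \<bullet> qgrad l v X \<partial>M) = (\<integral>X. h X * v X \<partial>M)"
    and W: "W v V"
  shows "(\<integral>X. U X \<bullet> V X \<partial>M) = (\<integral>X. h X * v X \<partial>M)"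
proof -
  obtain \<phi> where p: "\<And>n. \<phi> n \<in> C10 \<Omega>" "L2_tendsto M \<phi> v" "L2_tendsto M (\<lambda>n. qgrad l (\<phi> n)) V"
    using W unfolding W_def by blast
  have "(\<lambda>n. \<integral>X. U X \<bullet> qgrad l (\<phi> n) X \<partial>M) \<longlonglongrightarrow> (\<integral>X. U X \<bullet> V X \<partial>M)"
    by (intro L2_tendsto_inner p L2_tendsto_const U)
  moreover have "(\<lambda>n. \<integral>X. h X \<bullet> \<phi> n X \<partial>M) \<longlonglongrightarrow> (\<integral>X. h X \<bullet> v X \<partial>M)"
    by (intro L2_tendsto_inner p L2_tendsto_const h)
  ultimately show ?thesis using eq[OF p(1)] LIMSEQ_unique by (simp; blast)
qed

end

section \<open>Semilinear problems with bounded data\<close>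

lemma continuous_antiderivative:
  fixes g :: "real \<Rightarrow> real"
  assumes "continuous_on UNIV g"
  shows "\<exists>G. \<forall>t. (G has_field_derivative g t) (at t)"
proof -
  have "\<exists>H. \<forall>x. -\<infinity> < ereal x \<longrightarrow> ereal x < \<infinity> \<longrightarrow> (H has_vector_derivative g x) (at x)"
    using assms by (intro einterval_antiderivative) (auto simp: continuous_on_eq_continuous_at)
  then show ?thesis by (auto simp: has_real_derivative_iff_has_vector_derivative)
qed

text \<open>\<open>G\<close> is the convex potential of the nonlinearity. Its tangent lower bound
  gives coercivity and convexity of the energy, its quadratic upper bound gives the Euler-Lagrange
  equation, so the functional itself is never differentiated.\<close>

lemma antimono_antiderivative:
  fixes g :: "real \<Rightarrow> real"
  assumes anti: "\<And>s t. s \<le> t \<Longrightarrow> g t \<le> g s" and lip: "\<And>s t. \<bar>g s - g t\<bar> \<le> L * \<bar>s - t\<bar>"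
  shows "\<exists>G. (\<forall>t. (G has_field_derivative - g t) (at t)) \<and> G 0 = 0 \<and>
     (\<forall>a b. G a - g a * (b - a) \<le> G b) \<and> (\<forall>a b. G b \<le> G a - g a * (b - a) + L * (b - a)\<^sup>2)"
proof -
  have L: "L \<ge> 0" using lip[of 1 0] by auto
  have "continuous_on UNIV g"
    by (rule lipschitz_on_continuous_on[of L]) (auto simp: lipschitz_on_def dist_real_def lip L)
  then have "continuous_on UNIV (\<lambda>t. - g t)" by (rule continuous_on_minus)
  then obtain H where H: "\<And>x. (H has_field_derivative - g x) (at x)"
    using continuous_antiderivative by blast
  define G where "G t = H t - H 0" for t
  have G: "(G has_field_derivative - g x) (at x)" for x
    unfolding G_def using DERIV_diff[OF H DERIV_const] by simp
  have mvt: "\<exists>z. min a b \<le> z \<and> z \<le> max a b \<and> G b = G a - g z * (b - a)" for a b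
  proof (cases a b rule: linorder_cases)
    case less
    obtain z where "a < z" "z < b" "G b - G a = (b - a) * (- g z)"
      using MVT2[OF less, of G "\<lambda>x. - g x"] G by blast
    then show ?thesis by (intro exI[of _ z]) (auto simp: algebra_simps)
  next
    case greater
    obtain z where "b < z" "z < a" "G a - G b = (a - b) * (- g z)"
      using MVT2[OF greater, of G "\<lambda>x. - g x"] G by blast
    then show ?thesis by (intro exI[of _ z]) (auto simp: algebra_simps)
  qed auto
  have est: "0 \<le> (g a - g z) * (b - a) \<and> (g a - g z) * (b - a) \<le> L * (b - a)\<^sup>2"
    if z: "min a b \<le> z" "z \<le> max a b" for a b z
  proof
    show "0 \<le> (g a - g z) * (b - a)"
    proof (cases "a \<le> b")
      case True
      then show ?thesis using anti[of a z] z by (intro mult_nonneg_nonneg) auto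
    next
      case False
      then show ?thesis using anti[of z a] z by (intro mult_nonpos_nonpos) auto
    qed
    have "(g a - g z) * (b - a) \<le> \<bar>g a - g z\<bar> * \<bar>b - a\<bar>" by (metis abs_ge_self abs_mult)
    also have "\<dots> \<le> (L * \<bar>a - z\<bar>) * \<bar>b - a\<bar>" by (intro mult_right_mono lip) auto
    also have "\<dots> \<le> (L * \<bar>b - a\<bar>) * \<bar>b - a\<bar>" using z L
      by (intro mult_right_mono mult_left_mono) auto
    also have "\<dots> = L * (b - a)\<^sup>2" by (simp add: power2_eq_square[symmetric] abs_mult_self_eq mult.assoc)
    finally show "(g a - g z) * (b - a) \<le> L * (b - a)\<^sup>2" .
  qed
  have 1: "G a - g a * (b - a) \<le> G b" and 2: "G b \<le> G a - g a * (b - a) + L * (b - a)\<^sup>2" for a b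
  proof -
    obtain z where z: "min a b \<le> z" "z \<le> max a b" "G b = G a - g z * (b - a)" using mvt by blast
    show "G a - g a * (b - a) \<le> G b" "G b \<le> G a - g a * (b - a) + L * (b - a)\<^sup>2"
      using est[OF z(1,2)] z(3) by (auto simp: algebra_simps)
  qed
  show ?thesis using G 1 2 by (intro exI[of _ G]) (auto simp: G_def)
qed

context grushin_domain
begin

lemma bounded_mult_square_integrable:
  fixes F h :: "real \<times> (real ^ 'm) \<Rightarrow> real"
  assumes "F \<in> borel_measurable M" "\<And>X. X \<in> \<Omega> \<Longrightarrow> \<bar>F X\<bar> \<le> A" "square_integrable M h"
  shows "square_integrable M (\<lambda>X. F X * h X)"
  using square_integrable_bounded_mult[OF assms(3,1), of A] assms(2) by (simp add: space_M)

text \<open>The energy is uniformly convex on \<open>C10 \<Omega>\<close> by the parallelogram law, so minimising sequences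
  are Cauchy and no weak compactness is needed.\<close>

lemma semilinear_solution:
  fixes F :: "real \<times> (real ^ 'm) \<Rightarrow> real" and g :: "real \<Rightarrow> real"
  assumes F: "F \<in> borel_measurable M" "\<And>X. X \<in> \<Omega> \<Longrightarrow> 0 \<le> F X" "\<And>X. X \<in> \<Omega> \<Longrightarrow> F X \<le> A"
    and g: "\<And>s t. s \<le> t \<Longrightarrow> g t \<le> g s" "\<And>t. 0 \<le> g t" "\<And>t. g t \<le> B" "\<And>s t. \<bar>g s - g t\<bar> \<le> L * \<bar>s - t\<bar>"
  shows "\<exists>u U. W u U \<and> square_integrable M (\<lambda>X. F X * g (u X)) \<and>
     (\<forall>v\<in>C10 \<Omega>. (\<integral>X. U X \<bullet> qgrad l v X \<partial>M) = (\<integral>X. F X * g (u X) * v X \<partial>M))"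
proof -
  obtain r where r: "r > 0" "\<Omega> \<subseteq> cball 0 r" using ball_ex by auto
  have L: "L \<ge> 0" using g(4)[of 1 0] by auto
  obtain G where G: "\<And>t. (G has_field_derivative - g t) (at t)" "G 0 = 0"
     "\<And>a b. G a - g a * (b - a) \<le> G b" "\<And>a b. G b \<le> G a - g a * (b - a) + L * (b - a)\<^sup>2"
    using antimono_antiderivative[OF g(1) g(4)] by blast
  have cG: "continuous_on UNIV G" using G(1) by (meson DERIV_isCont continuous_at_imp_continuous_on)
  have cg: "continuous_on UNIV g"
    by (rule lipschitz_on_continuous_on[of L]) (auto simp: lipschitz_on_def dist_real_def g(4) L)
  have Fa: "\<bar>F X\<bar> \<le> A" if "X \<in> \<Omega>" for X using F that by fastforce
  have FM: "square_integrable M (\<lambda>X. F X * h X)" if "square_integrable M h" for h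
    by (rule bounded_mult_square_integrable[OF F(1) Fa that])
  have iF: "integrable M (\<lambda>X. F X * h X)" if "square_integrable M h" for h
    by (rule square_integrable_integrable[OF finite_M FM[OF that]])
  define N where "N \<phi> = (\<integral>X. (norm (qgrad l \<phi> X))\<^sup>2 \<partial>M)" for \<phi>
  define E where "E \<phi> = (\<integral>X. F X * G (\<phi> X) \<partial>M)" for \<phi>
  define J where "J \<phi> = N \<phi> / 2 + E \<phi>" for \<phi>
  have sG: "square_integrable M (\<lambda>X. G (\<phi> X))" if "\<phi> \<in> C10 \<Omega>" for \<phi>
    by (intro square_integrable_continuous continuous_on_compose2[OF cG C10_continuous[OF that]]) auto
  have sg: "square_integrable M (\<lambda>X. g (\<phi> X))" if "\<phi> \<in> C10 \<Omega>" for \<phi>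
    by (intro square_integrable_continuous continuous_on_compose2[OF cg C10_continuous[OF that]]) auto
  \<comment> \<open>From Young's inequality A B |phi| <= phi^2 / (8 r^2) + c: the Poincare constant
    4 r^2 turns the first term into half of the Dirichlet integral, which \<open>J\<close>
    contains.\<close>
  define c where "c = 2 * r\<^sup>2 * (A * B)\<^sup>2"
  have lower: "- (\<integral>X. c \<partial>M) \<le> J \<phi>" if phi: "\<phi> \<in> C10 \<Omega>" for \<phi>
  proof -
    have s: "square_integrable M \<phi>" by (rule C10_square_integrable[OF phi])
    have "(\<integral>X. (norm (\<phi> X))\<^sup>2 * (- 1 / (8 * r\<^sup>2)) - c \<partial>M) \<le> E \<phi>"
      unfolding E_def
    proof (rule integral_mono)
      show "integrable M (\<lambda>X. (norm (\<phi> X))\<^sup>2 * (- 1 / (8 * r\<^sup>2)) - c)"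
        by (intro Bochner_Integration.integrable_diff integrable_mult_left square_integrable_norm2 s
            finite_measure.integrable_const finite_M)
      show "integrable M (\<lambda>X. F X * G (\<phi> X))" by (intro iF sG phi)
      fix X assume "X \<in> space M"
      then have X: "X \<in> \<Omega>" by (simp add: space_M)
      have "\<bar>F X * (g 0 * \<phi> X)\<bar> \<le> A * (B * \<bar>\<phi> X\<bar>)"
        unfolding abs_mult using Fa[OF X] g(2,3)[of 0] by (intro mult_mono) auto
      moreover have "F X * (- (g 0 * \<phi> X)) \<le> F X * G (\<phi> X)"
        using G(3)[of 0 "\<phi> X"] G(2) F(2)[OF X] by (intro mult_left_mono) auto
      moreover have "A * B * \<bar>\<phi> X\<bar> \<le> (\<phi> X)\<^sup>2 / (8 * r\<^sup>2) + c"
      proof -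
        have "0 \<le> (\<bar>\<phi> X\<bar> / (4 * r) - r * (A * B))\<^sup>2" by simp
        also have "\<dots> = (\<phi> X)\<^sup>2 / (16 * r\<^sup>2) + r\<^sup>2 * (A * B)\<^sup>2 - A * B * \<bar>\<phi> X\<bar> / 2"
          using r by (simp add: power2_diff power_mult_distrib power_divide)
        finally show ?thesis by (simp add: c_def)
      qed
      ultimately show "(norm (\<phi> X))\<^sup>2 * (- 1 / (8 * r\<^sup>2)) - c \<le> F X * G (\<phi> X)"
        by (simp add: mult.assoc)
    qed
    also have "(\<integral>X. (norm (\<phi> X))\<^sup>2 * (- 1 / (8 * r\<^sup>2)) - c \<partial>M) = (\<integral>X. (norm (\<phi> X))\<^sup>2 \<partial>M) * (- 1 / (8 * r\<^sup>2)) - (\<integral>X. c \<partial>M)"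
      by (subst Bochner_Integration.integral_diff)
        (intro integrable_mult_left square_integrable_norm2 s finite_measure.integrable_const finite_M | simp)+
    finally have "- (\<integral>X. c \<partial>M) \<le> E \<phi> + (\<integral>X. (norm (\<phi> X))\<^sup>2 \<partial>M) / (8 * r\<^sup>2)" by simp
    moreover have "(\<integral>X. (norm (\<phi> X))\<^sup>2 \<partial>M) / (8 * r\<^sup>2) \<le> N \<phi> / 2"
      using poincare_C10[OF phi r(2)] r by (simp add: N_def field_simps)
    ultimately show ?thesis by (simp add: J_def)
  qed
  define \<mu> where "\<mu> = Inf (J ` C10 \<Omega>)"
  have bdd: "bdd_below (J ` C10 \<Omega>)" using lower by (auto intro!: bdd_belowI)
  have ne: "J ` C10 \<Omega> \<noteq> {}" using C10_zero(1) by blast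
  have mu: "\<mu> \<le> J \<phi>" if "\<phi> \<in> C10 \<Omega>" for \<phi>
    unfolding \<mu>_def using that bdd by (intro cInf_lower) auto
  have "\<exists>\<phi>\<in>C10 \<Omega>. J \<phi> < \<mu> + 1 / (real k + 1)" for k :: nat
    using cInf_lessD[OF ne, of "\<mu> + 1 / (real k + 1)"] unfolding \<mu>_def by auto
  then have "\<exists>\<phi>. \<forall>k. \<phi> k \<in> C10 \<Omega> \<and> J (\<phi> k) < \<mu> + 1 / (real k + 1)"
    by (intro choice allI) (simp add: Bex_def)
  then obtain \<phi> where phi: "\<And>k. \<phi> k \<in> C10 \<Omega>" "\<And>k. J (\<phi> k) < \<mu> + 1 / (real k + 1)" by auto
  \<comment> \<open>The midpoint has energy at least \<open>\<mu>\<close>, while convexity of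
    \<open>E\<close> and the parallelogram law put it below the mean of the two energies by an
    eighth of their squared distance in the Dirichlet norm.\<close>
  have par: "N (\<lambda>X. \<phi> i X - \<phi> j X) \<le> 4 * (1 / (real i + 1) + 1 / (real j + 1))" for i j
  proof -
    define \<psi> where "\<psi> X = (1 / 2) * (\<phi> i X + \<phi> j X)" for X
    have psi: "\<psi> \<in> C10 \<Omega>" unfolding \<psi>_def by (intro C10_cmult C10_add phi)
    note S = C10_square_integrable[OF phi(1)]
    have "N \<psi> = (\<integral>X. (norm (qgrad l (\<phi> i) X))\<^sup>2 / 2 + (norm (qgrad l (\<phi> j) X))\<^sup>2 / 2
       - (norm (qgrad l (\<phi> i) X - qgrad l (\<phi> j) X))\<^sup>2 / 4 \<partial>M)"
      unfolding N_def
    proof (rule Bochner_Integration.integral_cong[OF refl])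
      fix X
      have "qgrad l \<psi> X = (1 / 2) *\<^sub>R (qgrad l (\<phi> i) X + qgrad l (\<phi> j) X)"
        unfolding \<psi>_def[abs_def] using qgrad_cmult[OF C10_add(1)[OF phi(1) phi(1)], of "1/2" i j]
          qgrad_add[OF phi(1) phi(1), of i j] by simp
      then show "(norm (qgrad l \<psi> X))\<^sup>2 = (norm (qgrad l (\<phi> i) X))\<^sup>2 / 2 + (norm (qgrad l (\<phi> j) X))\<^sup>2 / 2
         - (norm (qgrad l (\<phi> i) X - qgrad l (\<phi> j) X))\<^sup>2 / 4"
        by (simp add: power2_norm_eq_inner inner_add_left inner_add_right inner_diff_left inner_diff_right
            inner_commute power_mult_distrib field_simps)
    qed
    also have "\<dots> = N (\<phi> i) / 2 + N (\<phi> j) / 2 - N (\<lambda>X. \<phi> i X - \<phi> j X) / 4"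
      unfolding N_def qgrad_diff[OF phi(1) phi(1)]
      by (subst Bochner_Integration.integral_diff Bochner_Integration.integral_add |
          intro Bochner_Integration.integrable_add integrable_divide square_integrable_norm2 square_integrable_diff S | simp)+
    finally have 1: "N \<psi> = N (\<phi> i) / 2 + N (\<phi> j) / 2 - N (\<lambda>X. \<phi> i X - \<phi> j X) / 4" .
    have "E \<psi> \<le> (\<integral>X. F X * G (\<phi> i X) / 2 + F X * G (\<phi> j X) / 2 \<partial>M)"
      unfolding E_def
    proof (rule integral_mono)
      show "integrable M (\<lambda>X. F X * G (\<psi> X))" by (intro iF sG psi)
      show "integrable M (\<lambda>X. F X * G (\<phi> i X) / 2 + F X * G (\<phi> j X) / 2)"
        by (intro Bochner_Integration.integrable_add integrable_divide iF sG phi)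
      fix X assume "X \<in> space M"
      then have X: "X \<in> \<Omega>" by (simp add: space_M)
      have "G (\<psi> X) \<le> G (\<phi> i X) / 2 + G (\<phi> j X) / 2"
        using G(3)[of "\<psi> X" "\<phi> i X"] G(3)[of "\<psi> X" "\<phi> j X"] by (simp add: \<psi>_def algebra_simps)
      then have "F X * G (\<psi> X) \<le> F X * (G (\<phi> i X) / 2 + G (\<phi> j X) / 2)"
        using F(2)[OF X] by (intro mult_left_mono)
      then show "F X * G (\<psi> X) \<le> F X * G (\<phi> i X) / 2 + F X * G (\<phi> j X) / 2" by (simp add: algebra_simps)
    qed
    also have "\<dots> = E (\<phi> i) / 2 + E (\<phi> j) / 2"
      unfolding E_def by (subst Bochner_Integration.integral_add) (auto intro!: integrable_divide iF sG phi)
    finally have "J \<psi> \<le> J (\<phi> i) / 2 + J (\<phi> j) / 2 - N (\<lambda>X. \<phi> i X - \<phi> j X) / 8"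
      using 1 by (simp add: J_def add_divide_distrib diff_divide_distrib)
    then show ?thesis using mu[OF psi] phi(2)[of i] phi(2)[of j] by (simp add: algebra_simps)
  qed
  have lim0: "(\<lambda>k. 1 / (real k + 1)) \<longlonglongrightarrow> 0"
    using LIMSEQ_inverse_real_of_nat by (simp add: inverse_eq_divide add.commute)
  have "\<exists>N'. \<forall>i\<ge>N'. \<forall>j\<ge>N'. (\<integral>X. (norm (qgrad l (\<phi> i) X - qgrad l (\<phi> j) X))\<^sup>2 \<partial>M) < e" if "e > 0" for e
  proof -
    have "e / 8 > 0" using that by simp
    from order_tendstoD(2)[OF lim0 this] obtain N' where N': "\<And>k. k \<ge> N' \<Longrightarrow> 1 / (real k + 1) < e / 8"
      by (auto simp: eventually_sequentially)
    have "(\<integral>X. (norm (qgrad l (\<phi> i) X - qgrad l (\<phi> j) X))\<^sup>2 \<partial>M) < e" if "i \<ge> N'" "j \<ge> N'" for i j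
    proof -
      have "(\<integral>X. (norm (qgrad l (\<phi> i) X - qgrad l (\<phi> j) X))\<^sup>2 \<partial>M) \<le> 4 * (1 / (real i + 1) + 1 / (real j + 1))"
        using par[of i j] unfolding N_def qgrad_diff[OF phi(1) phi(1)] .
      also have "\<dots> < 4 * (e / 8 + e / 8)"
        by (intro mult_strict_left_mono add_strict_mono N' that) simp
      finally show ?thesis by simp
    qed
    then show ?thesis by blast
  qed
  then obtain u U where WU: "W u U" and lu: "L2_tendsto M \<phi> u" and lU: "L2_tendsto M (\<lambda>n. qgrad l (\<phi> n)) U"
    using W_complete[of \<phi> "\<lambda>n. qgrad l (\<phi> n)", OF W_C10[OF phi(1)]] by blast
  have [measurable]: "u \<in> borel_measurable M" by (rule square_integrable_measurable[OF W_square_integrable(1)[OF WU]])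
  have [measurable]: "g \<in> borel_measurable borel" using cg by (rule borel_measurable_continuous_onI)
  note [measurable] = F(1)
  have sgu: "square_integrable M (\<lambda>X. g (u X))"
    by (rule square_integrable_bounded[where B=B]) (use g(2,3) in auto)
  have lg: "L2_tendsto M (\<lambda>k X. F X * g (\<phi> k X)) (\<lambda>X. F X * g (u X))"
  proof (rule L2_tendsto_bound[where b="\<lambda>k. (A * L)\<^sup>2 * (\<integral>X. (norm (\<phi> k X - u X))\<^sup>2 \<partial>M)"])
    show "(\<lambda>k. (A * L)\<^sup>2 * (\<integral>X. (norm (\<phi> k X - u X))\<^sup>2 \<partial>M)) \<longlonglongrightarrow> 0"
      using tendsto_mult_left[OF L2_tendstoD(3)[OF lu], of "(A * L)\<^sup>2"] by simp
    show "(\<integral>X. (norm (F X * g (\<phi> k X) - F X * g (u X)))\<^sup>2 \<partial>M) \<le> (A * L)\<^sup>2 * (\<integral>X. (norm (\<phi> k X - u X))\<^sup>2 \<partial>M)" for k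
    proof -
      have "(\<integral>X. (norm (F X * g (\<phi> k X) - F X * g (u X)))\<^sup>2 \<partial>M) \<le> (\<integral>X. (A * L)\<^sup>2 * (norm (\<phi> k X - u X))\<^sup>2 \<partial>M)"
      proof (rule integral_mono)
        show "integrable M (\<lambda>X. (norm (F X * g (\<phi> k X) - F X * g (u X)))\<^sup>2)"
          by (intro square_integrable_norm2 square_integrable_diff FM sgu sg phi)
        show "integrable M (\<lambda>X. (A * L)\<^sup>2 * (norm (\<phi> k X - u X))\<^sup>2)"
          by (intro integrable_mult_right square_integrable_norm2 square_integrable_diff L2_tendstoD(1,2)[OF lu])
        fix X assume "X \<in> space M"
        then have X: "X \<in> \<Omega>" by (simp add: space_M)
        have "\<bar>F X * (g (\<phi> k X) - g (u X))\<bar> \<le> A * (L * \<bar>\<phi> k X - u X\<bar>)"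
          unfolding abs_mult using Fa[OF X] by (intro mult_mono g(4)) auto
        then have "\<bar>F X * (g (\<phi> k X) - g (u X))\<bar>\<^sup>2 \<le> (A * (L * \<bar>\<phi> k X - u X\<bar>))\<^sup>2"
          by (intro power_mono) auto
        then show "(norm (F X * g (\<phi> k X) - F X * g (u X)))\<^sup>2 \<le> (A * L)\<^sup>2 * (norm (\<phi> k X - u X))\<^sup>2"
          by (simp add: power_mult_distrib right_diff_distrib mult.assoc)
      qed
      then show ?thesis by simp
    qed
  qed (intro FM sgu sg phi)+
  have "(\<integral>X. U X \<bullet> qgrad l v X \<partial>M) = (\<integral>X. F X * g (u X) * v X \<partial>M)" if v: "v \<in> C10 \<Omega>" for v
  proof -
    note sv = C10_square_integrable[OF v]
    have sv2: "square_integrable M (\<lambda>X. v X * v X)"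
      by (intro square_integrable_continuous continuous_intros C10_continuous[OF v])
    define a where "a k = (\<integral>X. qgrad l (\<phi> k) X \<bullet> qgrad l v X \<partial>M) - (\<integral>X. F X * g (\<phi> k X) * v X \<partial>M)" for k
    define a' where "a' = (\<integral>X. U X \<bullet> qgrad l v X \<partial>M) - (\<integral>X. F X * g (u X) * v X \<partial>M)"
    define C where "C = N v / 2 + L * (\<integral>X. F X * (v X * v X) \<partial>M)"
    have C: "C \<ge> 0"
    proof -
      have "0 \<le> (\<integral>X. F X * (v X * v X) \<partial>M)"
        by (rule Bochner_Integration.integral_nonneg) (simp add: F(2) space_M)
      then show ?thesis unfolding C_def N_def using L by simp
    qed
    have lim: "a \<longlonglongrightarrow> a'"
      unfolding a_def a'_def
      using L2_tendsto_inner[OF lg L2_tendsto_const[OF sv(1)]]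
      by (intro tendsto_diff L2_tendsto_inner lU L2_tendsto_const sv) simp
    \<comment> \<open>The variation is made around \<open>\<phi> k\<close>, since \<open>J\<close>
      is compared on \<open>C10\<close>, to which \<open>u\<close> need not belong; being a
      minimiser up to \<open>1 / (k + 1)\<close> is enough in the limit.\<close>
    have ineq: "0 \<le> 1 / (real k + 1) + s * a k + s\<^sup>2 * C" for k s
    proof -
      define \<psi> where "\<psi> X = \<phi> k X + s * v X" for X
      have psi: "\<psi> \<in> C10 \<Omega>" unfolding \<psi>_def by (intro C10_cmult C10_add phi v)
      have "qgrad l \<psi> = (\<lambda>X. qgrad l (\<phi> k) X + s *\<^sub>R qgrad l v X)"
        unfolding \<psi>_def[abs_def] using qgrad_add[OF phi(1) C10_cmult(1)[OF v], of k s] qgrad_cmult[OF v, of s] by simp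
      then have 1: "N \<psi> = N (\<phi> k) + 2 * s * (\<integral>X. qgrad l (\<phi> k) X \<bullet> qgrad l v X \<partial>M) + s\<^sup>2 * N v"
        unfolding N_def using integral_norm2_add[OF C10_square_integrable(2)[OF phi(1)] sv(2), of k s] by simp
      have i: "integrable M (\<lambda>X. F X * G (\<phi> k X))" "integrable M (\<lambda>X. F X * g (\<phi> k X) * v X)"
          "integrable M (\<lambda>X. F X * (v X * v X))"
        using iF[OF sG[OF phi(1)]] square_integrable_mult[OF FM[OF sg[OF phi(1)]] sv(1)] iF[OF sv2] by auto
      have "E \<psi> \<le> (\<integral>X. F X * G (\<phi> k X) - s * (F X * g (\<phi> k X) * v X) + L * s\<^sup>2 * (F X * (v X * v X)) \<partial>M)"
        unfolding E_def
      proof (rule integral_mono)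
        show "integrable M (\<lambda>X. F X * G (\<psi> X))" by (intro iF sG psi)
        show "integrable M (\<lambda>X. F X * G (\<phi> k X) - s * (F X * g (\<phi> k X) * v X) + L * s\<^sup>2 * (F X * (v X * v X)))"
          by (intro Bochner_Integration.integrable_add Bochner_Integration.integrable_diff integrable_mult_right i)
        fix X assume "X \<in> space M"
        then have X: "X \<in> \<Omega>" by (simp add: space_M)
        have "F X * G (\<psi> X) \<le> F X * (G (\<phi> k X) - g (\<phi> k X) * (\<psi> X - \<phi> k X) + L * (\<psi> X - \<phi> k X)\<^sup>2)"
          by (intro mult_left_mono G(4) F(2) X)
        also have "\<dots> = F X * G (\<phi> k X) - s * (F X * g (\<phi> k X) * v X) + L * s\<^sup>2 * (F X * (v X * v X))"
          by (simp add: \<psi>_def power2_eq_square algebra_simps)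
        finally show "F X * G (\<psi> X) \<le> F X * G (\<phi> k X) - s * (F X * g (\<phi> k X) * v X) + L * s\<^sup>2 * (F X * (v X * v X))" .
      qed
      also have "\<dots> = E (\<phi> k) - s * (\<integral>X. F X * g (\<phi> k X) * v X \<partial>M) + L * s\<^sup>2 * (\<integral>X. F X * (v X * v X) \<partial>M)"
        unfolding E_def using i by simp
      finally have "J \<psi> \<le> J (\<phi> k) + s * a k + s\<^sup>2 * C"
        unfolding J_def a_def C_def 1 by (simp add: algebra_simps add_divide_distrib)
      then show ?thesis using mu[OF psi] phi(2)[of k] by linarith
    qed
    have "0 \<le> s * a' + s\<^sup>2 * C" for s
    proof -
      have "(\<lambda>k. 1 / (real k + 1) + s * a k + s\<^sup>2 * C) \<longlonglongrightarrow> 0 + s * a' + s\<^sup>2 * C"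
        by (intro tendsto_intros lim0 lim)
      then show ?thesis using ineq by (intro LIMSEQ_le_const[of _ "s * a' + s\<^sup>2 * C" 0]) auto
    qed
    \<comment> \<open>The nearly optimal \<open>s\<close>; \<open>C + 1\<close> instead of
      \<open>C\<close> avoids a division by zero.\<close>
    from this[of "- a' / (2 * (C + 1))"] have "0 \<le> - a' / (2 * (C + 1)) * a' + (- a' / (2 * (C + 1)))\<^sup>2 * C" .
    also have "\<dots> \<le> - a' / (2 * (C + 1)) * a' + (- a' / (2 * (C + 1)))\<^sup>2 * (C + 1)"
      by (intro add_left_mono mult_left_mono) auto
    also have "\<dots> = - (a'\<^sup>2 / (4 * (C + 1)))"
    proof -
      define c' where "c' = C + 1"
      have "c' > 0" using C by (simp add: c'_def)
      then show ?thesis unfolding c'_def[symmetric] by (simp add: power2_eq_square field_simps)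
    qed
    finally have "a'\<^sup>2 / (4 * (C + 1)) \<le> 0" by simp
    then have "a'\<^sup>2 \<le> 0" using C by (simp add: divide_le_0_iff)
    then show ?thesis by (simp add: a'_def)
  qed
  then show ?thesis using WU FM[OF sgu] by blast
qed

end

section \<open>Barriers and propagation of positivity\<close>

text \<open>The increasing break points place both end points on the curve, whose image is a
  connected subset of \<Omega>.\<close>

lemma Lambda_connected_imp_connected:
  assumes "Lambda_connected l \<Omega>"
  shows "connected \<Omega>"
  unfolding connected_iff_connected_component
proof (intro ballI)
  fix P Q assume "P \<in> \<Omega>" "Q \<in> \<Omega>"
  then obtain \<gamma> and t :: "nat \<Rightarrow> real" and k where g: "continuous_on {t 0..t k} \<gamma>"
    "\<gamma> ` {t 0..t k} \<subseteq> \<Omega>" "\<gamma> (t 0) = P" "\<gamma> (t k) = Q" "\<forall>i<k. t i < t (Suc i)"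
    using assms unfolding Lambda_connected_def by metis
  have "t 0 \<le> t j" if "j \<le> k" for j
    using that by (induction j) (use g(5) in \<open>auto simp: Suc_le_eq intro: order_trans less_imp_le\<close>)
  then have "t 0 \<le> t k" by simp
  then have "P \<in> \<gamma> ` {t 0..t k}" "Q \<in> \<gamma> ` {t 0..t k}" using g(3,4) by (auto intro: rev_image_eqI)
  moreover have "connected (\<gamma> ` {t 0..t k})"
    by (rule connected_continuous_image[OF g(1)]) simp
  ultimately show "connected_component \<Omega> P Q"
    using g(2) unfolding connected_component_def by blast
qed

lemma sum_Basis_prod_real:
  fixes f :: "'a::euclidean_space \<times> 'b::euclidean_space \<Rightarrow> real"
  shows "sum f Basis = (\<Sum>i\<in>Basis. f (i, 0)) + (\<Sum>i\<in>Basis. f (0, i))"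
proof -
  have "inj_on (\<lambda>u. (u::'a, 0::'b)) Basis" "inj_on (\<lambda>u. (0::'a, u::'b)) Basis"
    by (auto intro!: inj_onI)
  then show ?thesis
    unfolding Basis_prod_def by (subst sum.union_disjoint) (auto simp: sum.reindex)
qed

text \<open>A squared distance, so that radial functions are smooth at the centre. The barrier uses
  \<open>\<kappa> = 1\<close>; the average estimate uses |x_Q|^(-2 l), for which the operator with
  its coefficient frozen at \<open>Q\<close> becomes a Laplacian in stretched coordinates.\<close>

definition qdist :: "real \<Rightarrow> real \<times> (real ^ 'm) \<Rightarrow> real \<times> (real ^ 'm) \<Rightarrow> real" where
  "qdist \<kappa> Q X = (fst X - fst Q)\<^sup>2 + \<kappa> * (norm (snd X - snd Q))\<^sup>2"

definition qdist_grad :: "real \<Rightarrow> real \<times> (real ^ 'm) \<Rightarrow> real \<times> (real ^ 'm) \<Rightarrow> real \<times> (real ^ 'm)" where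
  "qdist_grad \<kappa> Q X = (2 * (fst X - fst Q), (2 * \<kappa>) *\<^sub>R (snd X - snd Q))"

lemma qdist_GDERIV: "GDERIV (qdist \<kappa> Q) X :> qdist_grad \<kappa> Q X"
proof -
  have "((\<lambda>X. (fst X - fst Q)\<^sup>2 + \<kappa> * ((snd X - snd Q) \<bullet> (snd X - snd Q))) has_derivative
     (\<lambda>h. h \<bullet> qdist_grad \<kappa> Q X)) (at X)"
    by (auto intro!: derivative_eq_intros ext simp: qdist_grad_def inner_prod_def inner_commute algebra_simps)
  then show ?thesis unfolding gderiv_def qdist_def power2_norm_eq_inner .
qed

lemma qdist_grad_inner_GDERIV:
  "GDERIV (\<lambda>X. qdist_grad \<kappa> Q X \<bullet> b) X :> (2 * fst b, (2 * \<kappa>) *\<^sub>R snd b)"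
proof -
  have "((\<lambda>X. 2 * (fst X - fst Q) * fst b + ((2 * \<kappa>) *\<^sub>R (snd X - snd Q)) \<bullet> snd b) has_derivative
     (\<lambda>h. h \<bullet> (2 * fst b, (2 * \<kappa>) *\<^sub>R snd b))) (at X)"
    by (auto intro!: derivative_eq_intros ext simp: inner_prod_def algebra_simps)
  then show ?thesis unfolding gderiv_def by (simp add: qdist_grad_def inner_prod_def)
qed

lemma qdist_continuous: "continuous_on UNIV (qdist \<kappa> Q)" "continuous_on UNIV (qdist_grad \<kappa> Q)"
  unfolding qdist_def qdist_grad_def by (intro continuous_intros)+

lemma qdist_one: "qdist 1 Q X = (dist X Q)\<^sup>2"
  by (simp add: qdist_def dist_prod_def dist_norm)

text \<open>The Grushin operator applied to \<open>\<Psi> \<circ> qdist \<kappa> Q\<close>.\<close>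

definition radial_L :: "real \<Rightarrow> real \<Rightarrow> real \<times> (real ^ 'm) \<Rightarrow> (real \<Rightarrow> real) \<Rightarrow> (real \<Rightarrow> real) \<Rightarrow>
    real \<times> (real ^ 'm) \<Rightarrow> real" where
  "radial_L l \<kappa> Q \<Psi>' \<Psi>'' X =
     \<Psi>'' (qdist \<kappa> Q X) * (4 * (fst X - fst Q)\<^sup>2 + 4 * \<kappa>\<^sup>2 * (\<bar>fst X\<bar> powr l)\<^sup>2 * (norm (snd X - snd Q))\<^sup>2)
     + \<Psi>' (qdist \<kappa> Q X) * (2 + 2 * \<kappa> * real CARD('m) * (\<bar>fst X\<bar> powr l)\<^sup>2)"

section \<open>Radial test functions, barriers and the spreading of positivity\<close>

context grushin_domain
begin

text \<open>Both derivatives end up on the explicit function, so the identity makes sense for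
  \<open>u\<close> with a weak gradient only. The weight |x|^(2 l) is shared out: one factor belongs
  to \<open>qgrad\<close> of the approximants, the other is the \<open>w\<close> of
  \<open>integration_by_parts_weighted\<close>.\<close>

lemma radial_test:
  fixes \<Psi> \<Psi>' \<Psi>'' :: "real \<Rightarrow> real"
  assumes \<Psi>: "\<And>t. (\<Psi> has_field_derivative \<Psi>' t) (at t)" "\<And>t. (\<Psi>' has_field_derivative \<Psi>'' t) (at t)"
      "continuous_on UNIV \<Psi>''"
    and K: "compact K" "K \<subseteq> \<Omega>" "\<forall>X. X \<notin> K \<longrightarrow> \<Psi> (qdist \<kappa> Q X) = 0"
  shows "(\<lambda>X. \<Psi> (qdist \<kappa> Q X)) \<in> C10 \<Omega>"
    and "continuous_on UNIV (radial_L l \<kappa> Q \<Psi>' \<Psi>'')"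
    and "\<And>u U. W u U \<Longrightarrow> (\<integral>X. U X \<bullet> qgrad l (\<lambda>X. \<Psi> (qdist \<kappa> Q X)) X \<partial>M) = - (\<integral>X. u X * radial_L l \<kappa> Q \<Psi>' \<Psi>'' X \<partial>M)"
proof -
  let ?V = "\<lambda>X. \<Psi> (qdist \<kappa> Q X)"
  let ?q = "qdist \<kappa> Q"
  have c\<Psi>': "continuous_on UNIV \<Psi>'" using \<Psi>(2) by (meson DERIV_isCont continuous_at_imp_continuous_on)
  have cq: "continuous_on UNIV (\<lambda>X. \<Psi>' (?q X))" "continuous_on UNIV (\<lambda>X. \<Psi>'' (?q X))"
    by (rule continuous_on_compose2[OF c\<Psi>' qdist_continuous(1)] continuous_on_compose2[OF \<Psi>(3) qdist_continuous(1)]; simp)+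
  have gV: "GDERIV ?V X :> \<Psi>' (?q X) *\<^sub>R qdist_grad \<kappa> Q X" for X
    by (intro GDERIV_DERIV_compose qdist_GDERIV \<Psi>(1))
  have cgV: "continuous_on UNIV (\<lambda>X. \<Psi>' (?q X) *\<^sub>R qdist_grad \<kappa> Q X)"
    by (intro continuous_intros cq qdist_continuous)
  note V = C10I[OF gV cgV K(1,2) K(3)[rule_format]]
  show V1: "?V \<in> C10 \<Omega>" by (rule V(1))
  have cx: "continuous_on UNIV (\<lambda>X::real \<times> (real ^ 'm). \<bar>fst X\<bar> powr l)"
    using l by (intro continuous_intros continuous_on_powr') auto
  show cL: "continuous_on UNIV (radial_L l \<kappa> Q \<Psi>' \<Psi>'')"
    unfolding radial_L_def by (intro continuous_intros cq cx)
  define H where "H b = (2 * fst b, (2 * \<kappa>) *\<^sub>R snd b)" for b :: "real \<times> (real ^ 'm)"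
  \<comment> \<open>\<open>g b\<close> is the partial derivative along \<open>b\<close> and
    \<open>D b\<close> its gradient; the weighted diagonal second derivatives add up to
    \<open>radial_L\<close>.\<close>
  define g where "g b X = \<Psi>' (?q X) * (qdist_grad \<kappa> Q X \<bullet> b)" for b X
  define D where "D b X = \<Psi>' (?q X) *\<^sub>R H b + (qdist_grad \<kappa> Q X \<bullet> b) *\<^sub>R (\<Psi>'' (?q X) *\<^sub>R qdist_grad \<kappa> Q X)" for b X
  have gD: "GDERIV (g b) X :> D b X" for b X
    unfolding g_def D_def H_def
    by (intro GDERIV_mult GDERIV_DERIV_compose qdist_GDERIV \<Psi>(2) qdist_grad_inner_GDERIV)
  have cD: "continuous_on UNIV (D b)" for b
    unfolding D_def by (intro continuous_intros cq qdist_continuous)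
  have cgb: "continuous_on UNIV (g b)" for b
    unfolding g_def by (intro continuous_intros cq qdist_continuous)
  have qV: "qgrad l ?V X \<bullet> b = wt l b X * g b X" if "b \<in> Basis" for b X
    using fun_cong[OF V(2), of X] by (simp add: qgrad_inner[OF that] g_def)
  have LV: "(\<Sum>b\<in>Basis. wt l b X * (wt l b X * (D b X \<bullet> b))) = radial_L l \<kappa> Q \<Psi>' \<Psi>'' X" for X
  proof -
    have "(\<Sum>b\<in>Basis. wt l b X * (wt l b X * (D b X \<bullet> b)))
       = \<Psi>'' (?q X) * (\<Sum>b\<in>Basis. (wt l b X * (qdist_grad \<kappa> Q X \<bullet> b)) * (wt l b X * (qdist_grad \<kappa> Q X \<bullet> b)))
        + \<Psi>' (?q X) * (\<Sum>b\<in>Basis. (wt l b X)\<^sup>2 * (H b \<bullet> b))"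
      unfolding sum_distrib_left sum.distrib[symmetric] D_def
      by (intro sum.cong refl) (simp add: inner_add_left power2_eq_square algebra_simps)
    also have "(\<Sum>b\<in>Basis. (wt l b X * (qdist_grad \<kappa> Q X \<bullet> b)) * (wt l b X * (qdist_grad \<kappa> Q X \<bullet> b)))
       = grushin_sqrtA l X (qdist_grad \<kappa> Q X) \<bullet> grushin_sqrtA l X (qdist_grad \<kappa> Q X)"
      unfolding euclidean_inner[of "grushin_sqrtA l X (qdist_grad \<kappa> Q X)" "grushin_sqrtA l X (qdist_grad \<kappa> Q X)"]
      by (intro sum.cong refl) (simp add: grushin_sqrtA_inner)
    also have "\<dots> = 4 * (fst X - fst Q)\<^sup>2 + 4 * \<kappa>\<^sup>2 * (\<bar>fst X\<bar> powr l)\<^sup>2 * (norm (snd X - snd Q))\<^sup>2"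
      unfolding power2_norm_eq_inner
      by (simp add: grushin_sqrtA_def qdist_grad_def inner_prod_def power2_eq_square algebra_simps)
    also have "(\<Sum>b\<in>Basis. (wt l b X)\<^sup>2 * (H b \<bullet> b)) = 2 + 2 * \<kappa> * real CARD('m) * (\<bar>fst X\<bar> powr l)\<^sup>2"
      unfolding sum_Basis_prod_real by (simp add: H_def wt_def inner_prod_def algebra_simps)
    finally show ?thesis unfolding radial_L_def .
  qed
  fix u U assume W: "W u U"
  have C10: "(\<integral>X. qgrad l \<phi> X \<bullet> qgrad l ?V X \<partial>M) = - (\<integral>X. \<phi> X * radial_L l \<kappa> Q \<Psi>' \<Psi>'' X \<partial>M)"
    if phi: "\<phi> \<in> C10 \<Omega>" for \<phi>
  proof -
    have "(\<integral>X. qgrad l \<phi> X \<bullet> qgrad l ?V X \<partial>M) = (\<integral>X. (\<Sum>b\<in>Basis. (qgrad l \<phi> X \<bullet> b) * (wt l b X * g b X)) \<partial>M)"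
    proof (rule Bochner_Integration.integral_cong[OF refl])
      fix X
      show "qgrad l \<phi> X \<bullet> qgrad l ?V X = (\<Sum>b\<in>Basis. (qgrad l \<phi> X \<bullet> b) * (wt l b X * g b X))"
        unfolding euclidean_inner[of "qgrad l \<phi> X" "qgrad l ?V X"] by (intro sum.cong refl) (simp add: qV)
    qed
    also have "\<dots> = (\<Sum>b\<in>Basis. \<integral>X. (qgrad l \<phi> X \<bullet> b) * (wt l b X * g b X) \<partial>M)"
      by (intro Bochner_Integration.integral_sum integrable_continuous continuous_intros
          qgrad_continuous phi continuous_on_wt[OF l] cgb)
    also have "\<dots> = (\<Sum>b\<in>Basis. - (\<integral>X. \<phi> X * (wt l b X * (wt l b X * (D b X \<bullet> b))) \<partial>M))"
      by (intro sum.cong refl integration_by_parts_weighted[OF phi gD cD _ continuous_on_wt[OF l]] wt_shift)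
    also have "\<dots> = - (\<Sum>b\<in>Basis. \<integral>X. \<phi> X * (wt l b X * (wt l b X * (D b X \<bullet> b))) \<partial>M)"
      by (rule sum_negf)
    also have "(\<Sum>b\<in>Basis. \<integral>X. \<phi> X * (wt l b X * (wt l b X * (D b X \<bullet> b))) \<partial>M)
       = (\<integral>X. (\<Sum>b\<in>Basis. \<phi> X * (wt l b X * (wt l b X * (D b X \<bullet> b)))) \<partial>M)"
      by (intro Bochner_Integration.integral_sum[symmetric] integrable_continuous continuous_intros
          C10_continuous[OF phi] continuous_on_wt[OF l] cD)
    also have "\<dots> = (\<integral>X. \<phi> X * radial_L l \<kappa> Q \<Psi>' \<Psi>'' X \<partial>M)"
      unfolding sum_distrib_left[symmetric] LV ..
    finally show ?thesis .
  qed
  obtain \<phi> where p: "\<And>n. \<phi> n \<in> C10 \<Omega>" "L2_tendsto M \<phi> u" "L2_tendsto M (\<lambda>n. qgrad l (\<phi> n)) U"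
    using W unfolding W_def by blast
  have "(\<lambda>n. \<integral>X. qgrad l (\<phi> n) X \<bullet> qgrad l ?V X \<partial>M) \<longlonglongrightarrow> (\<integral>X. U X \<bullet> qgrad l ?V X \<partial>M)"
    by (intro L2_tendsto_inner p L2_tendsto_const C10_square_integrable V1)
  then have "(\<lambda>n. - (\<integral>X. \<phi> n X \<bullet> radial_L l \<kappa> Q \<Psi>' \<Psi>'' X \<partial>M)) \<longlonglongrightarrow> (\<integral>X. U X \<bullet> qgrad l ?V X \<partial>M)"
    unfolding C10[OF p(1)] by simp
  moreover have "(\<lambda>n. - (\<integral>X. \<phi> n X \<bullet> radial_L l \<kappa> Q \<Psi>' \<Psi>'' X \<partial>M)) \<longlonglongrightarrow> - (\<integral>X. u X \<bullet> radial_L l \<kappa> Q \<Psi>' \<Psi>'' X \<partial>M)"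
    by (intro tendsto_minus L2_tendsto_inner p L2_tendsto_const square_integrable_continuous cL)
  ultimately have "(\<integral>X. U X \<bullet> qgrad l ?V X \<partial>M) = - (\<integral>X. u X \<bullet> radial_L l \<kappa> Q \<Psi>' \<Psi>'' X \<partial>M)"
    by (rule LIMSEQ_unique)
  then show "(\<integral>X. U X \<bullet> qgrad l ?V X \<partial>M) = - (\<integral>X. u X * radial_L l \<kappa> Q \<Psi>' \<Psi>'' X \<partial>M)"
    unfolding inner_real_def .
qed

text \<open>Tests range over the whole energy space and not just over \<open>C10\<close>, so that
  \<open>gam\<close> of a difference is admissible. Nonnegativity allows pointwise inequalities to
  be integrated against \<open>u\<close> in the average estimate.\<close>

definition superharmonic where
  "superharmonic u U \<longleftrightarrow> W u U \<and> (AE X in M. 0 \<le> u X) \<and>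
     (\<forall>v V. W v V \<longrightarrow> (AE X in M. 0 \<le> v X) \<longrightarrow> 0 \<le> (\<integral>X. U X \<bullet> V X \<partial>M))"

text \<open>The barrier \<open>(R\<^sup>2 - dist\<^sup>2)\<^sup>k\<close> is a subsolution off a small ball around its centre as soon as
  the centre does not lie on the degeneracy set \<open>x = 0\<close>, even if the barrier crosses this set.\<close>

lemma hopf_barrier:
  assumes u: "superharmonic u U" and Q: "fst Q \<noteq> 0" and rR: "0 < r" "r < R" "cball Q R \<subseteq> \<Omega>"
    and c: "c > 0" "AE X in M. X \<in> ball Q r \<longrightarrow> c \<le> u X" and R': "0 < R'" "R' < R"
  shows "\<exists>c'>0. AE X in M. X \<in> ball Q R' \<longrightarrow> c' \<le> u X"
proof -
  have Wu: "W u U" and u0: "AE X in M. 0 \<le> u X"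
    and sup: "\<And>v V. W v V \<Longrightarrow> AE X in M. 0 \<le> v X \<Longrightarrow> 0 \<le> (\<integral>X. U X \<bullet> V X \<partial>M)"
    using u by (auto simp: superharmonic_def)
  \<comment> \<open>Up to the factor 4 this is the coefficient of \<open>\<Psi>''\<close>, the
    squared length of sqrt A applied to the gradient of \<open>qdist 1 Q\<close>.\<close>
  define a where "a X = (fst X - fst Q)\<^sup>2 + (\<bar>fst X\<bar> powr l)\<^sup>2 * (norm (snd X - snd Q))\<^sup>2" for X
  have cx: "continuous_on UNIV (\<lambda>X::real \<times> (real ^ 'm). \<bar>fst X\<bar> powr l)"
    using l by (intro continuous_intros continuous_on_powr') auto
  have ca: "continuous_on UNIV a" unfolding a_def by (intro continuous_intros cx)
  \<comment> \<open>Where the weight vanishes, x = 0 differs from \<open>fst Q\<close> and the x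
    part is positive: this is how the barrier crosses the degeneracy.\<close>
  have apos: "a X > 0" if "X \<noteq> Q" for X
  proof (cases "fst X = fst Q")
    case True
    then have "snd X \<noteq> snd Q" using that by (metis prod.expand)
    then show ?thesis using Q True by (simp add: a_def)
  next
    case False
    then have "(fst X - fst Q)\<^sup>2 > 0" by simp
    moreover have "0 \<le> (\<bar>fst X\<bar> powr l)\<^sup>2 * (norm (snd X - snd Q))\<^sup>2" by simp
    ultimately show ?thesis unfolding a_def by linarith
  qed
  have "\<exists>\<delta>>0. \<forall>X. r \<le> dist X Q \<and> dist X Q \<le> R \<longrightarrow> \<delta> \<le> a X"
  proof -
    let ?A = "cball Q R - ball Q r"
    have cpt: "compact ?A" by (intro compact_diff) auto
    show ?thesis
    proof (cases "?A = {}")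
      case True
      then show ?thesis by (intro exI[of _ 1]) (auto simp: dist_commute)
    next
      case False
      obtain Y where Y: "Y \<in> ?A" "\<And>X. X \<in> ?A \<Longrightarrow> a Y \<le> a X"
        using continuous_attains_inf[OF cpt False continuous_on_subset[OF ca]] by auto
      have "a Y > 0" using Y(1) rR by (intro apos) auto
      then show ?thesis using Y(2) by (intro exI[of _ "a Y"]) (auto simp: dist_commute)
    qed
  qed
  then obtain \<delta> where \<delta>: "\<delta> > 0" "\<And>X. r \<le> dist X Q \<Longrightarrow> dist X Q \<le> R \<Longrightarrow> \<delta> \<le> a X" by blast
  have cC: "continuous_on UNIV (\<lambda>X::real \<times> (real ^ 'm). 2 + 2 * real CARD('m) * (\<bar>fst X\<bar> powr l)\<^sup>2)"
    by (intro continuous_intros cx)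
  have "compact ((\<lambda>X. 2 + 2 * real CARD('m) * (\<bar>fst X\<bar> powr l)\<^sup>2) ` cball Q R)"
    by (rule compact_continuous_image[OF continuous_on_subset[OF cC subset_UNIV] compact_cball])
  from compact_imp_bounded[OF this] obtain C where
    "\<forall>y\<in>(\<lambda>X. 2 + 2 * real CARD('m) * (\<bar>fst X\<bar> powr l)\<^sup>2) ` cball Q R. norm y \<le> C"
    unfolding bounded_iff by blast
  then have C: "2 + 2 * real CARD('m) * (\<bar>fst X\<bar> powr l)\<^sup>2 \<le> C" if "X \<in> cball Q R" for X
    using that by force
  \<comment> \<open>A large exponent: on the annulus the second-order contribution, at least
    \<open>4 * \<delta> * n\<close>, beats the first-order one, at most
    \<open>R\<^sup>2 * C\<close>.\<close>
  obtain n :: nat where n: "R\<^sup>2 * C / (4 * \<delta>) \<le> real n" using real_arch_simple by blast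
  define P where "P t = max 0 (R\<^sup>2 - t)" for t :: real
  \<comment> \<open>Normalises the barrier to stay below \<open>c\<close>, hence below
    \<open>u\<close> on the inner ball.\<close>
  define s where "s = c / (R\<^sup>2) ^ (n + 3)"
  have s: "s > 0" using c rR by (simp add: s_def)
  \<comment> \<open>The offset 3 leaves a positive power of \<open>P\<close> in
    \<open>\<Psi>''\<close>, which is therefore continuous.\<close>
  define \<Psi> where "\<Psi> t = s * P t ^ (n + 3)" for t
  define \<Psi>' where "\<Psi>' t = - (s * (real n + 3)) * P t ^ (n + 2)" for t
  define \<Psi>'' where "\<Psi>'' t = s * (real n + 3) * (real n + 2) * P t ^ (n + 1)" for t
  have dm: "((\<lambda>t. P t ^ (k + 2)) has_field_derivative (- (real k + 2) * P t ^ (k + 1))) (at t)" for k t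
  proof -
    have "((\<lambda>t. R\<^sup>2 - t) has_field_derivative -1) (at t)"
      by (auto intro!: derivative_eq_intros)
    from DERIV_chain2[where f="\<lambda>t. max 0 t ^ (k + 2)" and g="\<lambda>t. R\<^sup>2 - t", OF max_power_has_derivative this]
    show ?thesis by (simp add: P_def algebra_simps)
  qed
  have d1: "(\<Psi> has_field_derivative \<Psi>' t) (at t)" for t
    using DERIV_cmult[OF dm[of "n + 1" t], of s] unfolding \<Psi>_def[abs_def] \<Psi>'_def
    by (simp add: algebra_simps numeral_3_eq_3)
  have d2: "(\<Psi>' has_field_derivative \<Psi>'' t) (at t)" for t
    using DERIV_cmult[OF dm[of n t], of "- (s * (real n + 3))"] unfolding \<Psi>''_def \<Psi>'_def[abs_def]
    by (simp add: algebra_simps)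
  have c2: "continuous_on UNIV \<Psi>''" unfolding \<Psi>''_def P_def by (intro continuous_intros)
  have z: "\<forall>X. X \<notin> cball Q R \<longrightarrow> \<Psi> (qdist 1 Q X) = 0"
  proof (intro allI impI)
    fix X assume "X \<notin> cball Q R"
    then have "R\<^sup>2 \<le> (dist X Q)\<^sup>2" using rR by (intro power_mono) (auto simp: dist_commute)
    then show "\<Psi> (qdist 1 Q X) = 0" by (simp add: \<Psi>_def P_def qdist_one)
  qed
  note RT = radial_test[OF d1 d2 c2 compact_cball rR(3) z]
  define V where "V X = \<Psi> (qdist 1 Q X)" for X
  define LV where "LV = radial_L l 1 Q \<Psi>' \<Psi>''"
  have V: "V \<in> C10 \<Omega>" unfolding V_def using RT(1) .
  have LVeq: "LV X = s * (real n + 3) * P (qdist 1 Q X) ^ (n + 1) *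
      (4 * (real n + 2) * a X - P (qdist 1 Q X) * (2 + 2 * real CARD('m) * (\<bar>fst X\<bar> powr l)\<^sup>2))" for X
    unfolding LV_def radial_L_def \<Psi>'_def \<Psi>''_def a_def by (simp add: algebra_simps)
  have P: "0 \<le> P t" "t \<ge> 0 \<Longrightarrow> P t \<le> R\<^sup>2" for t by (auto simp: P_def)
  have Vc: "V X \<le> c" for X
  proof -
    have "P (qdist 1 Q X) ^ (n + 3) \<le> (R\<^sup>2) ^ (n + 3)" by (intro power_mono P) (simp add: qdist_one)
    then have "V X \<le> s * (R\<^sup>2) ^ (n + 3)" unfolding V_def \<Psi>_def using s by (intro mult_left_mono) auto
    also have "\<dots> = c" using rR by (simp add: s_def)
    finally show ?thesis .
  qed
  have LV0: "LV X \<ge> 0" if "X \<notin> ball Q r" for X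
  proof (cases "X \<in> cball Q R")
    case False
    have "R\<^sup>2 \<le> (dist X Q)\<^sup>2" using False rR by (intro power_mono) (auto simp: dist_commute)
    then show ?thesis unfolding LVeq by (simp add: P_def qdist_one)
  next
    case True
    have "P (qdist 1 Q X) * (2 + 2 * real CARD('m) * (\<bar>fst X\<bar> powr l)\<^sup>2) \<le> R\<^sup>2 * C"
      using C[OF True] P by (intro mult_mono) (auto simp: qdist_one)
    also have "\<dots> \<le> 4 * \<delta> * real n" using n \<delta>(1) by (simp add: field_simps)
    also have "\<dots> \<le> 4 * (real n + 2) * \<delta>" using \<delta>(1) by (simp add: algebra_simps)
    also have "\<dots> \<le> 4 * (real n + 2) * a X"
      using \<delta>(2)[of X] that True by (intro mult_left_mono) (auto simp: dist_commute)
    finally show ?thesis unfolding LVeq using s P(1) by (intro mult_nonneg_nonneg) auto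
  qed
  define z where "z X = V X - u X" for X
  define Z where "Z X = qgrad l V X - U X" for X
  have Wz: "W z Z" unfolding z_def Z_def by (intro W_diff W_C10 V Wu)
  define G where "G X = gam' (z X) *\<^sub>R Z X" for X
  have WG: "W (\<lambda>X. gam (z X)) G" unfolding G_def by (rule W_gam[OF Wz])
  have "0 \<le> (\<integral>X. U X \<bullet> G X \<partial>M)" by (rule sup[OF WG]) (simp add: gam_bounds)
  moreover have "(\<integral>X. qgrad l V X \<bullet> G X \<partial>M) \<le> 0"
  proof -
    \<comment> \<open>\<open>gam z\<close> vanishes on the inner ball, where
      \<open>V \<le> c \<le> u\<close>, and \<open>LV \<ge> 0\<close> outside it; the region around
      the centre, where the sign of \<open>LV\<close> is not controlled, never contributes.\<close>
    have "0 \<le> (\<integral>X. gam (z X) * LV X \<partial>M)"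
    proof (rule integral_nonneg_AE)
      show "AE X in M. 0 \<le> gam (z X) * LV X"
        using c(2)
      proof eventually_elim
        case (elim X)
        show ?case
        proof (cases "X \<in> ball Q r")
          case True
          then have "z X \<le> 0" using elim Vc[of X] by (simp add: z_def)
          then show ?thesis by (simp add: gam_nonpos)
        next
          case False
          then show ?thesis using LV0 gam_bounds(1) by simp
        qed
      qed
    qed
    then show ?thesis using RT(3)[OF WG] by (simp add: V_def[abs_def] LV_def inner_commute)
  qed
  moreover have "(\<integral>X. Z X \<bullet> G X \<partial>M) = (\<integral>X. qgrad l V X \<bullet> G X \<partial>M) - (\<integral>X. U X \<bullet> G X \<partial>M)"
    unfolding Z_def inner_diff_left
    by (intro Bochner_Integration.integral_diff square_integrable_inner C10_square_integrable V
        W_square_integrable(2)[OF WG] W_square_integrable(2)[OF Wu])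
  ultimately have "(\<integral>X. Z X \<bullet> (gam' (z X) *\<^sub>R Z X) \<partial>M) \<le> 0" by (simp add: G_def)
  from W_nonpos_energy[OF Wz this] have Vu: "AE X in M. V X \<le> u X" by (simp add: z_def)
  define c' where "c' = s * (R\<^sup>2 - R'\<^sup>2) ^ (n + 3)"
  have RR: "R'\<^sup>2 < R\<^sup>2" using R' by (intro power_strict_mono) auto
  then have "c' > 0" using s by (simp add: c'_def)
  moreover have "AE X in M. X \<in> ball Q R' \<longrightarrow> c' \<le> u X"
    using Vu
  proof eventually_elim
    case (elim X)
    show ?case
    proof
      assume "X \<in> ball Q R'"
      then have "(dist X Q)\<^sup>2 \<le> R'\<^sup>2" by (intro power_mono) (auto simp: dist_commute)
      then have "R\<^sup>2 - R'\<^sup>2 \<le> P (qdist 1 Q X)" by (simp add: P_def qdist_one)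
      then have "(R\<^sup>2 - R'\<^sup>2) ^ (n + 3) \<le> P (qdist 1 Q X) ^ (n + 3)" using RR by (intro power_mono) auto
      then have "c' \<le> V X" unfolding c'_def V_def \<Psi>_def using s by (intro mult_left_mono) auto
      then show "c' \<le> u X" using elim by simp
    qed
  qed
  ultimately show ?thesis by blast
qed

text \<open>Positivity at a point for a class modulo null sets: an essential lower bound on a
  neighbourhood.\<close>

definition pos_at :: "(real \<times> (real ^ 'm) \<Rightarrow> real) \<Rightarrow> real \<times> (real ^ 'm) \<Rightarrow> bool" where
  "pos_at u P \<longleftrightarrow> (\<exists>r>0. ball P r \<subseteq> \<Omega> \<and> (\<exists>c>0. AE X in M. X \<in> ball P r \<longrightarrow> c \<le> u X))"

text \<open>The reach \<open>\<rho>\<close> is governed by the room around \<open>P\<close> and not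
  by the ball of positivity at \<open>P'\<close>; this uniformity makes the positivity set
  relatively closed.\<close>

lemma pos_at_nearby:
  assumes u: "superharmonic u U" and P: "ball P (4 * \<rho>) \<subseteq> \<Omega>" and P': "pos_at u P'" "dist P P' < \<rho>"
  shows "pos_at u P"
proof -
  have \<rho>: "\<rho> > 0" using P'(2) zero_le_dist[of P P'] by linarith
  obtain r c where r: "r > 0" "ball P' r \<subseteq> \<Omega>" and c: "c > 0" "AE X in M. X \<in> ball P' r \<longrightarrow> c \<le> u X"
    using P'(1) unfolding pos_at_def by blast
  define \<eta> where "\<eta> = min (r / 2) ((\<rho> - dist P P') / 2)"
  have \<eta>: "\<eta> > 0" "\<eta> \<le> r / 2" "\<eta> < \<rho> - dist P P'" using r P'(2) by (auto simp: \<eta>_def min_def field_simps)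
  \<comment> \<open>\<open>P'\<close> may lie on x = 0, so the barrier is centred at a nearby point
    off it, still well inside the ball of positivity.\<close>
  define Q where "Q = (if fst P' \<noteq> 0 then P' else P' + (\<eta>, 0))"
  have Q: "fst Q \<noteq> 0" using \<eta> by (auto simp: Q_def)
  have dQ: "dist P' Q \<le> \<eta>" using \<eta> by (auto simp: Q_def dist_norm norm_Pair)
  then have dPQ: "dist P Q < \<rho>" using dist_triangle[of P Q P'] \<eta>(3) by linarith
  define r' where "r' = min (r / 2) \<rho>"
  have r': "r' > 0" "r' \<le> r / 2" "r' < 2 * \<rho>" using r \<rho> by (auto simp: r'_def)
  have sub: "ball Q r' \<subseteq> ball P' r"
  proof
    fix X assume "X \<in> ball Q r'"
    then show "X \<in> ball P' r" using dist_triangle[of P' X Q] dQ \<eta>(2) r'(2) by auto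
  qed
  have cb: "cball Q (2 * \<rho>) \<subseteq> \<Omega>"
  proof
    fix X assume "X \<in> cball Q (2 * \<rho>)"
    then have "X \<in> ball P (4 * \<rho>)" using dist_triangle[of P X Q] dPQ \<rho> by auto
    then show "X \<in> \<Omega>" using P by blast
  qed
  have "AE X in M. X \<in> ball Q r' \<longrightarrow> c \<le> u X" using c(2) by eventually_elim (use sub in blast)
  \<comment> \<open>\<open>3 / 2 * \<rho>\<close> is below the barrier radius
    \<open>2 * \<rho>\<close> and still reaches past \<open>P\<close>, as
    \<open>dist P Q < \<rho>\<close>.\<close>
  from hopf_barrier[OF u Q r'(1,3) cb c(1) this, of "3 / 2 * \<rho>"] \<rho>
  obtain c' where c': "c' > 0" "AE X in M. X \<in> ball Q (3 / 2 * \<rho>) \<longrightarrow> c' \<le> u X" by auto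
  have "ball P (\<rho> / 2) \<subseteq> ball Q (3 / 2 * \<rho>)"
  proof
    fix X assume "X \<in> ball P (\<rho> / 2)"
    then show "X \<in> ball Q (3 / 2 * \<rho>)" using dist_triangle[of Q X P] dPQ by (auto simp: dist_commute)
  qed
  note sub' = this
  have "AE X in M. X \<in> ball P (\<rho> / 2) \<longrightarrow> c' \<le> u X"
    using c'(2) by eventually_elim (use sub' in blast)
  moreover have "ball P (\<rho> / 2) \<subseteq> \<Omega>" using P \<rho> by (auto simp: subset_iff)
  ultimately show ?thesis unfolding pos_at_def using \<rho> c'(1) by (intro exI[of _ "\<rho> / 2"]) auto
qed

lemma pos_at_everywhere:
  assumes u: "superharmonic u U" and conn: "connected \<Omega>" and P0: "P0 \<in> \<Omega>" "pos_at u P0" and P: "P \<in> \<Omega>"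
  shows "pos_at u P"
proof -
  define S where "S = {P\<in>\<Omega>. pos_at u P}"
  have "open S"
    unfolding open_contains_ball
  proof
    fix A assume "A \<in> S"
    then obtain r c where r: "r > 0" "ball A r \<subseteq> \<Omega>" and c: "c > 0" "AE X in M. X \<in> ball A r \<longrightarrow> c \<le> u X"
      unfolding S_def pos_at_def by blast
    have "ball A r \<subseteq> S"
    proof
      fix B assume B: "B \<in> ball A r"
      have sub: "ball B (r - dist A B) \<subseteq> ball A r"
      proof
        fix X assume "X \<in> ball B (r - dist A B)"
        then show "X \<in> ball A r" using dist_triangle[of A X B] by auto
      qed
      have "AE X in M. X \<in> ball B (r - dist A B) \<longrightarrow> c \<le> u X"
        using c(2) by eventually_elim (use sub in blast)
      then have "pos_at u B" unfolding pos_at_def using B sub r c(1)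
        by (intro exI[of _ "r - dist A B"]) auto
      then show "B \<in> S" using B r by (auto simp: S_def)
    qed
    then show "\<exists>e>0. ball A e \<subseteq> S" using r by blast
  qed
  moreover have "open (\<Omega> - S)"
    unfolding open_contains_ball
  proof
    fix A assume A: "A \<in> \<Omega> - S"
    obtain r where r: "r > 0" "ball A r \<subseteq> \<Omega>" using A op by (auto simp: open_contains_ball)
    have "B \<notin> S" if "B \<in> ball A (r / 4)" for B
      using pos_at_nearby[OF u, of A "r / 4" B] r A that by (auto simp: S_def)
    then have "ball A (r / 4) \<subseteq> \<Omega> - S" using r by (auto simp: subset_iff)
    then show "\<exists>e>0. ball A e \<subseteq> \<Omega> - S" using r by (intro exI[of _ "r / 4"]) auto
  qed
  moreover have "S \<subseteq> \<Omega>" by (auto simp: S_def)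
  ultimately have "S \<inter> \<Omega> = {} \<or> (\<Omega> - S) \<inter> \<Omega> = {}"
    using connectedD[OF conn, of S "\<Omega> - S"] by auto
  then show ?thesis using P0 P by (auto simp: S_def)
qed

lemma pos_on_compact:
  assumes pos: "\<And>P. P \<in> \<Omega> \<Longrightarrow> pos_at u P" and K: "compact K" "K \<subseteq> \<Omega>"
  shows "\<exists>c>0. AE X in M. X \<in> K \<longrightarrow> c \<le> u X"
proof -
  have "\<exists>q. \<forall>P\<in>K. fst (q P) > 0 \<and> snd (q P) > 0 \<and> (AE X in M. X \<in> ball P (fst (q P)) \<longrightarrow> snd (q P) \<le> u X)"
  proof (intro bchoice ballI)
    fix P assume "P \<in> K"
    then have "pos_at u P" using pos K(2) by blast
    then obtain r c where "r > 0" "c > 0" "AE X in M. X \<in> ball P r \<longrightarrow> c \<le> u X"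
      unfolding pos_at_def by blast
    then show "\<exists>q. fst q > 0 \<and> snd q > 0 \<and> (AE X in M. X \<in> ball P (fst q) \<longrightarrow> snd q \<le> u X)"
      by (intro exI[of _ "(r, c)"]) simp
  qed
  then obtain q where q: "\<forall>P\<in>K. fst (q P) > 0 \<and> snd (q P) > 0 \<and> (AE X in M. X \<in> ball P (fst (q P)) \<longrightarrow> snd (q P) \<le> u X)" ..
  define r c where "r P = fst (q P)" and "c P = snd (q P)" for P
  have rc: "r P > 0" "c P > 0" "AE X in M. X \<in> ball P (r P) \<longrightarrow> c P \<le> u X" if "P \<in> K" for P
    using q that by (auto simp: r_def c_def)
  have cov: "K \<subseteq> (\<Union>P\<in>K. ball P (r P))" using rc(1) by force
  obtain D where D: "D \<subseteq> K" "finite D" "K \<subseteq> (\<Union>P\<in>D. ball P (r P))"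
    by (rule compactE_image[OF K(1) _ cov]) auto
  \<comment> \<open>Inserting 1 keeps the minimum meaningful when the finite cover is empty.\<close>
  define c0 where "c0 = Min (insert 1 (c ` D))"
  have c0: "c0 > 0" unfolding c0_def using D rc(2) by (subst Min_gr_iff) auto
  have c0le: "c0 \<le> c P" if "P \<in> D" for P unfolding c0_def using D that by (intro Min_le) auto
  have "AE X in M. \<forall>P\<in>D. X \<in> ball P (r P) \<longrightarrow> c P \<le> u X"
    using D rc(3) by (intro AE_finite_allI) auto
  then have "AE X in M. X \<in> K \<longrightarrow> c0 \<le> u X"
  proof eventually_elim
    case (elim X)
    show ?case
    proof
      assume "X \<in> K"
      then obtain P where "P \<in> D" "X \<in> ball P (r P)" using D(3) by blast
      then show "c0 \<le> u X" using elim c0le[of P] by force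
    qed
  qed
  then show ?thesis using c0 by blast
qed

end

section \<open>Interior positivity\<close>

text \<open>\<open>t \<mapsto> -\<Psi>' t\<close> is \<open>s\<^sup>-\<^sup>N (1 - s / R)\<^sup>2\<close> with \<open>s = sqrt t\<close> and \<open>N = k + 1\<close>, continued below
  \<open>t = \<epsilon>\<^sup>2\<close> by its tangent line.  Without the factor \<open>(1 - s / R)\<^sup>2\<close> it would be the profile of the
  fundamental solution of the Laplacian in dimension \<open>N\<close>; this factor makes it a strict
  subsolution which tolerates Lipschitz coefficients, and cuts it off.\<close>

lemma singular_profile:
  fixes k :: nat and \<epsilon> R :: real
  assumes \<epsilon>: "0 < \<epsilon>" "\<epsilon> < R"
  shows "\<exists>\<Psi> \<Psi>' \<Psi>''. (\<forall>t. (\<Psi> has_field_derivative \<Psi>' t) (at t)) \<and> (\<forall>t. (\<Psi>' has_field_derivative \<Psi>'' t) (at t)) \<and>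
     continuous_on UNIV \<Psi>'' \<and> (\<forall>t. 0 \<le> \<Psi> t) \<and>
     (\<forall>t. R\<^sup>2 \<le> t \<longrightarrow> \<Psi> t = 0 \<and> \<Psi>' t = 0 \<and> \<Psi>'' t = 0) \<and>
     (\<forall>s. \<epsilon> \<le> s \<and> s \<le> R \<longrightarrow> \<Psi>' (s\<^sup>2) = - ((1 - s / R)\<^sup>2 / s ^ (k + 1)) \<and>
        \<Psi>'' (s\<^sup>2) = (real k + 1) / 2 * (1 - s / R)\<^sup>2 / s ^ (k + 3) + (1 - s / R) / (R * s ^ (k + 2))) \<and>
     (\<forall>t. 0 \<le> t \<and> t \<le> \<epsilon>\<^sup>2 \<longrightarrow> 0 \<le> \<Psi>'' t \<and> - \<Psi>' t \<le> (2 + (real k + 1) / 2) / \<epsilon> ^ (k + 1))"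
proof -
  have R: "R > 0" using \<epsilon> by linarith
  \<comment> \<open>The positive part makes the square of the cut-off factor continuously
    differentiable at \<open>s = R\<close>.\<close>
  define mm where "mm s = max 0 (1 - s / R)" for s
  define F where "F t = (mm (sqrt t))\<^sup>2 * inverse (sqrt t) ^ (k + 1)" for t
  define F' where "F' t = - ((real k + 1) / 2 * (mm (sqrt t))\<^sup>2 * inverse (sqrt t) ^ (k + 3)
     + mm (sqrt t) / R * inverse (sqrt t) ^ (k + 2))" for t
  have dmm: "((\<lambda>s. (mm s)\<^sup>2) has_field_derivative 2 * mm s * (- 1 / R)) (at s)" for s
  proof -
    have "((\<lambda>s. 1 - s / R) has_field_derivative - 1 / R) (at s)"
      using R by (auto intro!: derivative_eq_intros)
    from DERIV_chain2[where f="\<lambda>t. (max 0 t) ^ (0 + 2)" and g="\<lambda>s. 1 - s / R", OF max_power_has_derivative this]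
    show ?thesis by (simp add: mm_def power2_eq_square)
  qed
  have dF: "(F has_field_derivative F' t) (at t)" if t: "t > 0" for t
  proof -
    define s where "s = sqrt t"
    have s: "s > 0" using t by (simp add: s_def)
    have "((\<lambda>s. inverse s ^ (k + 1)) has_field_derivative (real k + 1) * (inverse s ^ k * (- (inverse s)\<^sup>2))) (at s)"
      using DERIV_power[OF DERIV_inverse[of s UNIV], of "k + 1"] s
      by (simp add: power2_eq_square algebra_simps)
    from DERIV_mult[OF dmm this]
    have "((\<lambda>s. (mm s)\<^sup>2 * inverse s ^ (k + 1)) has_field_derivative
      2 * mm s * (- 1 / R) * inverse s ^ (k + 1) + (real k + 1) * (inverse s ^ k * (- (inverse s)\<^sup>2)) * (mm s)\<^sup>2) (at s)" .
    from DERIV_chain2[OF this[unfolded s_def] DERIV_real_sqrt[OF t]]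
    have "(F has_field_derivative (2 * mm s * (- 1 / R) * inverse s ^ (k + 1) +
         (real k + 1) * (inverse s ^ k * (- (inverse s)\<^sup>2)) * (mm s)\<^sup>2) * (inverse s / 2)) (at t)"
      unfolding F_def[abs_def] s_def .
    moreover have "(2 * mm s * (- 1 / R) * inverse s ^ (k + 1) +
         (real k + 1) * (inverse s ^ k * (- (inverse s)\<^sup>2)) * (mm s)\<^sup>2) * (inverse s / 2) = F' t"
      unfolding F'_def s_def[symmetric]
      by (simp add: power_add power2_eq_square power3_eq_cube algebra_simps)
    ultimately show ?thesis by simp
  qed
  have mm: "mm s \<ge> 0" for s by (simp add: mm_def)
  have mm1: "mm s \<le> 1" if "s \<ge> 0" for s using that R by (simp add: mm_def)
  have Fnn: "F t \<ge> 0" if "t \<ge> 0" for t unfolding F_def using that by (intro mult_nonneg_nonneg) auto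
  have F'np: "F' t \<le> 0" if "t \<ge> 0" for t
    unfolding F'_def neg_le_0_iff_le
    by (intro add_nonneg_nonneg mult_nonneg_nonneg divide_nonneg_nonneg mm zero_le_power)
      (use that R in auto)
  \<comment> \<open>The second derivative: \<open>- F'\<close> down to \<epsilon>^2 and constant
    below, which amounts to the tangent-line continuation of \<open>\<Psi>'\<close>.\<close>
  define g where "g t = - F' (max (\<epsilon>\<^sup>2) t)" for t
  have mpos: "max (\<epsilon>\<^sup>2) t > 0" for t using \<epsilon> by (simp add: less_max_iff_disj)
  have gnn: "g t \<ge> 0" for t using F'np[of "max (\<epsilon>\<^sup>2) t"] mpos[of t] by (simp add: g_def)
  have cg: "continuous_on UNIV g"
    unfolding g_def F'_def mm_def
    by (intro continuous_intros) (use mpos R in \<open>auto simp: less_le\<close>)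
  obtain H where H: "\<And>t. (H has_field_derivative g t) (at t)" using continuous_antiderivative[OF cg] by blast
  \<comment> \<open>The constant of integration makes \<open>\<Psi>'\<close> agree with
    \<open>- F\<close> at \<epsilon>^2, and hence beyond it.\<close>
  define \<Psi>' where "\<Psi>' t = H t - H (\<epsilon>\<^sup>2) - F (\<epsilon>\<^sup>2)" for t
  have d2: "(\<Psi>' has_field_derivative g t) (at t)" for t
    unfolding \<Psi>'_def using DERIV_diff[OF DERIV_diff[OF H DERIV_const] DERIV_const] by simp
  then have "continuous_on UNIV \<Psi>'" by (meson DERIV_isCont continuous_at_imp_continuous_on)
  then obtain P where P: "\<And>t. (P has_field_derivative \<Psi>' t) (at t)" using continuous_antiderivative by blast
  define \<Psi> where "\<Psi> t = P t - P (R\<^sup>2)" for t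
  have d1: "(\<Psi> has_field_derivative \<Psi>' t) (at t)" for t
    unfolding \<Psi>_def using DERIV_diff[OF P DERIV_const] by simp
  have e0: "\<epsilon>\<^sup>2 > 0" using \<epsilon> by simp
  have eR: "\<epsilon>\<^sup>2 < R\<^sup>2" using \<epsilon> by (intro power_strict_mono) auto
  have \<Psi>'F: "\<Psi>' t = - F t" if t: "\<epsilon>\<^sup>2 \<le> t" for t
  proof (cases "t = \<epsilon>\<^sup>2")
    case True
    then show ?thesis by (simp add: \<Psi>'_def)
  next
    case False
    have d: "((\<lambda>t. \<Psi>' t + F t) has_field_derivative 0) (at z)" if "\<epsilon>\<^sup>2 \<le> z" for z
      using DERIV_add[OF d2[of z] dF[of z]] that e0 by (simp add: g_def)
    have "\<Psi>' t + F t = \<Psi>' (\<epsilon>\<^sup>2) + F (\<epsilon>\<^sup>2)"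
    proof (rule DERIV_isconst_end[where f="\<lambda>t. \<Psi>' t + F t"])
      show "\<epsilon>\<^sup>2 < t" using False t by simp
      show "continuous_on {\<epsilon>\<^sup>2..t} (\<lambda>t. \<Psi>' t + F t)"
        using d by (meson DERIV_isCont atLeastAtMost_iff continuous_at_imp_continuous_on)
    qed (use d in auto)
    then show ?thesis by (simp add: \<Psi>'_def)
  qed
  have mono: "\<Psi>' s \<le> \<Psi>' t" if "s \<le> t" for s t
    by (rule DERIV_nonneg_imp_nondecreasing[OF that]) (use d2 gnn in blast)
  have \<Psi>'np: "\<Psi>' t \<le> 0" for t
  proof (cases "\<epsilon>\<^sup>2 \<le> t")
    case True
    then have "t \<ge> 0" using e0 by linarith
    then show ?thesis using \<Psi>'F[OF True] Fnn by simp
  next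
    case False
    then have "\<Psi>' t \<le> \<Psi>' (\<epsilon>\<^sup>2)" by (intro mono) simp
    then show ?thesis using \<Psi>'F[of "\<epsilon>\<^sup>2"] Fnn[of "\<epsilon>\<^sup>2"] e0 by simp
  qed
  have far: "\<Psi>' t = 0 \<and> g t = 0" if t: "R\<^sup>2 \<le> t" for t
  proof -
    have "R \<le> sqrt t" using t R by (simp add: real_le_rsqrt)
    then have "mm (sqrt t) = 0" using R by (simp add: mm_def)
    moreover have "max (\<epsilon>\<^sup>2) t = t" using t eR by simp
    moreover have "\<epsilon>\<^sup>2 \<le> t" using t eR by simp
    ultimately show ?thesis using \<Psi>'F[of t] by (simp add: g_def F'_def F_def)
  qed
  have \<Psi>0: "\<Psi> t = 0" if t: "R\<^sup>2 \<le> t" for t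
  proof (cases "t = R\<^sup>2")
    case True
    then show ?thesis by (simp add: \<Psi>_def)
  next
    case False
    have "\<Psi> t = \<Psi> (R\<^sup>2)"
    proof (rule DERIV_isconst_end[where f=\<Psi>])
      show "R\<^sup>2 < t" using False t by simp
      show "continuous_on {R\<^sup>2..t} \<Psi>"
        using d1 by (meson DERIV_isCont continuous_at_imp_continuous_on)
      show "(\<Psi> has_field_derivative 0) (at z)" if "R\<^sup>2 < z" "z < t" for z using d1[of z] far[of z] that by simp
    qed
    then show ?thesis by (simp add: \<Psi>_def)
  qed
  have \<Psi>nn: "0 \<le> \<Psi> t" for t
  proof (cases "R\<^sup>2 \<le> t")
    case True
    then show ?thesis using \<Psi>0 by simp
  next
    case False
    then have "\<Psi> (R\<^sup>2) \<le> \<Psi> t"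
      by (intro DERIV_nonpos_imp_nonincreasing[of t "R\<^sup>2" \<Psi>]) (use d1 \<Psi>'np in auto)
    then show ?thesis by (simp add: \<Psi>_def)
  qed
  have mid: "\<Psi>' (s\<^sup>2) = - ((1 - s / R)\<^sup>2 / s ^ (k + 1)) \<and>
        g (s\<^sup>2) = (real k + 1) / 2 * (1 - s / R)\<^sup>2 / s ^ (k + 3) + (1 - s / R) / (R * s ^ (k + 2))"
    if s: "\<epsilon> \<le> s" "s \<le> R" for s
  proof -
    have s0: "s > 0" using s \<epsilon> by linarith
    have q: "\<epsilon>\<^sup>2 \<le> s\<^sup>2" using s \<epsilon> by (intro power_mono) auto
    have m: "mm s = 1 - s / R" using s R by (simp add: mm_def)
    have "max (\<epsilon>\<^sup>2) (s\<^sup>2) = s\<^sup>2" using q by simp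
    then show ?thesis using \<Psi>'F[OF q] s0 R m
      by (simp add: g_def F'_def F_def inverse_eq_divide power_one_over)
  qed
  \<comment> \<open>In units of 1 / \<epsilon>^(k + 1), the value of \<open>F\<close> at
    \<epsilon>^2 costs 1, and the rise of the tangent line from \<epsilon>^2 down to 0 costs
    \<open>1 + (k + 1) / 2\<close>.\<close>
  have core: "0 \<le> g t \<and> - \<Psi>' t \<le> (2 + (real k + 1) / 2) / \<epsilon> ^ (k + 1)" if t: "0 \<le> t" "t \<le> \<epsilon>\<^sup>2" for t
  proof
    define i where "i = inverse \<epsilon>"
    have i: "i > 0" "i * \<epsilon> = 1" using \<epsilon> by (auto simp: i_def)
    have m: "0 \<le> mm \<epsilon>" "mm \<epsilon> \<le> 1" "(mm \<epsilon>)\<^sup>2 \<le> 1"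
      using mm mm1[of \<epsilon>] \<epsilon> by (auto intro: power_le_one)
    have F0: "F (\<epsilon>\<^sup>2) \<le> i ^ (k + 1)"
      unfolding F_def using \<epsilon> m i by (simp add: i_def[symmetric] mult_left_le_one_le)
    have g0: "g (\<epsilon>\<^sup>2) * \<epsilon>\<^sup>2 \<le> ((real k + 1) / 2 + 1) * i ^ (k + 1)"
    proof -
      have "g (\<epsilon>\<^sup>2) * \<epsilon>\<^sup>2 = ((real k + 1) / 2 * (mm \<epsilon>)\<^sup>2 * i ^ (k + 3) + mm \<epsilon> / R * i ^ (k + 2)) * \<epsilon>\<^sup>2"
        unfolding g_def F'_def using \<epsilon> by (simp add: i_def[symmetric])
      also have "\<dots> = (real k + 1) / 2 * (mm \<epsilon>)\<^sup>2 * i ^ (k + 1) * (i * \<epsilon>)\<^sup>2 + mm \<epsilon> * (\<epsilon> / R) * i ^ (k + 1) * (i * \<epsilon>)"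
        by (simp add: power_add power2_eq_square power3_eq_cube algebra_simps)
      also have "\<dots> = ((real k + 1) / 2 * (mm \<epsilon>)\<^sup>2 + mm \<epsilon> * (\<epsilon> / R)) * i ^ (k + 1)"
        unfolding i(2) by (simp add: algebra_simps)
      also have "\<dots> \<le> ((real k + 1) / 2 * 1 + 1 * 1) * i ^ (k + 1)"
        using m \<epsilon> i R by (intro mult_right_mono add_mono mult_mono mult_left_mono) auto
      finally show ?thesis by simp
    qed
    show "0 \<le> g t" by (rule gnn)
    have "- \<Psi>' t \<le> F (\<epsilon>\<^sup>2) + g (\<epsilon>\<^sup>2) * (\<epsilon>\<^sup>2 - t)"
    proof (cases "t = \<epsilon>\<^sup>2")
      case True
      then show ?thesis by (simp add: \<Psi>'F)
    next
      case False
      then have "t < \<epsilon>\<^sup>2" using t by simp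
      then obtain z where z: "z < \<epsilon>\<^sup>2" "\<Psi>' (\<epsilon>\<^sup>2) - \<Psi>' t = (\<epsilon>\<^sup>2 - t) * g z"
        using MVT2[of t "\<epsilon>\<^sup>2" \<Psi>' g] d2 by blast
      then have "g z = g (\<epsilon>\<^sup>2)" by (simp add: g_def max_def)
      then show ?thesis using z \<Psi>'F[of "\<epsilon>\<^sup>2"] by (simp add: algebra_simps)
    qed
    also have "\<dots> \<le> F (\<epsilon>\<^sup>2) + g (\<epsilon>\<^sup>2) * \<epsilon>\<^sup>2" using t gnn by (intro add_left_mono mult_left_mono) auto
    also have "\<dots> \<le> (2 + (real k + 1) / 2) * i ^ (k + 1)" using F0 g0 by (simp add: algebra_simps)
    also have "\<dots> = (2 + (real k + 1) / 2) / \<epsilon> ^ (k + 1)" by (simp only: i_def divide_inverse power_inverse)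
    finally show "- \<Psi>' t \<le> (2 + (real k + 1) / 2) / \<epsilon> ^ (k + 1)" .
  qed
  have "\<forall>t. (\<Psi> has_field_derivative \<Psi>' t) (at t)" "\<forall>t. (\<Psi>' has_field_derivative g t) (at t)" "\<forall>t. 0 \<le> \<Psi> t"
    by (intro allI d1 d2 \<Psi>nn)+
  moreover have "\<forall>t. R\<^sup>2 \<le> t \<longrightarrow> \<Psi> t = 0 \<and> \<Psi>' t = 0 \<and> g t = 0"
    using \<Psi>0 far by simp
  moreover have "\<forall>s. \<epsilon> \<le> s \<and> s \<le> R \<longrightarrow> \<Psi>' (s\<^sup>2) = - ((1 - s / R)\<^sup>2 / s ^ (k + 1)) \<and>
        g (s\<^sup>2) = (real k + 1) / 2 * (1 - s / R)\<^sup>2 / s ^ (k + 3) + (1 - s / R) / (R * s ^ (k + 2))"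
    by (intro allI impI mid) auto
  moreover have "\<forall>t. 0 \<le> t \<and> t \<le> \<epsilon>\<^sup>2 \<longrightarrow> 0 \<le> g t \<and> - \<Psi>' t \<le> (2 + (real k + 1) / 2) / \<epsilon> ^ (k + 1)"
    by (intro allI impI core) auto
  ultimately show ?thesis using cg
    by (intro exI[of _ \<Psi>] exI[of _ \<Psi>'] exI[of _ g] conjI)
qed

text \<open>For \<open>a \<ge> 1\<close> the derivative is largest at the right end. Applied to
  |x|^(2 l), this measures how far the coefficient is from its frozen value.\<close>

lemma powr_lipschitz_on:
  fixes \<alpha> \<beta> a :: real
  assumes "0 < \<alpha>" "1 \<le> a"
  shows "\<exists>L\<ge>0. \<forall>s\<in>{\<alpha>..\<beta>}. \<forall>t\<in>{\<alpha>..\<beta>}. \<bar>s powr a - t powr a\<bar> \<le> L * \<bar>s - t\<bar>"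
proof (intro exI[of _ "a * \<beta> powr (a - 1)"] conjI ballI)
  show "0 \<le> a * \<beta> powr (a - 1)" using assms by simp
  fix s t assume st: "s \<in> {\<alpha>..\<beta>}" "t \<in> {\<alpha>..\<beta>}"
  have "norm (s powr a - t powr a) \<le> (a * \<beta> powr (a - 1)) * norm (s - t)"
  proof (rule field_differentiable_bound[of "{\<alpha>..\<beta>}" _ "\<lambda>z. a * z powr (a - 1)"])
    fix z assume z: "z \<in> {\<alpha>..\<beta>}"
    then have "z > 0" using assms by simp
    then have "((\<lambda>z. z powr a) has_field_derivative a * z powr (a - 1)) (at z)"
      by (rule has_real_derivative_powr)
    then show "((\<lambda>z. z powr a) has_field_derivative a * z powr (a - 1)) (at z within {\<alpha>..\<beta>})"
      by (rule has_field_derivative_at_within)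
    show "norm (a * z powr (a - 1)) \<le> a * \<beta> powr (a - 1)"
      using z assms by (simp add: abs_mult mult_left_mono powr_mono2)
  qed (use st in auto)
  then show "\<bar>s powr a - t powr a\<bar> \<le> a * \<beta> powr (a - 1) * \<bar>s - t\<bar>" by simp
qed

text \<open>Vitali's covering theorem gives the bound for open sets, outer regularity then for measurable
  ones.\<close>

lemma AE_ge_of_ball_averages:
  fixes u :: "'a::euclidean_space \<Rightarrow> real"
  assumes u: "integrable lebesgue u" "AE X in lebesgue. 0 \<le> u X" and B: "open B" "bounded B"
    and c: "c > 0" and dmax: "dmax > 0"
    and avg: "\<And>X \<delta>. X \<in> B \<Longrightarrow> 0 < \<delta> \<Longrightarrow> \<delta> < dmax \<Longrightarrow> ball X \<delta> \<subseteq> B \<Longrightarrow>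
       c * measure lebesgue (ball X \<delta>) \<le> (\<integral>Y. indicator (ball X \<delta>) Y * u Y \<partial>lebesgue)"
  shows "AE X in lebesgue. X \<in> B \<longrightarrow> c \<le> u X"
proof -
  \<comment> \<open>In terms of this measure the aim is that \<open>\<nu>\<close> dominates
    \<open>c\<close> times Lebesgue measure on subsets of \<open>B\<close>.\<close>
  define \<nu> where "\<nu> = density lebesgue (\<lambda>X. ennreal (u X))"
  have [measurable]: "u \<in> borel_measurable lebesgue" using u(1) by simp
  have setsnu: "sets \<nu> = sets lebesgue" by (simp add: \<nu>_def)
  have iu: "integrable lebesgue (\<lambda>Y. indicator A Y * u Y)" if "A \<in> sets lebesgue" for A
    using integrable_mult_indicator[OF that u(1)] by simp
  have nu: "emeasure \<nu> A = ennreal (\<integral>Y. indicator A Y * u Y \<partial>lebesgue)" if A: "A \<in> sets lebesgue" for A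
  proof -
    have "emeasure \<nu> A = (\<integral>\<^sup>+Y. ennreal (u Y) * indicator A Y \<partial>lebesgue)"
      unfolding \<nu>_def by (rule emeasure_density) (use A in auto)
    also have "\<dots> = (\<integral>\<^sup>+Y. ennreal (indicator A Y * u Y) \<partial>lebesgue)"
      by (intro nn_integral_cong) (auto split: split_indicator)
    also have "\<dots> = ennreal (\<integral>Y. indicator A Y * u Y \<partial>lebesgue)"
    proof (rule nn_integral_eq_integral[OF iu[OF A]])
      show "AE Y in lebesgue. 0 \<le> indicator A Y * u Y" using u(2) by eventually_elim simp
    qed
    finally show ?thesis .
  qed
  have opn: "ennreal c * emeasure lebesgue T \<le> emeasure \<nu> T" if T: "open T" "T \<subseteq> B" for T
  proof -
    \<comment> \<open>The Vitali cover: centre-radius pairs of balls inside \<open>T\<close> to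
      which the average hypothesis applies.\<close>
    define K where "K = {(x, d). x \<in> T \<and> 0 < d \<and> d < dmax \<and> ball x d \<subseteq> T}"
    have "\<exists>i. i \<in> K \<and> x \<in> ball (fst i) (snd i) \<and> snd i < d" if x: "x \<in> T" "0 < d" for x d
    proof -
      obtain e where e: "e > 0" "ball x e \<subseteq> T" using T(1) x(1) by (auto simp: open_contains_ball)
      define e' where "e' = min e (min d dmax) / 2"
      have e': "e' > 0" "e' < e" "e' < d" "e' < dmax" using e x dmax by (auto simp: e'_def min_def)
      have "ball x e' \<subseteq> T" using e e' subset_ball[of e' e x] by auto
      then show ?thesis using e' x by (intro exI[of _ "(x, e')"]) (auto simp: K_def)
    qed
    from Vitali_covering_theorem_balls[of T K fst snd, OF this]
    obtain C where C: "countable C" "C \<subseteq> K" "pairwise (\<lambda>i j. disjnt (ball (fst i) (snd i)) (ball (fst j) (snd j))) C"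
      "negligible (T - (\<Union>i\<in>C. ball (fst i) (snd i)))" by blast
    let ?b = "\<lambda>i. ball (fst i) (snd i)"
    have dis: "disjoint_family_on ?b C"
      using C(3) by (auto simp: disjoint_family_on_def pairwise_def disjnt_def)
    have Usets: "(\<Union>i\<in>C. ?b i) \<in> sets lebesgue" by (intro sets.countable_UN'[OF C(1)]) auto
    have "emeasure lebesgue T \<le> emeasure lebesgue ((\<Union>i\<in>C. ?b i) \<union> (T - (\<Union>i\<in>C. ?b i)))"
      using Usets T(1) by (intro emeasure_mono) auto
    also have "\<dots> = emeasure lebesgue (\<Union>i\<in>C. ?b i)"
      using C(4) Usets by (intro emeasure_Un_null_set) (auto simp: negligible_iff_null_sets)
    also have "\<dots> = (\<integral>\<^sup>+i. emeasure lebesgue (?b i) \<partial>count_space C)"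
      by (intro emeasure_UN_countable C(1) dis) auto
    finally have "ennreal c * emeasure lebesgue T \<le> ennreal c * (\<integral>\<^sup>+i. emeasure lebesgue (?b i) \<partial>count_space C)"
      by (intro mult_left_mono) auto
    also have "\<dots> = (\<integral>\<^sup>+i. ennreal c * emeasure lebesgue (?b i) \<partial>count_space C)"
      by (rule nn_integral_cmult[symmetric]) simp
    also have "\<dots> \<le> (\<integral>\<^sup>+i. emeasure \<nu> (?b i) \<partial>count_space C)"
    proof (rule nn_integral_mono)
      fix i assume "i \<in> space (count_space C)"
      then have i: "i \<in> K" using C(2) by auto
      have "emeasure lebesgue (?b i) = ennreal (measure lebesgue (?b i))"
        by (rule emeasure_eq_measure2) (rule lmeasurable_ball)
      then have "ennreal c * emeasure lebesgue (?b i) = ennreal (c * measure lebesgue (?b i))"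
        using c by (simp add: ennreal_mult)
      also have "\<dots> \<le> emeasure \<nu> (?b i)"
      proof -
        have "fst i \<in> B" "0 < snd i" "snd i < dmax" "?b i \<subseteq> B" using i T(2) by (auto simp: K_def)
        from avg[OF this] show ?thesis by (subst nu) (simp_all add: ennreal_leI)
      qed
      finally show "ennreal c * emeasure lebesgue (?b i) \<le> emeasure \<nu> (?b i)" .
    qed
    also have "\<dots> = emeasure \<nu> (\<Union>i\<in>C. ?b i)"
      by (intro emeasure_UN_countable[symmetric] C(1) dis) (auto simp: setsnu)
    also have "\<dots> \<le> emeasure \<nu> T"
    proof (rule emeasure_mono)
      have "?b i \<subseteq> T" if "i \<in> C" for i
      proof -
        have "i \<in> K" using C(2) that by blast
        then show ?thesis by (simp add: K_def case_prod_beta)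
      qed
      then show "(\<Union>i\<in>C. ?b i) \<subseteq> T" by (rule UN_least)
      show "T \<in> sets \<nu>" using T(1) by (simp add: setsnu)
    qed
    finally show ?thesis .
  qed
  have mble: "ennreal c * emeasure lebesgue Z \<le> emeasure \<nu> Z" if Z: "Z \<in> sets lebesgue" "Z \<subseteq> B" for Z
  proof -
    have "\<exists>T. open T \<and> Z \<subseteq> T \<and> emeasure lebesgue (T - Z) < ennreal (1 / (real n + 1))" for n
      using sets_lebesgue_outer_open[OF Z(1), of "1 / (real n + 1)"] by (metis of_nat_0_le_iff add_nonneg_pos zero_less_divide_1_iff zero_less_one)
    then obtain T where T: "\<And>n. open (T n)" "\<And>n. Z \<subseteq> T n"
      "\<And>n. emeasure lebesgue (T n - Z) < ennreal (1 / (real n + 1))" by metis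
    \<comment> \<open>Cutting down to \<open>B\<close> and making the open sets decrease gives
      continuity of \<open>\<nu>\<close> from above; their intersection exceeds \<open>Z\<close> by
      a null set only.\<close>
    define S where "S n = (\<Inter>j\<le>n. T j) \<inter> B" for n
    have S: "open (S n)" "S n \<subseteq> B" "Z \<subseteq> S n" "S n \<subseteq> T n" for n
      using T Z B by (auto simp: S_def intro!: open_Int open_INT)
    have dec: "decseq S" by (auto simp: S_def decseq_def)
    define D where "D = (\<Inter>n. S n)"
    have Dsets: "D \<in> sets lebesgue" unfolding D_def using S(1) by (intro sets.countable_INT) auto
    have "emeasure lebesgue (D - Z) \<le> ennreal (1 / (real n + 1))" for n
    proof -
      have "emeasure lebesgue (D - Z) \<le> emeasure lebesgue (T n - Z)"
      proof (rule emeasure_mono)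
        show "D - Z \<subseteq> T n - Z" using S(4)[of n] by (auto simp: D_def)
        show "T n - Z \<in> sets lebesgue" using T(1) Z(1) by auto
      qed
      then show ?thesis using T(3)[of n] by simp
    qed
    moreover have "(\<lambda>n. ennreal (1 / (real n + 1))) \<longlonglongrightarrow> ennreal 0"
      using LIMSEQ_inverse_real_of_nat by (intro tendsto_ennrealI) (simp add: inverse_eq_divide add.commute)
    ultimately have "emeasure lebesgue (D - Z) \<le> 0"
      unfolding ennreal_0 by (intro LIMSEQ_le_const[of "\<lambda>n. ennreal (1 / (real n + 1))"]) auto
    then have null: "D - Z \<in> null_sets lebesgue" using Dsets Z(1) by auto
    then have null': "D - Z \<in> null_sets \<nu>"
      unfolding \<nu>_def by (subst null_sets_density_iff) (auto simp: AE_iff_null_sets[symmetric] dest: AE_not_in)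
    have ZD: "Z \<union> (D - Z) = D" using S(3) by (auto simp: D_def)
    have "emeasure \<nu> D = emeasure \<nu> Z"
      using emeasure_Un_null_set[OF _ null', of Z] Z(1) unfolding ZD by (simp add: setsnu)
    moreover have "(\<lambda>n. emeasure \<nu> (S n)) \<longlonglongrightarrow> emeasure \<nu> D"
      unfolding D_def using S(1) dec by (intro Lim_emeasure_decseq) (auto simp: setsnu nu)
    moreover have "ennreal c * emeasure lebesgue Z \<le> emeasure \<nu> (S n)" for n
    proof -
      have "ennreal c * emeasure lebesgue Z \<le> ennreal c * emeasure lebesgue (S n)"
        using S Z(1) by (intro mult_left_mono emeasure_mono) auto
      also have "\<dots> \<le> emeasure \<nu> (S n)" by (rule opn[OF S(1,2)])
      finally show ?thesis .
    qed
    ultimately show ?thesis by (metis LIMSEQ_le_const)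
  qed
  \<comment> \<open>On this set the integrand \<open>c - u\<close> is positive, yet its integral is
    at most 0, so the set is null.\<close>
  define Z where "Z = {X \<in> B. u X < c}"
  have Z: "Z \<in> sets lebesgue" "Z \<subseteq> B"
  proof -
    have "Z = B \<inter> {X \<in> space lebesgue. u X < c}" by (auto simp: Z_def)
    moreover have "{X \<in> space lebesgue. u X < c} \<in> sets lebesgue" by measurable
    ultimately show "Z \<in> sets lebesgue" using B(1) by auto
  qed (auto simp: Z_def)
  have Zm: "Z \<in> lmeasurable" using bounded_subset[OF B(2) Z(2)] Z(1) by (rule bounded_set_imp_lmeasurable)
  have "ennreal (c * measure lebesgue Z) \<le> ennreal (\<integral>Y. indicator Z Y * u Y \<partial>lebesgue)"
    using mble[OF Z] c unfolding nu[OF Z(1)] by (simp add: emeasure_eq_measure2[OF Zm] ennreal_mult)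
  moreover have "0 \<le> (\<integral>Y. indicator Z Y * u Y \<partial>lebesgue)"
  proof (rule integral_nonneg_AE)
    show "AE Y in lebesgue. 0 \<le> indicator Z Y * u Y" using u(2) by eventually_elim simp
  qed
  ultimately have "c * measure lebesgue Z \<le> (\<integral>Y. indicator Z Y * u Y \<partial>lebesgue)" by (simp add: ennreal_le_iff)
  moreover have iZ: "integrable lebesgue (\<lambda>Y. indicator Z Y * c)"
    using Zm by (intro integrable_mult_left integrable_real_indicator) (auto simp: fmeasurable_def)
  moreover have "(\<integral>Y. indicator Z Y * c \<partial>lebesgue) = c * measure lebesgue Z" using Z(1) by simp
  ultimately have le: "(\<integral>Y. indicator Z Y * c - indicator Z Y * u Y \<partial>lebesgue) \<le> 0"
    using Bochner_Integration.integral_diff[OF iZ iu[OF Z(1)]] by linarith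
  have nn: "0 \<le> indicator Z Y * c - indicator Z Y * u Y" for Y
    by (auto simp: Z_def split: split_indicator)
  have "(\<integral>Y. indicator Z Y * c - indicator Z Y * u Y \<partial>lebesgue) = 0"
    using le nn by (intro antisym Bochner_Integration.integral_nonneg) auto
  then have "AE Y in lebesgue. indicator Z Y * c - indicator Z Y * u Y = 0"
    using integral_nonneg_eq_0_iff_AE[OF Bochner_Integration.integrable_diff[OF iZ iu[OF Z(1)]]] nn by auto
  then show ?thesis
  proof eventually_elim
    case (elim Y)
    then show ?case by (cases "Y \<in> Z") (auto simp: Z_def)
  qed
qed

text \<open>\<open>b\<close> is the coefficient relative to its frozen value and \<open>s\<close>
  the adapted distance. For \<open>b = 1\<close> the terms with the squared cut-off cancel, because
  \<open>2 * (k + 1) = 2 + 2 * k\<close>, and differentiating the cut-off leaves a gain of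
  \<open>4 * s / R\<close> times (1 - s / R) / s^(k + 1). Smallness of \<open>C * R\<close> lets
  this gain absorb the error from \<open>b\<close>.\<close>

lemma radial_profile_ineq:
  fixes s R b C p z :: real and k :: nat
  assumes s: "0 < s" "s \<le> R" and b: "\<bar>b - 1\<bar> \<le> C * s" and C: "0 \<le> C" "C * R \<le> 1 / 2" "4 * (real k + 1) * (C * R) \<le> 1"
    and pz: "0 \<le> p" "0 \<le> z" "p + z = s\<^sup>2"
  shows "(1 - s / R) / (R * s ^ k) \<le>
    ((real k + 1) / 2 * (1 - s / R)\<^sup>2 / s ^ (k + 3) + (1 - s / R) / (R * s ^ (k + 2))) * (4 * (p + b * z))
     - (1 - s / R)\<^sup>2 / s ^ (k + 1) * (2 + 2 * real k * b)"
proof -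
  have R: "R > 0" using s by linarith
  define m where "m = 1 - s / R"
  have m: "0 \<le> m" "m \<le> 1" using s R by (auto simp: m_def)
  define e where "e = C * s"
  have eCR: "e \<le> C * R" unfolding e_def using s C by (intro mult_left_mono) auto
  have e: "0 \<le> e" "e \<le> 1 / 2" using eCR C s by (auto simp: e_def)
  have eR: "4 * (real k + 1) * e \<le> s / R"
  proof -
    have "4 * (real k + 1) * e = (4 * (real k + 1) * (C * R)) * (s / R)" using R by (simp add: e_def)
    also have "\<dots> \<le> 1 * (s / R)" using C s R by (intro mult_right_mono) auto
    finally show ?thesis by simp
  qed
  have T: "(1 - e) * s\<^sup>2 \<le> p + b * z"
  proof -
    have "(1 - e) * z \<le> b * z" using b pz by (intro mult_right_mono) (auto simp: e_def abs_le_iff)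
    moreover have "(1 - e) * p \<le> 1 * p" using e pz by (intro mult_right_mono) auto
    ultimately have "(1 - e) * p + (1 - e) * z \<le> p + b * z" by linarith
    then show ?thesis using pz(3) by (simp add: distrib_left[symmetric])
  qed
  have co: "0 \<le> (real k + 1) / 2 * m\<^sup>2 / s ^ (k + 3) + m / (R * s ^ (k + 2))"
    using m s R by (intro add_nonneg_nonneg divide_nonneg_nonneg mult_nonneg_nonneg) auto
  have b2: "2 + 2 * real k * b \<le> 2 + 2 * real k * (1 + e)"
    using b by (intro add_left_mono mult_left_mono) (auto simp: e_def abs_le_iff)
  \<comment> \<open>Of the gain \<open>4 * (s / R)\<close> at least half survives the factor
    \<open>1 - e\<close>, and half of that pays for the perturbation, leaving
    \<open>s / R\<close>.\<close>
  have br: "s / R \<le> 2 * (real k + 1) * m * (1 - e) + 4 * (1 - e) * (s / R) - m * (2 + 2 * real k * (1 + e))"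
  proof -
    have "2 * (real k + 1) * m * (1 - e) - m * (2 + 2 * real k * (1 + e)) = - (m * ((4 * real k + 2) * e))"
      by (simp add: algebra_simps)
    moreover have "m * ((4 * real k + 2) * e) \<le> 1 * ((4 * real k + 4) * e)"
      using m e by (intro mult_mono mult_right_mono) auto
    moreover have "1 * ((4 * real k + 4) * e) \<le> s / R" using eR by (simp add: algebra_simps)
    moreover have "2 * (s / R) \<le> 4 * (1 - e) * (s / R)" using e s R by (intro mult_right_mono) auto
    ultimately show ?thesis by linarith
  qed
  have "m / (R * s ^ k) = m / s ^ (k + 1) * (s / R)" using s by (simp add: field_simps)
  also have "\<dots> \<le> m / s ^ (k + 1) * (2 * (real k + 1) * m * (1 - e) + 4 * (1 - e) * (s / R) - m * (2 + 2 * real k * (1 + e)))"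
    using br m s by (intro mult_left_mono divide_nonneg_nonneg) auto
  also have "\<dots> = ((real k + 1) / 2 * m\<^sup>2 / s ^ (k + 3) + m / (R * s ^ (k + 2))) * (4 * ((1 - e) * s\<^sup>2))
     - m\<^sup>2 / s ^ (k + 1) * (2 + 2 * real k * (1 + e))"
  proof -
    define A q where "A = m / s ^ (k + 1)" and "q = s / R"
    have 1: "m\<^sup>2 / s ^ (k + 3) * s\<^sup>2 = m * A" "m / (R * s ^ (k + 2)) * s\<^sup>2 = A * q"
      using s R by (simp_all add: A_def q_def power_add power2_eq_square power3_eq_cube)
    have 2: "m\<^sup>2 / s ^ (k + 1) = m * A" by (simp add: A_def power2_eq_square)
    have "(c / 2 * x + y) * (4 * ((1 - e) * t)) = c * 2 * (1 - e) * (x * t) + 4 * (1 - e) * (y * t)" for c x y t :: real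
      by (simp add: field_simps)
    from this[of "real k + 1" "m\<^sup>2 / s ^ (k + 3)" "m / (R * s ^ (k + 2))" "s\<^sup>2"]
    have "((real k + 1) / 2 * m\<^sup>2 / s ^ (k + 3) + m / (R * s ^ (k + 2))) * (4 * ((1 - e) * s\<^sup>2))
      = (real k + 1) * 2 * (1 - e) * (m * A) + 4 * (1 - e) * (A * q)"
      unfolding 1 times_divide_eq_right .
    then show ?thesis unfolding 2 A_def[symmetric] q_def[symmetric] by (simp add: algebra_simps)
  qed
  also have "\<dots> \<le> ((real k + 1) / 2 * m\<^sup>2 / s ^ (k + 3) + m / (R * s ^ (k + 2))) * (4 * (p + b * z))
     - m\<^sup>2 / s ^ (k + 1) * (2 + 2 * real k * b)"
  proof (rule diff_mono)
    show "((real k + 1) / 2 * m\<^sup>2 / s ^ (k + 3) + m / (R * s ^ (k + 2))) * (4 * ((1 - e) * s\<^sup>2))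
      \<le> ((real k + 1) / 2 * m\<^sup>2 / s ^ (k + 3) + m / (R * s ^ (k + 2))) * (4 * (p + b * z))"
      using T by (intro mult_left_mono co) auto
    show "m\<^sup>2 / s ^ (k + 1) * (2 + 2 * real k * b) \<le> m\<^sup>2 / s ^ (k + 1) * (2 + 2 * real k * (1 + e))"
      using b2 s by (intro mult_left_mono divide_nonneg_nonneg) auto
  qed
  finally show ?thesis unfolding m_def .
qed

section \<open>Lower bounds for ball averages of supersolutions\<close>

context grushin_domain
begin

lemma AE_fst_nonzero: "AE X in M. fst X \<noteq> 0"
proof -
  have "negligible {X :: real \<times> (real ^ 'm). (1, 0) \<bullet> X = 0}"
    by (rule negligible_hyperplane) (simp add: zero_prod_def)
  then have "{X :: real \<times> (real ^ 'm). fst X = 0} \<in> null_sets lebesgue"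
    by (simp add: negligible_iff_null_sets inner_prod_def)
  then have "AE X in lebesgue. X \<notin> {X :: real \<times> (real ^ 'm). fst X = 0}" by (rule AE_not_in)
  then have "AE X in lebesgue. X \<in> \<Omega> \<longrightarrow> fst X \<noteq> 0" by eventually_elim simp
  then show ?thesis using Omega_sets by (simp add: AE_restrict_space_iff)
qed

text \<open>If every point off x = 0 had a ball on which \<open>u\<close> vanishes, countably many
  such balls would cover almost all of \<Omega> by Lindelof.\<close>

lemma support_point:
  fixes u :: "real \<times> (real ^ 'm) \<Rightarrow> real"
  assumes "\<not> (AE X in M. u X = 0)"
  shows "\<exists>P\<in>\<Omega>. fst P \<noteq> 0 \<and> (\<forall>r>0. \<not> (AE X in M. X \<in> ball P r \<longrightarrow> u X = 0))"
proof (rule ccontr)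
  assume neg: "\<not> ?thesis"
  define \<F> where "\<F> = {ball P r | P r. r > 0 \<and> P \<in> \<Omega> \<and> (AE X in M. X \<in> ball P r \<longrightarrow> u X = 0)}"
  obtain \<F>' where F: "\<F>' \<subseteq> \<F>" "countable \<F>'" "\<Union>\<F>' = \<Union>\<F>"
    by (rule Lindelof[of \<F>]) (auto simp: \<F>_def)
  have 1: "AE X in M. \<forall>S\<in>\<F>'. X \<in> S \<longrightarrow> u X = 0"
    using F(1,2) by (subst AE_ball_countable) (auto simp: \<F>_def)
  have 2: "X \<in> \<Union>\<F>'" if X: "X \<in> \<Omega>" "fst X \<noteq> 0" for X
  proof -
    obtain r where "r > 0" "AE Y in M. Y \<in> ball X r \<longrightarrow> u Y = 0" using neg X by blast
    then have "ball X r \<in> \<F>" using X unfolding \<F>_def by blast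
    then show ?thesis unfolding F(3) using \<open>r > 0\<close> by (meson UnionI centre_in_ball)
  qed
  have "AE X in M. X \<in> \<Omega>" by (rule AE_I2) (simp add: space_M)
  with 1 AE_fst_nonzero have "AE X in M. u X = 0"
    by eventually_elim (use 2 in blast)
  then show False using assms by blast
qed

text \<open>Testing with a cut-off, truncated subsolution that is singular at \<open>Q\<close> bounds the averages of a
  supersolution over small balls around \<open>Q\<close> from below, uniformly in \<open>Q\<close>.\<close>

lemma superharmonic_ball_average:
  assumes u: "superharmonic u U"
    and Q: "fst Q \<noteq> 0" and \<epsilon>: "0 < \<epsilon>" "\<epsilon> < R" and C: "0 \<le> C" "C * R \<le> 1 / 2" "4 * (real CARD('m) + 1) * (C * R) \<le> 1"
    and lip: "\<And>x. \<bar>x - fst Q\<bar> \<le> R \<Longrightarrow> \<bar>(\<bar>x\<bar> powr l)\<^sup>2 / (\<bar>fst Q\<bar> powr l)\<^sup>2 - 1\<bar> \<le> C * \<bar>x - fst Q\<bar>"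
    and \<Lambda>: "1 \<le> \<Lambda>" "\<bar>fst Q\<bar> powr l \<le> \<Lambda>" "1 / (\<bar>fst Q\<bar> powr l) \<le> \<Lambda>"
    and K: "cball Q (\<Lambda> * R) \<subseteq> \<Omega>" and S: "S \<subseteq> ball Q (R / (2 * \<Lambda>))" "S \<in> sets lebesgue"
  shows "(\<integral>X. indicator S X * u X \<partial>M) * \<epsilon> ^ (CARD('m) + 1) \<le>
     2 * R ^ (CARD('m) + 1) * ((2 + 4 * real CARD('m)) * (2 + (real CARD('m) + 1) / 2) + 1) *
       (\<integral>X. indicator (ball Q (\<Lambda> * \<epsilon>)) X * u X \<partial>M)"
proof -
  have Wu: "W u U" and u0: "AE X in M. 0 \<le> u X"
    and sup: "\<And>v V. W v V \<Longrightarrow> AE X in M. 0 \<le> v X \<Longrightarrow> 0 \<le> (\<integral>X. U X \<bullet> V X \<partial>M)"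
    using u by (auto simp: superharmonic_def)
  define k where "k = CARD('m)"
  have R: "R > 0" using \<epsilon> by linarith
  define a where "a = \<bar>fst Q\<bar> powr l"
  have a: "a > 0" using Q by (simp add: a_def)
  \<comment> \<open>Stretching y by \<open>1 / a\<close> turns the operator frozen at
    \<open>Q\<close> into the Laplacian; \<Lambda> compares the adapted distance with the Euclidean
    one.\<close>
  define \<kappa> where "\<kappa> = 1 / a\<^sup>2"
  have \<kappa>: "\<kappa> > 0" using a by (simp add: \<kappa>_def)
  have \<kappa>\<Lambda>: "\<kappa> \<le> \<Lambda>\<^sup>2"
  proof -
    have "(1 / a)\<^sup>2 \<le> \<Lambda>\<^sup>2" using \<Lambda> a by (intro power_mono) (auto simp: a_def)
    then show ?thesis by (simp add: \<kappa>_def power_divide)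
  qed
  have a\<Lambda>: "a\<^sup>2 \<le> \<Lambda>\<^sup>2" using \<Lambda> a by (intro power_mono) (auto simp: a_def)
  have \<Lambda>1: "1 \<le> \<Lambda>\<^sup>2" using \<Lambda>(1) by (simp add: one_le_power)
  let ?q = "qdist \<kappa> Q"
  have qnn: "0 \<le> ?q X" for X using \<kappa> by (simp add: qdist_def)
  have dist2: "(dist X Q)\<^sup>2 = (fst X - fst Q)\<^sup>2 + (norm (snd X - snd Q))\<^sup>2" for X
    using qdist_one[of Q X] by (simp add: qdist_def)
  have q1: "?q X \<le> \<Lambda>\<^sup>2 * (dist X Q)\<^sup>2" for X
    unfolding dist2 qdist_def distrib_left using \<kappa>\<Lambda> \<Lambda>1 mult_right_mono[OF \<Lambda>1, of "(fst X - fst Q)\<^sup>2"]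
    by (intro add_mono mult_right_mono) auto
  have q2: "(dist X Q)\<^sup>2 \<le> \<Lambda>\<^sup>2 * ?q X" for X
  proof -
    have "(norm (snd X - snd Q))\<^sup>2 = a\<^sup>2 * (\<kappa> * (norm (snd X - snd Q))\<^sup>2)" using a by (simp add: \<kappa>_def)
    also have "\<dots> \<le> \<Lambda>\<^sup>2 * (\<kappa> * (norm (snd X - snd Q))\<^sup>2)" using a\<Lambda> \<kappa> by (intro mult_right_mono) auto
    finally show ?thesis
      unfolding dist2 qdist_def distrib_left using mult_right_mono[OF \<Lambda>1, of "(fst X - fst Q)\<^sup>2"] by simp
  qed
  have q3: "dist X Q < \<Lambda> * t" if "?q X < t\<^sup>2" "t > 0" for X t
  proof -
    have "\<Lambda>\<^sup>2 * ?q X < \<Lambda>\<^sup>2 * t\<^sup>2" using that \<Lambda>1 by (intro mult_strict_left_mono) linarith+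
    then have "(dist X Q)\<^sup>2 < (\<Lambda> * t)\<^sup>2" using q2[of X] by (simp add: power_mult_distrib)
    moreover have "0 \<le> \<Lambda> * t" using that \<Lambda>(1) by (intro mult_nonneg_nonneg) auto
    ultimately show ?thesis by (rule power2_less_imp_less)
  qed
  have q4: "dist X Q \<le> \<Lambda> * R" if "?q X \<le> R\<^sup>2" for X
  proof -
    have "\<Lambda>\<^sup>2 * ?q X \<le> \<Lambda>\<^sup>2 * R\<^sup>2" using that by (intro mult_left_mono) auto
    then have "(dist X Q)\<^sup>2 \<le> (\<Lambda> * R)\<^sup>2" using q2[of X] by (simp add: power_mult_distrib)
    moreover have "0 \<le> \<Lambda> * R" using R \<Lambda>(1) by (intro mult_nonneg_nonneg) auto
    ultimately show ?thesis by (rule power2_le_imp_le)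
  qed
  obtain \<Psi> \<Psi>' \<Psi>'' where P: "\<forall>t. (\<Psi> has_field_derivative \<Psi>' t) (at t)" "\<forall>t. (\<Psi>' has_field_derivative \<Psi>'' t) (at t)"
     "continuous_on UNIV \<Psi>''" "\<forall>t. 0 \<le> \<Psi> t"
     "\<forall>t. R\<^sup>2 \<le> t \<longrightarrow> \<Psi> t = 0 \<and> \<Psi>' t = 0 \<and> \<Psi>'' t = 0"
     "\<forall>s. \<epsilon> \<le> s \<and> s \<le> R \<longrightarrow> \<Psi>' (s\<^sup>2) = - ((1 - s / R)\<^sup>2 / s ^ (k + 1)) \<and>
        \<Psi>'' (s\<^sup>2) = (real k + 1) / 2 * (1 - s / R)\<^sup>2 / s ^ (k + 3) + (1 - s / R) / (R * s ^ (k + 2))"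
     "\<forall>t. 0 \<le> t \<and> t \<le> \<epsilon>\<^sup>2 \<longrightarrow> 0 \<le> \<Psi>'' t \<and> - \<Psi>' t \<le> (2 + (real k + 1) / 2) / \<epsilon> ^ (k + 1)"
    using singular_profile[OF \<epsilon>, of k] by blast
  define LV where "LV = radial_L l \<kappa> Q \<Psi>' \<Psi>''"
  define b where "b X = (\<bar>fst X\<bar> powr l)\<^sup>2 / a\<^sup>2" for X :: "real \<times> (real ^ 'm)"
  define p z where "p X = (fst X - fst Q)\<^sup>2" and "z X = \<kappa> * (norm (snd X - snd Q))\<^sup>2" for X
  have pz: "0 \<le> p X" "0 \<le> z X" "?q X = p X + z X" for X
    using \<kappa> by (auto simp: p_def z_def qdist_def)
  have LVeq: "LV X = \<Psi>'' (?q X) * (4 * (p X + b X * z X)) + \<Psi>' (?q X) * (2 + 2 * real k * b X)" for X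
    using a unfolding LV_def radial_L_def b_def p_def z_def \<kappa>_def k_def
    by (simp add: power2_eq_square field_simps)
  have bnd: "\<bar>b X - 1\<bar> \<le> C * sqrt (?q X) \<and> \<bar>b X - 1\<bar> \<le> 1 / 2" if "?q X \<le> R\<^sup>2" for X
  proof -
    have "\<bar>fst X - fst Q\<bar> \<le> sqrt (?q X)"
      using pz(2)[of X] by (intro real_le_rsqrt) (simp add: pz(3) p_def)
    moreover have "sqrt (?q X) \<le> R" using that R by (simp add: real_le_lsqrt)
    ultimately have x: "\<bar>fst X - fst Q\<bar> \<le> R" "C * \<bar>fst X - fst Q\<bar> \<le> C * sqrt (?q X)" "C * sqrt (?q X) \<le> C * R"
      using C by (auto intro!: mult_left_mono)
    then show ?thesis using lip[OF x(1)] C(2) unfolding b_def a_def by linarith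
  qed
  \<comment> \<open>The lower bound of \<open>LV\<close> outside the core up to adapted distance
    \<open>R / 2\<close>, where \<open>1 - s / R \<ge> 1 / 2\<close>.\<close>
  define c1 where "c1 = 1 / (2 * R ^ (k + 1))"
  define C2 where "C2 = (2 + 4 * real k) * (2 + (real k + 1) / 2)"
  have out: "LV X \<ge> 0" "?q X \<le> (R / 2)\<^sup>2 \<Longrightarrow> LV X \<ge> c1" if q: "\<epsilon>\<^sup>2 \<le> ?q X" for X
  proof -
    define s where "s = sqrt (?q X)"
    have s2: "s\<^sup>2 = ?q X" using qnn by (simp add: s_def)
    have s: "\<epsilon> \<le> s" using q by (simp add: s_def real_le_rsqrt)
    then have s: "\<epsilon> \<le> s" "0 < s" using \<epsilon> by auto
    have ge: "(1 - s / R) / (R * s ^ k) \<le> LV X" if sR: "s \<le> R"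
    proof -
      have "?q X \<le> R\<^sup>2" unfolding s2[symmetric] using sR s by (intro power_mono) auto
      from bnd[OF this] have bb: "\<bar>b X - 1\<bar> \<le> C * s" by (simp add: s_def)
      have "p X + z X = s\<^sup>2" using s2 pz(3) by simp
      from radial_profile_ineq[OF s(2) sR bb C(1,2) C(3)[folded k_def] pz(1,2) this]
      show ?thesis using P(6) s sR unfolding LVeq s2[symmetric] by simp
    qed
    show "LV X \<ge> 0"
    proof (cases "s \<le> R")
      case True
      have "0 \<le> (1 - s / R) / (R * s ^ k)" using True R s by (intro divide_nonneg_nonneg) auto
      then show ?thesis using ge[OF True] by linarith
    next
      case False
      then have "R\<^sup>2 \<le> s\<^sup>2" using R by (intro power_mono) auto
      then show ?thesis using P(5) unfolding LVeq s2[symmetric] by simp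
    qed
    show "LV X \<ge> c1" if "?q X \<le> (R / 2)\<^sup>2"
    proof -
      have sR: "s \<le> R / 2" unfolding s_def using that R by (intro real_le_lsqrt) auto
      have "c1 = (1 / 2) / (R * R ^ k)" by (simp add: c1_def)
      also have "\<dots> \<le> (1 - s / R) / (R * s ^ k)"
      proof (rule frac_le)
        show "1 / 2 \<le> 1 - s / R" using sR R by (simp add: field_simps)
        show "R * s ^ k \<le> R * R ^ k" using sR s R by (intro mult_left_mono power_mono) auto
      qed (use s R sR in auto)
      finally show ?thesis using ge sR R by linarith
    qed
  qed
  have core: "LV X \<ge> - (C2 / \<epsilon> ^ (k + 1))" if q: "?q X \<le> \<epsilon>\<^sup>2" for X
  proof -
    have "\<epsilon>\<^sup>2 \<le> R\<^sup>2" using \<epsilon> by (intro power_mono) auto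
    then have "?q X \<le> R\<^sup>2" using q by linarith
    from conjunct2[OF bnd[OF this]] have bb: "0 \<le> b X" "b X \<le> 2" unfolding abs_le_iff by linarith+
    have 1: "0 \<le> \<Psi>'' (?q X)" "- \<Psi>' (?q X) \<le> (2 + (real k + 1) / 2) / \<epsilon> ^ (k + 1)" using P(7) q qnn by auto
    have "- \<Psi>' (?q X) * (2 + 2 * real k * b X) \<le> (2 + (real k + 1) / 2) / \<epsilon> ^ (k + 1) * (2 + 2 * real k * b X)"
      using 1(2) bb by (intro mult_right_mono) auto
    also have "\<dots> \<le> (2 + (real k + 1) / 2) / \<epsilon> ^ (k + 1) * (2 + 4 * real k)"
      using bb \<epsilon> mult_left_mono[OF bb(2), of "2 * real k"] by (intro mult_left_mono) auto
    also have "\<dots> = C2 / \<epsilon> ^ (k + 1)" by (simp add: C2_def)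
    finally have "- (C2 / \<epsilon> ^ (k + 1)) \<le> \<Psi>' (?q X) * (2 + 2 * real k * b X)" by simp
    moreover have "0 \<le> \<Psi>'' (?q X) * (4 * (p X + b X * z X))"
      using 1 bb pz by (intro mult_nonneg_nonneg add_nonneg_nonneg) auto
    ultimately show ?thesis unfolding LVeq by linarith
  qed
  define K' where "K' = {X. ?q X \<le> R\<^sup>2}"
  have K'sub: "K' \<subseteq> cball Q (\<Lambda> * R)" using q4 by (auto simp: K'_def dist_commute)
  have "closed K'" unfolding K'_def
    by (intro closed_Collect_le qdist_continuous continuous_on_const)
  then have K': "compact K'"
    using bounded_subset[OF bounded_cball K'sub] by (simp add: compact_eq_bounded_closed)
  have K'0: "\<forall>X. X \<notin> K' \<longrightarrow> \<Psi> (?q X) = 0" using P(5) by (simp add: K'_def)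
  note RT = radial_test[OF P(1)[rule_format] P(2)[rule_format] P(3) K' subset_trans[OF K'sub K] K'0]
  have "0 \<le> (\<integral>X. U X \<bullet> qgrad l (\<lambda>X. \<Psi> (?q X)) X \<partial>M)"
    using P(4) by (intro sup[OF W_C10[OF RT(1)]]) simp
  then have le0: "(\<integral>X. u X * LV X \<partial>M) \<le> 0" using RT(3)[OF Wu] by (simp add: LV_def)
  \<comment> \<open>\<open>C2\<close> covers the negative part of \<open>LV\<close> in the core; the
    extra 1 pays for \<open>c1\<close> where \<open>S\<close> meets the core.\<close>
  define D where "D = (C2 + 1) / \<epsilon> ^ (k + 1)"
  have c1D: "c1 \<le> 1 / \<epsilon> ^ (k + 1)"
  proof -
    have "\<epsilon> ^ (k + 1) \<le> R ^ (k + 1)" using \<epsilon> by (intro power_mono) auto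
    also have "\<dots> \<le> 2 * R ^ (k + 1)" using R by simp
    finally show ?thesis unfolding c1_def using \<epsilon> by (intro frac_le) auto
  qed
  have C2: "C2 \<ge> 0" by (simp add: C2_def)
  have D: "D \<ge> 0" using C2 \<epsilon> by (simp add: D_def)
  have c1: "c1 > 0" using R by (simp add: c1_def)
  \<comment> \<open>Integrated against \<open>u \<ge> 0\<close> and combined with the supersolution
    inequality, this pointwise bound controls the mass on \<open>S\<close> by the mass on the small
    ball.\<close>
  have pt: "c1 * indicator S X - D * indicator (ball Q (\<Lambda> * \<epsilon>)) X \<le> LV X" for X
  proof (cases "?q X < \<epsilon>\<^sup>2")
    case True
    then have "X \<in> ball Q (\<Lambda> * \<epsilon>)" using q3[OF True \<epsilon>(1)] by (simp add: dist_commute)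
    moreover have "c1 * indicator S X \<le> c1" using c1 by (auto split: split_indicator)
    moreover have "D = C2 / \<epsilon> ^ (k + 1) + 1 / \<epsilon> ^ (k + 1)" by (simp add: D_def add_divide_distrib)
    ultimately show ?thesis using core[of X] True c1D by simp
  next
    case False
    then have q: "\<epsilon>\<^sup>2 \<le> ?q X" by simp
    have Dn: "0 \<le> D * indicator (ball Q (\<Lambda> * \<epsilon>)) X" using D by simp
    show ?thesis
    proof (cases "X \<in> S")
      case True
      then have "dist X Q < R / (2 * \<Lambda>)" using S by (auto simp: dist_commute)
      then have "(dist X Q)\<^sup>2 \<le> (R / (2 * \<Lambda>))\<^sup>2" by (intro power_mono) auto
      then have "\<Lambda>\<^sup>2 * (dist X Q)\<^sup>2 \<le> \<Lambda>\<^sup>2 * (R / (2 * \<Lambda>))\<^sup>2" by (intro mult_left_mono) auto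
      also have "\<dots> = (R / 2)\<^sup>2" using \<Lambda> by (simp add: power_divide power_mult_distrib)
      finally have "?q X \<le> (R / 2)\<^sup>2" using q1[of X] by linarith
      then show ?thesis using out(2)[OF q] Dn True by simp
    next
      case False
      then show ?thesis using out(1)[OF q] Dn by simp
    qed
  qed
  have iu: "integrable M u" by (rule square_integrable_integrable[OF finite_M W_square_integrable(1)[OF Wu]])
  have SM: "indicator S \<in> borel_measurable M" "indicator (ball Q (\<Lambda> * \<epsilon>)) \<in> borel_measurable M"
    by (intro measurable_restrict_space1 borel_measurable_indicator; use S(2) in simp)+
  have iI: "integrable M (\<lambda>X. indicator T X * u X)" if "(indicator T :: _ \<Rightarrow> real) \<in> borel_measurable M" for T
  proof (rule Bochner_Integration.integrable_bound[OF iu])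
    show "(\<lambda>X. indicator T X * u X) \<in> borel_measurable M" using that iu by measurable
    show "AE X in M. norm (indicator T X * u X) \<le> norm (u X)" by (auto split: split_indicator)
  qed
  have "(\<integral>X. c1 * (indicator S X * u X) - D * (indicator (ball Q (\<Lambda> * \<epsilon>)) X * u X) \<partial>M) \<le> (\<integral>X. u X * LV X \<partial>M)"
  proof (rule integral_mono_AE)
    show "integrable M (\<lambda>X. c1 * (indicator S X * u X) - D * (indicator (ball Q (\<Lambda> * \<epsilon>)) X * u X))"
      by (intro Bochner_Integration.integrable_diff integrable_mult_right iI SM)
    show "integrable M (\<lambda>X. u X * LV X)"
      unfolding LV_def by (intro square_integrable_mult W_square_integrable(1)[OF Wu] square_integrable_continuous RT(2))
    show "AE X in M. c1 * (indicator S X * u X) - D * (indicator (ball Q (\<Lambda> * \<epsilon>)) X * u X) \<le> u X * LV X"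
      using u0
    proof eventually_elim
      case (elim X)
      from mult_left_mono[OF pt[of X] elim] show ?case by (simp add: algebra_simps)
    qed
  qed
  then have "c1 * (\<integral>X. indicator S X * u X \<partial>M) - D * (\<integral>X. indicator (ball Q (\<Lambda> * \<epsilon>)) X * u X \<partial>M) \<le> 0"
    using le0 iI[OF SM(1)] iI[OF SM(2)] by simp
  then have "c1 * (\<integral>X. indicator S X * u X \<partial>M) * (\<epsilon> ^ (k + 1) * (2 * R ^ (k + 1)))
     \<le> D * (\<integral>X. indicator (ball Q (\<Lambda> * \<epsilon>)) X * u X \<partial>M) * (\<epsilon> ^ (k + 1) * (2 * R ^ (k + 1)))"
    using \<epsilon> R by (intro mult_right_mono) auto
  moreover have "c1 * I * (\<epsilon> ^ (k + 1) * (2 * R ^ (k + 1))) = I * \<epsilon> ^ (k + 1)" for I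
    using R by (simp add: c1_def)
  moreover have "D * I * (\<epsilon> ^ (k + 1) * (2 * R ^ (k + 1))) = 2 * R ^ (k + 1) * (C2 + 1) * I" for I
    using \<epsilon> by (simp add: D_def)
  ultimately show ?thesis by (simp only: k_def C2_def)
qed

text \<open>The power \<open>\<epsilon> ^ (CARD('m) + 1)\<close> in the average estimate is the
  volume scaling in R^(1 + m), so the averages over small balls in \<open>B\<close> share one
  positive lower bound, proportional to the mass \<open>I\<close> of \<open>u\<close> near a support
  point.\<close>

lemma superharmonic_pos_somewhere:
  assumes u: "superharmonic u U" and nz: "\<not> (AE X in M. u X = 0)"
  shows "\<exists>P\<in>\<Omega>. pos_at u P"
proof -
  have Wu: "W u U" and u0: "AE X in M. 0 \<le> u X" using u by (auto simp: superharmonic_def)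
  obtain P where P: "P \<in> \<Omega>" "fst P \<noteq> 0" "\<And>r. r > 0 \<Longrightarrow> \<not> (AE X in M. X \<in> ball P r \<longrightarrow> u X = 0)"
    using support_point[OF nz] by blast
  define w where "w = \<bar>fst P\<bar>"
  have w: "w > 0" using P by (simp add: w_def)
  obtain d where d: "d > 0" "ball P d \<subseteq> \<Omega>" using op P(1) by (auto simp: open_contains_ball)
  obtain L where L: "L \<ge> 0" "\<And>s t. s \<in> {w/2..3*w/2} \<Longrightarrow> t \<in> {w/2..3*w/2} \<Longrightarrow> \<bar>s powr (2 * l) - t powr (2 * l)\<bar> \<le> L * \<bar>s - t\<bar>"
    using powr_lipschitz_on[of "w/2" "2 * l" "3*w/2"] w l by auto
  \<comment> \<open>Bounds |x|^l and its inverse over the range of x that occurs near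
    \<open>P\<close>.\<close>
  define \<Lambda> where "\<Lambda> = max 1 (max ((3*w/2) powr l) (1 / ((w/2) powr l)))"
  have \<Lambda>: "1 \<le> \<Lambda>" "t powr l \<le> \<Lambda>" "1 / (t powr l) \<le> \<Lambda>" if "t \<in> {w/2..3*w/2}" for t
  proof -
    have "t powr l \<le> (3*w/2) powr l" using that w l by (intro powr_mono2) auto
    moreover have "(w/2) powr l \<le> t powr l" using that w l by (intro powr_mono2) auto
    then have "1 / (t powr l) \<le> 1 / ((w/2) powr l)" using w by (intro frac_le) auto
    ultimately show "1 \<le> \<Lambda>" "t powr l \<le> \<Lambda>" "1 / (t powr l) \<le> \<Lambda>" by (auto simp: \<Lambda>_def)
  qed
  have \<Lambda>1: "1 \<le> \<Lambda>" by (simp add: \<Lambda>_def)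
  \<comment> \<open>The Lipschitz constant of |x|^(2 l), divided by its value at \<open>Q\<close>,
    which is at least 1 / \<Lambda>^2.\<close>
  define C where "C = L * \<Lambda>\<^sup>2"
  have C: "C \<ge> 0" using L by (simp add: C_def)
  define n where "n = real CARD('m) + 1"
  have n: "n \<ge> 1" by (simp add: n_def)
  \<comment> \<open>The three bounds keep x away from 0, make the coefficient error absorbable, and
    keep the adapted balls inside \<Omega>.\<close>
  define R where "R = min (w/4) (min (1 / (4 * n * (C + 1))) (d / (2 * \<Lambda>)))"
  have R: "R > 0" using w n C d \<Lambda>1 by (simp add: R_def)
  have R1: "R \<le> w/4" "R \<le> 1 / (4 * n * (C + 1))" "R \<le> d / (2 * \<Lambda>)" by (auto simp: R_def)
  have nCR: "4 * n * (C * R) \<le> 1"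
  proof -
    have "4 * n * C * R \<le> 4 * n * (C + 1) * R" using n R by (intro mult_right_mono) auto
    also have "\<dots> \<le> 4 * n * (C + 1) * (1 / (4 * n * (C + 1)))" using n C R1 by (intro mult_left_mono) auto
    also have "\<dots> = 1" using n C by simp
    finally show ?thesis by (simp add: mult.assoc)
  qed
  have CR: "C * R \<le> 1 / 2"
  proof -
    have "4 * 1 * (C * R) \<le> 4 * n * (C * R)" using n C R by (intro mult_right_mono mult_left_mono) auto
    then show ?thesis using nCR by simp
  qed
  have dR: "\<Lambda> * R \<le> d / 2" using R1(3) \<Lambda>1 by (simp add: field_simps)
  \<comment> \<open>Small enough that \<open>B\<close> lies in the ball of radius
    \<open>R / (2 * \<Lambda>)\<close> around each of its points.\<close>
  define r where "r = R / (8 * \<Lambda>)"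
  have r: "r > 0" using R \<Lambda>1 by (simp add: r_def)
  have rR: "r \<le> R / 8" using R \<Lambda>1 unfolding r_def by (intro frac_le) auto
  have "R \<le> \<Lambda> * R" using \<Lambda>1 R by simp
  then have rd: "r < d / 2" using rR dR R by linarith
  define B where "B = ball P r"
  have B\<Omega>: "B \<subseteq> \<Omega>" using subset_ball[of r d P] rd d by (auto simp: B_def)
  define I where "I = (\<integral>X. indicator B X * u X \<partial>M)"
  have iu: "integrable M u" by (rule square_integrable_integrable[OF finite_M W_square_integrable(1)[OF Wu]])
  have iI: "integrable M (\<lambda>X. indicator T X * u X)" if "T \<in> sets lebesgue" for T
  proof (rule Bochner_Integration.integrable_bound[OF iu])
    have [measurable]: "(indicator T :: _ \<Rightarrow> real) \<in> borel_measurable M"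
      using that by (intro measurable_restrict_space1) auto
    show "(\<lambda>X. indicator T X * u X) \<in> borel_measurable M" using iu by measurable
    show "AE X in M. norm (indicator T X * u X) \<le> norm (u X)" by (auto split: split_indicator)
  qed
  have Bs: "B \<in> sets lebesgue" by (simp add: B_def)
  have I: "I > 0"
  proof (rule ccontr)
    have nn: "AE X in M. 0 \<le> indicator B X * u X" using u0 by eventually_elim simp
    assume "\<not> I > 0"
    then have "I = 0" using integral_nonneg_AE[OF nn] by (simp add: I_def)
    then have "AE X in M. indicator B X * u X = 0"
      using integral_nonneg_eq_0_iff_AE[OF iI[OF Bs] nn] by (simp add: I_def)
    then have "AE X in M. X \<in> ball P r \<longrightarrow> u X = 0" by eventually_elim (auto simp: B_def)
    then show False using P(3)[OF r] by blast
  qed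
  define A where "A = 2 * R ^ (CARD('m) + 1) * ((2 + 4 * real CARD('m)) * (2 + (real CARD('m) + 1) / 2) + 1)"
  have A: "A > 0" using R by (auto simp: A_def intro!: mult_pos_pos add_nonneg_pos)
  have est: "I * \<epsilon> ^ (CARD('m) + 1) \<le> A * (\<integral>X. indicator (ball Q (\<Lambda> * \<epsilon>)) X * u X \<partial>M)"
    if Q: "Q \<in> B" and \<epsilon>: "0 < \<epsilon>" "\<epsilon> < R" for Q \<epsilon>
    unfolding I_def A_def
  proof (rule superharmonic_ball_average[OF u _ \<epsilon> C CR])
    have dPQ: "dist P Q < r" using Q by (simp add: B_def)
    have "\<bar>fst P - fst Q\<bar> \<le> dist P Q" using dist_fst_le[of P Q] by (simp add: dist_real_def)
    then have fQ: "\<bar>fst P - fst Q\<bar> < w/32" using dPQ rR R1(1) by linarith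
    then show "fst Q \<noteq> 0" using w by (auto simp: w_def)
    have aQ: "\<bar>fst Q\<bar> \<in> {w/2..3*w/2}" using fQ unfolding w_def atLeastAtMost_iff by (intro conjI) linarith+
    show "1 \<le> \<Lambda>" "\<bar>fst Q\<bar> powr l \<le> \<Lambda>" "1 / (\<bar>fst Q\<bar> powr l) \<le> \<Lambda>" using \<Lambda>[OF aQ] by auto
    show "4 * (real CARD('m) + 1) * (C * R) \<le> 1" using nCR by (simp add: n_def)
    show "cball Q (\<Lambda> * R) \<subseteq> \<Omega>"
    proof
      fix X assume "X \<in> cball Q (\<Lambda> * R)"
      then have "dist P X < d" using dist_triangle[of P X Q] dPQ rd dR by auto
      then show "X \<in> \<Omega>" using d by auto
    qed
    show "B \<subseteq> ball Q (R / (2 * \<Lambda>))"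
    proof
      fix X assume "X \<in> B"
      then have "dist Q X < 2 * r" using dist_triangle[of Q X P] dPQ by (auto simp: B_def dist_commute)
      moreover have "2 * r \<le> R / (2 * \<Lambda>)" using R \<Lambda>1 by (simp add: r_def field_simps)
      ultimately show "X \<in> ball Q (R / (2 * \<Lambda>))" by simp
    qed
    show "B \<in> sets lebesgue" by (rule Bs)
    fix x assume x: "\<bar>x - fst Q\<bar> \<le> R"
    have ax: "\<bar>x\<bar> \<in> {w/2..3*w/2}" using fQ x R1(1) unfolding w_def atLeastAtMost_iff by (intro conjI) linarith+
    have sq: "(t powr l)\<^sup>2 = t powr (2 * l)" for t :: real
      by (simp add: power2_eq_square flip: powr_add)
    define h where "h = \<bar>fst Q\<bar> powr (2 * l)"
    have h: "h > 0" using aQ w by (auto simp: h_def)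
    have h\<Lambda>: "1 / h \<le> \<Lambda>\<^sup>2"
    proof -
      have "(1 / (\<bar>fst Q\<bar> powr l))\<^sup>2 \<le> \<Lambda>\<^sup>2" using \<Lambda>[OF aQ] by (intro power_mono) auto
      then show ?thesis by (simp add: power_divide sq h_def)
    qed
    have "\<bar>\<bar>x\<bar> powr (2 * l) - h\<bar> \<le> L * \<bar>\<bar>x\<bar> - \<bar>fst Q\<bar>\<bar>" unfolding h_def by (rule L(2)[OF ax aQ])
    also have "\<dots> \<le> L * \<bar>x - fst Q\<bar>" using L(1) by (intro mult_left_mono) auto
    finally have 1: "\<bar>\<bar>x\<bar> powr (2 * l) - h\<bar> \<le> L * \<bar>x - fst Q\<bar>" .
    have "\<bar>\<bar>x\<bar> powr (2 * l) / h - 1\<bar> = \<bar>\<bar>x\<bar> powr (2 * l) - h\<bar> * (1 / h)"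
      using h by (simp add: diff_divide_distrib[symmetric] abs_divide field_simps)
    also have "\<dots> \<le> (L * \<bar>x - fst Q\<bar>) * \<Lambda>\<^sup>2" using 1 h\<Lambda> h L by (intro mult_mono) auto
    finally show "\<bar>(\<bar>x\<bar> powr l)\<^sup>2 / (\<bar>fst Q\<bar> powr l)\<^sup>2 - 1\<bar> \<le> C * \<bar>x - fst Q\<bar>"
      unfolding sq h_def C_def by (simp add: algebra_simps)
  qed
  define V where "V = unit_ball_vol (real (CARD('m) + 1))"
  have V: "V > 0" unfolding V_def by (rule unit_ball_vol_pos) simp
  define c where "c = I / (A * \<Lambda> ^ (CARD('m) + 1) * V)"
  have c: "c > 0" using I A \<Lambda>1 V by (simp add: c_def)
  define u' where "u' X = indicator \<Omega> X * u X" for X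
  have iu': "integrable lebesgue u'"
    using iu Omega_sets by (simp add: u'_def[abs_def] integrable_restrict_space)
  have u'0: "AE X in lebesgue. 0 \<le> u' X"
  proof -
    have "AE X in lebesgue. X \<in> \<Omega> \<longrightarrow> 0 \<le> u X" using u0 Omega_sets by (simp add: AE_restrict_space_iff)
    then show ?thesis by eventually_elim (simp add: u'_def split: split_indicator)
  qed
  have "AE X in lebesgue. X \<in> B \<longrightarrow> c \<le> u' X"
  proof (rule AE_ge_of_ball_averages[OF iu' u'0 _ _ c, where dmax="\<Lambda> * R"])
    show "open B" "bounded B" by (auto simp: B_def)
    show "\<Lambda> * R > 0" using \<Lambda>1 R by simp
    fix Q \<delta> assume Q: "Q \<in> B" and \<delta>: "0 < \<delta>" "\<delta> < \<Lambda> * R" and sub: "ball Q \<delta> \<subseteq> B"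
    define \<epsilon> where "\<epsilon> = \<delta> / \<Lambda>"
    have \<epsilon>: "0 < \<epsilon>" "\<epsilon> < R" "\<Lambda> * \<epsilon> = \<delta>" using \<delta> \<Lambda>1 by (auto simp: \<epsilon>_def field_simps)
    have "(\<integral>X. indicator (ball Q \<delta>) X * u' X \<partial>lebesgue) = (\<integral>X. indicator \<Omega> X *\<^sub>R (indicator (ball Q \<delta>) X * u X) \<partial>lebesgue)"
      by (intro Bochner_Integration.integral_cong) (auto simp: u'_def)
    also have "\<dots> = (\<integral>X. indicator (ball Q \<delta>) X * u X \<partial>M)"
      using Omega_sets by (intro integral_restrict_space[symmetric]) simp
    finally have eq: "(\<integral>X. indicator (ball Q \<delta>) X * u' X \<partial>lebesgue) = (\<integral>X. indicator (ball Q \<delta>) X * u X \<partial>M)" .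
    have "measure lebesgue (ball Q \<delta>) = V * \<delta> ^ (CARD('m) + 1)"
      using content_ball[of \<delta> Q] \<delta> by (simp add: V_def)
    then have "c * measure lebesgue (ball Q \<delta>) = I * \<epsilon> ^ (CARD('m) + 1) / A"
      using V \<Lambda>1 by (simp add: c_def \<epsilon>_def power_divide)
    also have "\<dots> \<le> (\<integral>X. indicator (ball Q \<delta>) X * u X \<partial>M)"
      using est[OF Q \<epsilon>(1,2)] A unfolding \<epsilon>(3) by (simp add: field_simps)
    finally show "c * measure lebesgue (ball Q \<delta>) \<le> (\<integral>X. indicator (ball Q \<delta>) X * u' X \<partial>lebesgue)"
      unfolding eq .
  qed
  then have "AE X in lebesgue. X \<in> \<Omega> \<longrightarrow> X \<in> ball P r \<longrightarrow> c \<le> u X"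
    by eventually_elim (auto simp: u'_def B_def)
  then have "AE X in M. X \<in> ball P r \<longrightarrow> c \<le> u X"
    using Omega_sets by (simp add: AE_restrict_space_iff)
  then have "pos_at u P" unfolding pos_at_def using r c B\<Omega> by (auto simp: B_def)
  then show ?thesis using P(1) by blast
qed

lemma strong_maximum_principle:
  assumes u: "superharmonic u U" and nz: "\<not> (AE X in M. u X = 0)" and conn: "connected \<Omega>"
    and K: "compact K" "K \<subseteq> \<Omega>"
  shows "\<exists>c>0. AE X in M. X \<in> K \<longrightarrow> c \<le> u X"
proof -
  obtain P0 where "P0 \<in> \<Omega>" "pos_at u P0" using superharmonic_pos_somewhere[OF u nz] by blast
  from pos_on_compact[OF pos_at_everywhere[OF u conn this] K] show ?thesis .
qed

end

section \<open>Existence and uniqueness\<close>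

lemma grushin_sqrtA_sym: "grushin_sqrtA l X p \<bullet> q = p \<bullet> grushin_sqrtA l X q"
  by (simp add: grushin_sqrtA_def inner_prod_def)

lemma grushin_A_inner: "grushin_A l X p \<bullet> q = grushin_sqrtA l X p \<bullet> grushin_sqrtA l X q"
  by (simp add: grushin_sqrtA_sym[symmetric] grushin_sqrtA_sqrtA)

lemma grushin_A_sqrtA_inv:
  assumes "fst X \<noteq> 0"
  shows "grushin_A l X (grushin_sqrtA_inv l X p) \<bullet> q = p \<bullet> grushin_sqrtA l X q"
  unfolding grushin_A_inner grushin_sqrtA_inverse(1)[OF assms] ..

lemma compactly_contained_compact: "compact K \<Longrightarrow> K \<subseteq> \<Omega> \<Longrightarrow> compactly_contained K \<Omega>" for K :: "'a::t2_space set"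
  by (simp add: compactly_contained_def closure_closed compact_imp_closed)

context grushin_domain
begin

lemma L2_lim_iff: "L2_lim \<Omega> g h \<longleftrightarrow> L2_tendsto M g h"
  by (simp add: L2_lim_def L2_tendsto_def L2_fun_def square_integrable_def)

lemma norm0_eq: "norm0 l \<Omega> v = sqrt (\<integral>X. (norm (qgrad l v X))\<^sup>2 \<partial>M)"
  by (simp add: norm0_def grushin_A_inner qgrad_def power2_norm_eq_inner)

lemma H10_repr_imp_W:
  assumes "H10_repr l \<Omega> \<phi> u"
  shows "\<exists>U. W u U"
proof -
  have p: "\<And>n. \<phi> n \<in> C10 \<Omega>" "L2_tendsto M \<phi> u"
    and C: "\<And>e. e > 0 \<Longrightarrow> \<exists>N. \<forall>i\<ge>N. \<forall>j\<ge>N. norm0 l \<Omega> (\<lambda>X. \<phi> i X - \<phi> j X) < e"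
    using assms by (auto simp: H10_repr_def L2_lim_iff)
  have C': "\<exists>N. \<forall>i\<ge>N. \<forall>j\<ge>N. (\<integral>X. (norm (qgrad l (\<phi> i) X - qgrad l (\<phi> j) X))\<^sup>2 \<partial>M) < e" if "e > 0" for e
  proof -
    have "sqrt e > 0" using that by simp
    from C[OF this] obtain N where "\<forall>i\<ge>N. \<forall>j\<ge>N. norm0 l \<Omega> (\<lambda>X. \<phi> i X - \<phi> j X) < sqrt e" ..
    then show ?thesis by (intro exI[of _ N]) (simp add: norm0_eq qgrad_diff p(1))
  qed
  obtain U where "L2_tendsto M (\<lambda>n. qgrad l (\<phi> n)) U"
    using L2_complete[OF C10_square_integrable(2)[OF p(1)] C'] by blast
  then show ?thesis using W_I[OF p] by blast
qed

lemma L2_tendsto_H10_repr: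
  assumes p: "\<And>n. \<phi> n \<in> C10 \<Omega>" "L2_tendsto M \<phi> u" "L2_tendsto M (\<lambda>n. qgrad l (\<phi> n)) U"
  shows "H10_repr l \<Omega> \<phi> u"
  unfolding H10_repr_def L2_lim_iff
proof (intro conjI allI impI p)
  fix e :: real assume e: "e > 0"
  let ?d = "\<lambda>n. sqrt (\<integral>X. (norm (qgrad l (\<phi> n) X - U X))\<^sup>2 \<partial>M)"
  have "?d \<longlonglongrightarrow> sqrt 0" by (intro tendsto_real_sqrt L2_tendstoD(3)[OF p(3)])
  then have "?d \<longlonglongrightarrow> 0" by simp
  from order_tendstoD(2)[OF this, of "e / 2"] e obtain N where N: "\<And>n. n \<ge> N \<Longrightarrow> ?d n < e / 2"
    by (auto simp: eventually_sequentially)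
  have "norm0 l \<Omega> (\<lambda>X. \<phi> i X - \<phi> j X) < e" if "i \<ge> N" "j \<ge> N" for i j
  proof -
    note S = square_integrable_diff[OF L2_tendstoD(1,2)[OF p(3)]] square_integrable_diff[OF L2_tendstoD(2,1)[OF p(3)]]
    have "norm0 l \<Omega> (\<lambda>X. \<phi> i X - \<phi> j X) \<le> ?d i + sqrt (\<integral>X. (norm (U X - qgrad l (\<phi> j) X))\<^sup>2 \<partial>M)"
      using L2_triangle[OF S(1)[of i] S(2)[of j]] by (simp add: norm0_eq qgrad_diff p(1))
    also have "\<dots> = ?d i + ?d j" by (simp add: norm_minus_commute)
    finally show ?thesis using N[OF that(1)] N[OF that(2)] by linarith
  qed
  then show "\<exists>N. \<forall>i\<ge>N. \<forall>j\<ge>N. norm0 l \<Omega> (\<lambda>X. \<phi> i X - \<phi> j X) < e" by blast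
qed

lemma H10_iff: "u \<in> H10 l \<Omega> \<longleftrightarrow> (\<exists>U. W u U)"
  using H10_repr_imp_W L2_tendsto_H10_repr unfolding H10_def W_def by blast

text \<open>Whatever the choice operator selects comes from some \<open>U'\<close> with
  \<open>W u U'\<close>; closability gives \<open>U' = U\<close> almost everywhere, and off x = 0
  the inverse weight cancels.\<close>

lemma weak_quasi_grad_AE:
  assumes W: "W u U"
  shows "AE X in M. \<forall>q. grushin_A l X (weak_quasi_grad l \<Omega> u X) \<bullet> q = U X \<bullet> grushin_sqrtA l X q"
proof -
  obtain \<phi> where p: "\<And>n. \<phi> n \<in> C10 \<Omega>" "L2_tendsto M \<phi> u" "L2_tendsto M (\<lambda>n. qgrad l (\<phi> n)) U"
    using W unfolding W_def by blast
  have "is_weak_quasi_grad l \<Omega> u (\<lambda>X. grushin_sqrtA_inv l X (U X))"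
    unfolding is_weak_quasi_grad_def L2_lim_iff
    using L2_tendsto_H10_repr[OF p] p(3) by (intro exI[of _ \<phi>] exI[of _ U]) (auto simp: qgrad_def[abs_def])
  then have "is_weak_quasi_grad l \<Omega> u (weak_quasi_grad l \<Omega> u)"
    unfolding weak_quasi_grad_def by (rule someI[of "is_weak_quasi_grad l \<Omega> u"])
  then obtain \<psi> U' where q: "H10_repr l \<Omega> \<psi> u" "L2_tendsto M (\<lambda>n. qgrad l (\<psi> n)) U'"
    "AE X in M. weak_quasi_grad l \<Omega> u X = grushin_sqrtA_inv l X (U' X)"
    unfolding is_weak_quasi_grad_def L2_lim_iff qgrad_def[abs_def] by blast
  have "W u U'" using q(1,2) by (intro W_I[of \<psi>]) (auto simp: H10_repr_def L2_lim_iff)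
  from W_unique[OF W this] q(3) AE_fst_nonzero show ?thesis
    by eventually_elim (simp add: grushin_A_sqrtA_inv)
qed

text \<open>The selected quasi-gradient has no measurability built in; completeness of Lebesgue
  measure transfers it from an almost everywhere equal function.\<close>

lemma borel_measurable_AE_eq:
  fixes g h :: "real \<times> (real ^ 'm) \<Rightarrow> real"
  assumes g: "g \<in> borel_measurable M" and ae: "AE X in M. g X = h X"
  shows "h \<in> borel_measurable M"
proof (rule measurableI)
  fix S :: "real set" assume S: "S \<in> sets borel"
  have "g -` S \<inter> \<Omega> \<in> sets M" using measurable_sets[OF g S] by (simp add: space_M)
  then have 1: "g -` S \<inter> \<Omega> \<in> sets lebesgue" using Omega_sets by (simp add: sets_restrict_space_iff)
  have "AE X in lebesgue. X \<in> \<Omega> \<longrightarrow> g X = h X" using ae Omega_sets by (simp add: AE_restrict_space_iff)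
  then have "AE X in lebesgue. X \<in> g -` S \<inter> \<Omega> \<longleftrightarrow> X \<in> h -` S \<inter> \<Omega>" by eventually_elim auto
  then have "h -` S \<inter> \<Omega> \<in> sets lebesgue" by (rule completion.in_sets_AE[OF _ 1]) simp
  then show "h -` S \<inter> space M \<in> sets M" using Omega_sets by (simp add: space_M sets_restrict_space_iff)
qed simp

section \<open>Weak solutions in terms of \<open>W\<close>, and uniqueness\<close>

definition solution where
  "solution f u U \<longleftrightarrow> W u U \<and> (\<forall>K. compact K \<longrightarrow> K \<subseteq> \<Omega> \<longrightarrow> (\<exists>c>0. AE X in M. X \<in> K \<longrightarrow> c \<le> u X)) \<and>
     (\<forall>v\<in>C10 \<Omega>. (\<integral>X. U X \<bullet> qgrad l v X \<partial>M) = (\<integral>X. f X * v X / u X \<partial>M))"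

lemma weak_solution_iff: "weak_solution l \<Omega> f u \<longleftrightarrow> (\<exists>U. solution f u U)"
proof -
  have bounds: "(\<forall>\<Omega>'. compactly_contained \<Omega>' \<Omega> \<longrightarrow> (\<exists>C>0. AE X in lebesgue. X \<in> \<Omega>' \<longrightarrow> C \<le> u X))
     \<longleftrightarrow> (\<forall>K. compact K \<longrightarrow> K \<subseteq> \<Omega> \<longrightarrow> (\<exists>c>0. AE X in M. X \<in> K \<longrightarrow> c \<le> u X))" (is "?A \<longleftrightarrow> ?B")
  proof
    assume A: ?A
    show ?B
    proof (intro allI impI)
      fix K assume "compact K" "K \<subseteq> \<Omega>"
      then have "compactly_contained K \<Omega>" by (rule compactly_contained_compact)
      then obtain C where C: "C > 0" "AE X in lebesgue. X \<in> K \<longrightarrow> C \<le> u X" using A by blast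
      from C(2) have "AE X in lebesgue. X \<in> \<Omega> \<longrightarrow> X \<in> K \<longrightarrow> C \<le> u X" by eventually_elim simp
      then show "\<exists>c>0. AE X in M. X \<in> K \<longrightarrow> c \<le> u X" using C(1) Omega_sets by (auto simp: AE_restrict_space_iff)
    qed
  next
    assume B: ?B
    show ?A
    proof (intro allI impI)
      fix \<Omega>' assume "compactly_contained \<Omega>' \<Omega>"
      then have K: "compact (closure \<Omega>')" "closure \<Omega>' \<subseteq> \<Omega>" by (auto simp: compactly_contained_def)
      then obtain C where C: "C > 0" "AE X in M. X \<in> closure \<Omega>' \<longrightarrow> C \<le> u X" using B by blast
      then have "AE X in lebesgue. X \<in> \<Omega> \<longrightarrow> X \<in> closure \<Omega>' \<longrightarrow> C \<le> u X"
        using Omega_sets by (simp add: AE_restrict_space_iff)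
      then have "AE X in lebesgue. X \<in> \<Omega>' \<longrightarrow> C \<le> u X"
        by eventually_elim (use K(2) closure_subset[of \<Omega>'] in blast)
      then show "\<exists>C>0. AE X in lebesgue. X \<in> \<Omega>' \<longrightarrow> C \<le> u X" using C(1) by blast
    qed
  qed
  have eq: "(\<integral>X. grushin_A l X (weak_quasi_grad l \<Omega> u X) \<bullet> grad v X \<partial>M) = (\<integral>X. U X \<bullet> qgrad l v X \<partial>M)"
    if W: "W u U" and v: "v \<in> C10 \<Omega>" for U v
  proof -
    have m: "(\<lambda>X. U X \<bullet> qgrad l v X) \<in> borel_measurable M"
      by (intro borel_measurable_integrable square_integrable_inner W_square_integrable(2)[OF W] C10_square_integrable(2)[OF v])
    have ae: "AE X in M. U X \<bullet> qgrad l v X = grushin_A l X (weak_quasi_grad l \<Omega> u X) \<bullet> grad v X"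
      using weak_quasi_grad_AE[OF W]
    proof eventually_elim
      case (elim X)
      show ?case unfolding qgrad_def by (rule spec[OF elim, symmetric])
    qed
    show ?thesis
      by (rule integral_cong_AE[symmetric, OF m borel_measurable_AE_eq[OF m ae] ae])
  qed
  show ?thesis
    unfolding weak_solution_def H10_iff bounds solution_def using eq by auto
qed

text \<open>Where \<open>v\<close> is nonzero the singular factor is at most \<open>1 / c\<close>,
  so an integrable \<open>f\<close> suffices. The bound doubles as the majorant for dominated
  convergence.\<close>

lemma rhs_bound:
  fixes f v u :: "real \<times> (real ^ 'm) \<Rightarrow> real"
  assumes f: "integrable M f" and v: "v \<in> borel_measurable M" "\<And>X. \<bar>v X\<bar> \<le> B" "\<forall>X. X \<notin> K \<longrightarrow> v X = 0"
    and u: "u \<in> borel_measurable M" "c > 0" "AE X in M. X \<in> K \<longrightarrow> c \<le> u X"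
  shows "integrable M (\<lambda>X. f X * v X / u X)" "AE X in M. \<bar>f X * v X / u X\<bar> \<le> \<bar>f X\<bar> * (B / c)"
proof -
  show ae: "AE X in M. \<bar>f X * v X / u X\<bar> \<le> \<bar>f X\<bar> * (B / c)"
    using u(3)
  proof eventually_elim
    case (elim X)
    have B: "B \<ge> 0" using v(2)[of X] by linarith
    show ?case
    proof (cases "X \<in> K")
      case True
      then have "\<bar>v X\<bar> / \<bar>u X\<bar> \<le> B / c" using elim v(2)[of X] u(2) B by (intro frac_le) auto
      then have "\<bar>f X\<bar> * (\<bar>v X\<bar> / \<bar>u X\<bar>) \<le> \<bar>f X\<bar> * (B / c)" by (rule mult_left_mono) simp
      then show ?thesis by (simp add: abs_mult)
    next
      case False
      then have "v X = 0" using v(3) by blast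
      then show ?thesis using B u(2) by simp
    qed
  qed
  show "integrable M (\<lambda>X. f X * v X / u X)"
  proof (rule Bochner_Integration.integrable_bound)
    show "integrable M (\<lambda>X. \<bar>f X\<bar> * (B / c))" using f by (intro integrable_mult_left integrable_abs)
    show "(\<lambda>X. f X * v X / u X) \<in> borel_measurable M" using f v(1) u(1) by measurable
    show "AE X in M. norm (f X * v X / u X) \<le> norm (\<bar>f X\<bar> * (B / c))"
      using ae
    proof eventually_elim
      case (elim X)
      show ?case unfolding real_norm_def using elim by (rule order_trans) (rule abs_ge_self)
    qed
  qed
qed

text \<open>The difference \<open>z\<close> of two solutions is not admissible in the equations, since \<open>f / u\<close> need not
  lie in the dual space.  It is replaced by \<open>gam z * gam \<phi>\<close> with \<open>\<phi>\<close> in \<open>C10 \<Omega>\<close> close to \<open>z\<close>.\<close>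

lemma solution_le:
  assumes f: "integrable M f" "AE X in M. 0 \<le> f X" and u: "solution f u U" and w: "solution f w V"
  shows "AE X in M. w X \<le> u X"
proof -
  have Wu: "W u U" and Ww: "W w V"
    and lu: "\<And>K. compact K \<Longrightarrow> K \<subseteq> \<Omega> \<Longrightarrow> \<exists>c>0. AE X in M. X \<in> K \<longrightarrow> c \<le> u X"
    and lw: "\<And>K. compact K \<Longrightarrow> K \<subseteq> \<Omega> \<Longrightarrow> \<exists>c>0. AE X in M. X \<in> K \<longrightarrow> c \<le> w X"
    and eu: "\<And>v. v \<in> C10 \<Omega> \<Longrightarrow> (\<integral>X. U X \<bullet> qgrad l v X \<partial>M) = (\<integral>X. f X * v X / u X \<partial>M)"
    and ew: "\<And>v. v \<in> C10 \<Omega> \<Longrightarrow> (\<integral>X. V X \<bullet> qgrad l v X \<partial>M) = (\<integral>X. f X * v X / w X \<partial>M)"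
    using u w by (auto simp: solution_def)
  note Su = W_square_integrable[OF Wu] and Sw = W_square_integrable[OF Ww]
  define z where "z X = w X - u X" for X
  define Z where "Z X = V X - U X" for X
  have Wz: "W z Z" unfolding z_def Z_def by (rule W_diff[OF Ww Wu])
  note Sz = W_square_integrable[OF Wz]
  have [measurable]: "z \<in> borel_measurable M" by (rule square_integrable_measurable[OF Sz(1)])
  have [measurable]: "gam \<in> borel_measurable borel" "gam' \<in> borel_measurable borel"
    by (auto intro: borel_measurable_continuous_onI gam_continuous)
  obtain \<phi> where p: "\<And>n. \<phi> n \<in> C10 \<Omega>" "L2_tendsto M \<phi> z" "L2_tendsto M (\<lambda>n. qgrad l (\<phi> n)) Z"
    "AE X in M. (\<lambda>n. \<phi> n X) \<longlonglongrightarrow> z X"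
    by (rule W_E[OF Wz], rule that)
  have [measurable]: "\<phi> n \<in> borel_measurable M" for n by (rule continuous_M[OF C10_continuous[OF p(1)]])
  define \<psi> where "\<psi> n X = gam (\<phi> n X)" for n X
  have psi: "\<psi> n \<in> C10 \<Omega>" "grad (\<psi> n) = (\<lambda>X. gam' (\<phi> n X) *\<^sub>R grad (\<phi> n) X)" for n
    unfolding \<psi>_def[abs_def] using C10_compose[OF p(1) gam_has_derivative gam_continuous(2) gam_nonpos(1)] by auto
  have psiq: "qgrad l (\<psi> n) = (\<lambda>X. gam' (\<phi> n X) *\<^sub>R qgrad l (\<phi> n) X)" for n
    by (simp add: qgrad_def[abs_def] psi(2) grushin_sqrtA_linear)
  have [measurable]: "\<psi> n \<in> borel_measurable M" for n by (rule continuous_M[OF C10_continuous[OF psi(1)]])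
  have gb: "\<bar>gam t\<bar> \<le> 1" "\<bar>gam' t\<bar> \<le> 1" for t using gam_bounds[of t] by auto
  have psilim: "AE X in M. (\<lambda>n. \<psi> n X) \<longlonglongrightarrow> gam (z X)"
    using p(4)
  proof eventually_elim
    case (elim X)
    show ?case unfolding \<psi>_def by (rule continuous_on_tendsto_compose[OF gam_continuous(1)[of UNIV] elim]) auto
  qed
  have lim1: "L2_tendsto M (\<lambda>n. qgrad l (\<psi> n)) (\<lambda>X. gam' (z X) *\<^sub>R Z X)"
    unfolding psiq
  proof (rule L2_tendsto_bounded_mult[where B=1, OF p(3)])
    show "AE X in M. (\<lambda>n. gam' (\<phi> n X)) \<longlonglongrightarrow> gam' (z X)"
      using p(4)
    proof eventually_elim
      case (elim X)
      show ?case by (rule continuous_on_tendsto_compose[OF gam_continuous(2)[of UNIV] elim]) auto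
    qed
  qed (auto simp: gb)
  have lim2: "L2_tendsto M (\<lambda>n X. \<psi> n X *\<^sub>R H X) (\<lambda>X. gam (z X) *\<^sub>R H X)" if "square_integrable M H"
    for H :: "real \<times> (real ^ 'm) \<Rightarrow> real \<times> (real ^ 'm)"
    by (rule L2_tendsto_bounded_mult[where B=1, OF L2_tendsto_const[OF that]])
      (use psilim in \<open>auto simp: gb \<psi>_def\<close>)
  have step: "(\<integral>X. Z X \<bullet> (gam (z X) *\<^sub>R qgrad l (\<psi> k) X + \<psi> k X *\<^sub>R (gam' (z X) *\<^sub>R Z X)) \<partial>M) \<le> 0" for k
  proof -
    obtain K where K: "compact K" "K \<subseteq> \<Omega>" "\<And>X. X \<notin> K \<Longrightarrow> \<psi> k X = 0" "\<And>X. X \<notin> K \<Longrightarrow> grad (\<psi> k) X = 0"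
      by (rule C10_support[OF psi(1)], rule that)
    obtain c where c: "c > 0" "AE X in M. X \<in> K \<longrightarrow> c \<le> u X" using lu[OF K(1,2)] by blast
    obtain d where d: "d > 0" "AE X in M. X \<in> K \<longrightarrow> d \<le> w X" using lw[OF K(1,2)] by blast
    have mu: "u \<in> borel_measurable M" "w \<in> borel_measurable M"
      using Su Sw by (auto intro: square_integrable_measurable)
    \<comment> \<open>\<open>\<psi> k\<close> fixes the compact support, on which both solutions are
      bounded below, while \<open>j\<close> tends to infinity and replaces \<open>\<psi> j\<close>
      by \<open>gam z\<close>.\<close>
    define v where "v j X = \<psi> j X * \<psi> k X" for j X
    have v: "v j \<in> C10 \<Omega>" for j unfolding v_def by (rule C10_mult_C10(1)[OF psi(1) psi(1)])
    have vb: "\<bar>v j X\<bar> \<le> 1" for j X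
      unfolding v_def \<psi>_def abs_mult using mult_mono[OF gb(1) gb(1)] by simp
    have v0: "\<forall>X. X \<notin> K \<longrightarrow> v j X = 0" for j using K(3) by (simp add: v_def)
    have vm: "v j \<in> borel_measurable M" for j by (rule continuous_M[OF C10_continuous[OF v]])
    have qv: "qgrad l (v j) = (\<lambda>X. \<psi> j X *\<^sub>R qgrad l (\<psi> k) X + \<psi> k X *\<^sub>R qgrad l (\<psi> j) X)" for j
      unfolding v_def[abs_def] by (rule qgrad_mult[OF psi(1) psi(1)])
    note ru = rhs_bound[OF f(1) vm vb v0 mu(1) c] and rw = rhs_bound[OF f(1) vm vb v0 mu(2) d]
    have "L2_tendsto M (\<lambda>j X. \<psi> k X *\<^sub>R qgrad l (\<psi> j) X) (\<lambda>X. \<psi> k X *\<^sub>R (gam' (z X) *\<^sub>R Z X))"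
      by (rule L2_tendsto_bounded_mult[where B=1, OF lim1]) (auto simp: gb \<psi>_def)
    from L2_tendsto_add[OF lim2[OF C10_square_integrable(2)[OF psi(1)]] this]
    have "L2_tendsto M (\<lambda>j. qgrad l (v j)) (\<lambda>X. gam (z X) *\<^sub>R qgrad l (\<psi> k) X + \<psi> k X *\<^sub>R (gam' (z X) *\<^sub>R Z X))"
      unfolding qv .
    from L2_tendsto_inner[OF L2_tendsto_const[OF Sz(2)] this]
    have L: "(\<lambda>j. \<integral>X. Z X \<bullet> qgrad l (v j) X \<partial>M) \<longlonglongrightarrow>
      (\<integral>X. Z X \<bullet> (gam (z X) *\<^sub>R qgrad l (\<psi> k) X + \<psi> k X *\<^sub>R (gam' (z X) *\<^sub>R Z X)) \<partial>M)" .
    have E: "(\<integral>X. Z X \<bullet> qgrad l (v j) X \<partial>M) = (\<integral>X. f X * v j X / w X - f X * v j X / u X \<partial>M)" for j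
    proof -
      have "(\<integral>X. Z X \<bullet> qgrad l (v j) X \<partial>M) = (\<integral>X. V X \<bullet> qgrad l (v j) X \<partial>M) - (\<integral>X. U X \<bullet> qgrad l (v j) X \<partial>M)"
        unfolding Z_def inner_diff_left
        by (intro Bochner_Integration.integral_diff square_integrable_inner Su Sw C10_square_integrable v)
      also have "\<dots> = (\<integral>X. f X * v j X / w X - f X * v j X / u X \<partial>M)"
        unfolding eu[OF v] ew[OF v] by (rule Bochner_Integration.integral_diff[symmetric, OF rw(1) ru(1)])
      finally show ?thesis .
    qed
    define v' where "v' X = gam (z X) * \<psi> k X" for X
    have "(\<lambda>j. \<integral>X. f X * v j X / w X - f X * v j X / u X \<partial>M) \<longlonglongrightarrow> (\<integral>X. f X * v' X / w X - f X * v' X / u X \<partial>M)"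
    proof (rule integral_dominated_convergence[where w="\<lambda>X. \<bar>f X\<bar> * (1 / d) + \<bar>f X\<bar> * (1 / c)"])
      show "integrable M (\<lambda>X. \<bar>f X\<bar> * (1 / d) + \<bar>f X\<bar> * (1 / c))"
        using f(1) by (intro Bochner_Integration.integrable_add integrable_mult_left integrable_abs)
      show "AE X in M. norm (f X * v j X / w X - f X * v j X / u X) \<le> \<bar>f X\<bar> * (1 / d) + \<bar>f X\<bar> * (1 / c)" for j
        using ru(2)[of j] rw(2)[of j] unfolding real_norm_def by eventually_elim linarith
      show "AE X in M. (\<lambda>j. f X * v j X / w X - f X * v j X / u X) \<longlonglongrightarrow> f X * v' X / w X - f X * v' X / u X"
        using psilim
      proof eventually_elim
        case (elim X)
        have "(\<lambda>j. v j X) \<longlonglongrightarrow> v' X" unfolding v_def v'_def by (intro tendsto_mult elim tendsto_const)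
        then show ?case unfolding divide_inverse by (intro tendsto_diff tendsto_mult tendsto_const)
      qed
    qed (use f(1) mu vm in \<open>measurable, auto simp: v'_def[abs_def]\<close>)
    then have "(\<integral>X. Z X \<bullet> (gam (z X) *\<^sub>R qgrad l (\<psi> k) X + \<psi> k X *\<^sub>R (gam' (z X) *\<^sub>R Z X)) \<partial>M)
      = (\<integral>X. f X * v' X / w X - f X * v' X / u X \<partial>M)"
      using L unfolding E by (rule LIMSEQ_unique[rotated])
    also have "\<dots> = - (\<integral>X. f X * v' X / u X - f X * v' X / w X \<partial>M)"
      by (simp only: Bochner_Integration.integral_minus[symmetric] minus_diff_eq)
    also have "\<dots> \<le> 0"
    proof (simp only: neg_le_0_iff_le, rule integral_nonneg_AE)
      \<comment> \<open>Where \<open>v'\<close> is nonzero, \<open>0 < u < w\<close> holds almost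
        everywhere, so the monotonicity of 1 / t gives the sign.\<close>
      show "AE X in M. 0 \<le> f X * v' X / u X - f X * v' X / w X"
        using f(2) c(2) d(2)
      proof eventually_elim
        case (elim X)
        show ?case
        proof (cases "X \<in> K \<and> z X > 0")
          case True
          then have "0 < u X" "u X \<le> w X" using elim c(1) by (auto simp: z_def)
          moreover have "0 \<le> f X * v' X" using elim(1) gam_bounds by (simp add: v'_def \<psi>_def)
          ultimately have "f X * v' X / w X \<le> f X * v' X / u X" by (intro divide_left_mono) auto
          then show ?thesis by simp
        next
          case False
          then have "v' X = 0" using K(3)[of X] gam_nonpos(1)[of "z X"] by (auto simp: v'_def)
          then show ?thesis by simp
        qed
      qed
    qed
    finally show ?thesis .
  qed
  have Sg: "square_integrable M (\<lambda>X. gam' (z X) *\<^sub>R Z X)"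
    by (rule W_square_integrable(2)[OF W_gam[OF Wz]])
  have "L2_tendsto M (\<lambda>k X. gam (z X) *\<^sub>R qgrad l (\<psi> k) X) (\<lambda>X. gam (z X) *\<^sub>R (gam' (z X) *\<^sub>R Z X))"
    by (rule L2_tendsto_bounded_mult[where B=1, OF lim1]) (auto simp: gb)
  \<comment> \<open>Now \<open>k\<close> tends to infinity: both terms of the product rule have the
    same limit, giving twice a nonnegative integrand.\<close>
  from L2_tendsto_inner[OF L2_tendsto_const[OF Sz(2)] L2_tendsto_add[OF this lim2[OF Sg]]]
  have "(\<integral>X. Z X \<bullet> (gam (z X) *\<^sub>R (gam' (z X) *\<^sub>R Z X) + gam (z X) *\<^sub>R (gam' (z X) *\<^sub>R Z X)) \<partial>M) \<le> 0"
    by (rule LIMSEQ_le_const2) (use step in auto)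
  then have le: "(\<integral>X. 2 * (gam (z X) * (gam' (z X) * (norm (Z X))\<^sup>2)) \<partial>M) \<le> 0"
    by (simp add: power2_norm_eq_inner inner_add_right)
  have nn: "0 \<le> gam (z X) * (gam' (z X) * (norm (Z X))\<^sup>2)" for X using gam_bounds by simp
  have "square_integrable M (\<lambda>X. gam (z X) *\<^sub>R (gam' (z X) *\<^sub>R Z X))"
    by (rule square_integrable_bounded_mult[OF Sg, where B=1]) (auto simp: gb)
  from square_integrable_inner[OF Sz(2) this]
  have int: "integrable M (\<lambda>X. gam (z X) * (gam' (z X) * (norm (Z X))\<^sup>2))"
    by (simp add: power2_norm_eq_inner mult.assoc)
  have "0 \<le> (\<integral>X. gam (z X) * (gam' (z X) * (norm (Z X))\<^sup>2) \<partial>M)" using nn by simp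
  with le have "(\<integral>X. gam (z X) * (gam' (z X) * (norm (Z X))\<^sup>2) \<partial>M) = 0" by simp
  then have "AE X in M. gam (z X) * (gam' (z X) * (norm (Z X))\<^sup>2) = 0"
    using integral_nonneg_eq_0_iff_AE[OF int] nn by simp
  then have "AE X in M. z X > 0 \<longrightarrow> Z X = 0"
    by eventually_elim (auto dest: gam_pos)
  from W_nonpos[OF Wz this] show ?thesis by (simp add: z_def)
qed

section \<open>Existence by regularisation\<close>

lemma bump_test:
  assumes F: "F \<in> borel_measurable M" "\<And>X. X \<in> \<Omega> \<Longrightarrow> 0 \<le> F X" "\<And>X. X \<in> \<Omega> \<Longrightarrow> F X \<le> A"
    and eq: "\<And>v. v \<in> C10 \<Omega> \<Longrightarrow> (\<integral>X. F X * v X \<partial>M) = 0"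
  shows "AE X in M. F X = 0"
proof (rule ccontr)
  assume "\<not> ?thesis"
  from support_point[OF this] obtain P where P: "P \<in> \<Omega>" "\<And>r. r > 0 \<Longrightarrow> \<not> (AE X in M. X \<in> ball P r \<longrightarrow> F X = 0)"
    by blast
  obtain r where r: "r > 0" "cball P r \<subseteq> \<Omega>" using op P(1) by (auto simp: open_contains_cball)
  \<comment> \<open>One nonnegative bump at a support point suffices, since
    \<open>F \<ge> 0\<close>.\<close>
  define v where "v X = (max 0 (r\<^sup>2 - qdist 1 P X)) ^ (0 + 2)" for X
  define D where "D X = ((real 0 + 2) * (max 0 (r\<^sup>2 - qdist 1 P X)) ^ (0 + 1)) *\<^sub>R (0 - qdist_grad 1 P X)" for X
  have "GDERIV v X :> D X" for X
    unfolding v_def[abs_def] D_def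
    by (rule GDERIV_DERIV_compose[OF GDERIV_diff[OF GDERIV_const qdist_GDERIV] max_power_has_derivative])
  moreover have "continuous_on UNIV D"
    unfolding D_def by (intro continuous_intros qdist_continuous)
  moreover have "v X = 0" if "X \<notin> cball P r" for X
  proof -
    have "r\<^sup>2 \<le> (dist X P)\<^sup>2" using that r by (intro power_mono) (auto simp: dist_commute)
    then show ?thesis by (simp add: v_def qdist_one)
  qed
  ultimately have v: "v \<in> C10 \<Omega>" using r(2) by (intro C10I(1)[of v D "cball P r"]) auto
  have vnn: "0 \<le> v X" for X by (simp add: v_def)
  have int: "integrable M (\<lambda>X. F X * v X)"
  proof (rule square_integrable_mult)
    show "square_integrable M F" by (rule square_integrable_bounded[OF F(1), where B=A]) (use F in auto)
  qed (rule C10_square_integrable(1)[OF v])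
  have nn: "AE X in M. 0 \<le> F X * v X" using F(2) vnn by (intro AE_I2) (simp add: space_M)
  have "AE X in M. F X * v X = 0" using integral_nonneg_eq_0_iff_AE[OF int nn] eq[OF v] by simp
  then have "AE X in M. X \<in> ball P r \<longrightarrow> F X = 0"
  proof eventually_elim
    case (elim X)
    show ?case
    proof
      assume "X \<in> ball P r"
      then have "(dist X P)\<^sup>2 < r\<^sup>2" by (intro power_strict_mono) (auto simp: dist_commute)
      then have "v X > 0" by (simp add: v_def qdist_one)
      then show "F X = 0" using elim by simp
    qed
  qed
  then show False using P(2)[OF r(1)] by blast
qed

text \<open>The hypotheses of \<open>semilinear_solution\<close> for 1 / (t + \<delta>); the
  positive part makes the nonlinearity defined and monotone on all of R, before solutions are known
  to be nonnegative.\<close>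

lemma regularised_nonlinearity:
  fixes \<delta> :: real
  assumes \<delta>: "\<delta> > 0"
  shows "s \<le> t \<Longrightarrow> 1 / (max 0 t + \<delta>) \<le> 1 / (max 0 s + \<delta>)" "0 \<le> 1 / (max 0 t + \<delta>)"
    "1 / (max 0 t + \<delta>) \<le> 1 / \<delta>"
    "\<bar>1 / (max 0 s + \<delta>) - 1 / (max 0 t + \<delta>)\<bar> \<le> (1 / \<delta>\<^sup>2) * \<bar>s - t\<bar>"
proof -
  show "s \<le> t \<Longrightarrow> 1 / (max 0 t + \<delta>) \<le> 1 / (max 0 s + \<delta>)" "0 \<le> 1 / (max 0 t + \<delta>)"
    "1 / (max 0 t + \<delta>) \<le> 1 / \<delta>"
    using \<delta> by (auto intro!: frac_le)
  define a b where "a = max 0 s + \<delta>" and "b = max 0 t + \<delta>"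
  have ab: "\<delta> \<le> a" "\<delta> \<le> b" by (auto simp: a_def b_def)
  then have "a \<noteq> 0" "b \<noteq> 0" using \<delta> by auto
  then have "1 / a - 1 / b = (b - a) * (1 / (a * b))" by (simp add: diff_frac_eq)
  then have "\<bar>1 / a - 1 / b\<bar> = \<bar>b - a\<bar> * (1 / (a * b))" using ab \<delta> by (simp add: abs_mult)
  also have "\<dots> \<le> \<bar>s - t\<bar> * (1 / \<delta>\<^sup>2)"
  proof (rule mult_mono)
    show "\<bar>b - a\<bar> \<le> \<bar>s - t\<bar>" by (auto simp: a_def b_def max_def)
    have "\<delta>\<^sup>2 \<le> a * b" unfolding power2_eq_square using ab \<delta> by (intro mult_mono) auto
    then show "1 / (a * b) \<le> 1 / \<delta>\<^sup>2" using \<delta> by (intro frac_le) auto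
  qed (use ab \<delta> in auto)
  finally show "\<bar>1 / (max 0 s + \<delta>) - 1 / (max 0 t + \<delta>)\<bar> \<le> (1 / \<delta>\<^sup>2) * \<bar>s - t\<bar>"
    unfolding a_def b_def by (simp only: mult.commute)
qed

text \<open>The solutions \<open>u n\<close> of the regularised problems increase with \<open>n\<close>; testing the equations with
  each other gives \<open>\<parallel>u m - u n\<parallel>\<^sup>2 \<le> \<parallel>u m\<parallel>\<^sup>2 - \<parallel>u n\<parallel>\<^sup>2\<close> for \<open>n \<le> m\<close>, so they converge strongly.\<close>

lemma solution_exists:
  assumes conn: "connected \<Omega>" and f: "integrable M f" "AE X in M. 0 \<le> f X" "\<not> (AE X in M. f X = 0)"
  shows "\<exists>u U. solution f u U"
proof -
  have [measurable]: "f \<in> borel_measurable M" using f(1) by simp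
  \<comment> \<open>The height \<open>n + 1\<close> keeps \<open>F 0\<close> from vanishing
    identically; the outer \<open>max\<close> is there because \<open>f\<close> is nonnegative only
    almost everywhere.\<close>
  define F where "F n X = max 0 (min (f X) (real n + 1))" for n X
  define \<delta> where "\<delta> n = 1 / (real n + 1)" for n :: nat
  define g where "g n t = 1 / (max 0 t + \<delta> n)" for n t
  have \<delta>: "\<delta> n > 0" for n by (simp add: \<delta>_def)
  have gp: "s \<le> t \<Longrightarrow> g n t \<le> g n s" "0 \<le> g n t" "g n t \<le> 1 / \<delta> n"
    "\<bar>g n s - g n t\<bar> \<le> (1 / (\<delta> n)\<^sup>2) * \<bar>s - t\<bar>" for n s t
    unfolding g_def by (rule regularised_nonlinearity[OF \<delta>]; assumption?)+
  have FM[measurable]: "F n \<in> borel_measurable M" for n unfolding F_def by measurable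
  have F: "0 \<le> F n X" "F n X \<le> real n + 1" "F n X \<le> \<bar>f X\<bar>" for n X by (auto simp: F_def)
  have Fmono: "F n X \<le> F (Suc n) X" for n X by (auto simp: F_def)
  have "\<exists>p. W (fst p) (snd p) \<and> square_integrable M (\<lambda>X. F n X * g n (fst p X)) \<and>
     (\<forall>v\<in>C10 \<Omega>. (\<integral>X. snd p X \<bullet> qgrad l v X \<partial>M) = (\<integral>X. F n X * g n (fst p X) * v X \<partial>M))" for n
    using semilinear_solution[of "F n" "real n + 1" "g n", OF FM F(1,2) gp] by auto
  then have "\<exists>p. \<forall>n. W (fst (p n)) (snd (p n)) \<and> square_integrable M (\<lambda>X. F n X * g n (fst (p n) X)) \<and>
     (\<forall>v\<in>C10 \<Omega>. (\<integral>X. snd (p n) X \<bullet> qgrad l v X \<partial>M) = (\<integral>X. F n X * g n (fst (p n) X) * v X \<partial>M))"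
    by (intro choice allI)
  then obtain p where p: "\<forall>n. W (fst (p n)) (snd (p n)) \<and> square_integrable M (\<lambda>X. F n X * g n (fst (p n) X)) \<and>
     (\<forall>v\<in>C10 \<Omega>. (\<integral>X. snd (p n) X \<bullet> qgrad l v X \<partial>M) = (\<integral>X. F n X * g n (fst (p n) X) * v X \<partial>M))" ..
  define u U where "u n = fst (p n)" and "U n = snd (p n)" for n
  have Wu: "W (u n) (U n)" and sh: "square_integrable M (\<lambda>X. F n X * g n (u n X))"
    and eq0: "\<And>v. v \<in> C10 \<Omega> \<Longrightarrow> (\<integral>X. U n X \<bullet> qgrad l v X \<partial>M) = (\<integral>X. F n X * g n (u n X) * v X \<partial>M)" for n
    using p by (auto simp: u_def U_def)
  note S = W_square_integrable[OF Wu]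
  have [measurable]: "u n \<in> borel_measurable M" for n by (rule square_integrable_measurable[OF S(1)])
  have eq: "(\<integral>X. U n X \<bullet> V X \<partial>M) = (\<integral>X. F n X * g n (u n X) * v X \<partial>M)" if "W v V" for n v V
    by (rule W_test[OF sh S(2) eq0 that])
  have ih: "integrable M (\<lambda>X. F n X * g n (u n X) * v X)" if "square_integrable M v" for n v
    by (rule square_integrable_mult[OF sh that])
  have hnn: "0 \<le> F n X * g n (u n X)" for n X using F gp by simp
  have u0: "AE X in M. 0 \<le> u n X" for n
  proof -
    note Wm = W_minus[OF Wu[of n]]
    \<comment> \<open>Testing with \<open>gam (- u n X)\<close>: the right-hand side is nonnegative,
      while the left-hand side is minus an energy over the set where \<open>u n\<close> is
      negative.\<close>
    have "0 \<le> (\<integral>X. F n X * g n (u n X) * gam (- u n X) \<partial>M)"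
      using hnn gam_bounds by (intro Bochner_Integration.integral_nonneg) simp
    then have "0 \<le> (\<integral>X. U n X \<bullet> (gam' (- u n X) *\<^sub>R - U n X) \<partial>M)" using eq[OF W_gam[OF Wm]] by simp
    then have "(\<integral>X. - U n X \<bullet> (gam' (- u n X) *\<^sub>R - U n X) \<partial>M) \<le> 0" by simp
    from W_nonpos_energy[OF Wm this] show ?thesis by simp
  qed
  have "AE X in M. u n X - u (Suc n) X \<le> 0" for n
  proof (rule W_nonpos_energy[OF W_diff[OF Wu Wu]])
    let ?z = "\<lambda>X. u n X - u (Suc n) X" and ?Z = "\<lambda>X. U n X - U (Suc n) X"
    note G = W_gam[OF W_diff[OF Wu[of n] Wu[of "Suc n"]]]
    note SG = W_square_integrable[OF G]
    have "(\<integral>X. ?Z X \<bullet> (gam' (?z X) *\<^sub>R ?Z X) \<partial>M)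
       = (\<integral>X. U n X \<bullet> (gam' (?z X) *\<^sub>R ?Z X) \<partial>M) - (\<integral>X. U (Suc n) X \<bullet> (gam' (?z X) *\<^sub>R ?Z X) \<partial>M)"
      unfolding inner_diff_left[of "U n _" "U (Suc n) _"]
      by (intro Bochner_Integration.integral_diff square_integrable_inner S SG)
    also have "\<dots> = (\<integral>X. F n X * g n (u n X) * gam (?z X) - F (Suc n) X * g (Suc n) (u (Suc n) X) * gam (?z X) \<partial>M)"
      unfolding eq[OF G] by (rule Bochner_Integration.integral_diff[symmetric, OF ih[OF SG(1)] ih[OF SG(1)]])
    also have "\<dots> \<le> (\<integral>X. 0 \<partial>M)"
    proof (rule integral_mono)
      show "integrable M (\<lambda>X. F n X * g n (u n X) * gam (?z X) - F (Suc n) X * g (Suc n) (u (Suc n) X) * gam (?z X))"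
        by (intro Bochner_Integration.integrable_diff ih SG)
      fix X
      show "F n X * g n (u n X) * gam (?z X) - F (Suc n) X * g (Suc n) (u (Suc n) X) * gam (?z X) \<le> 0"
      proof (cases "?z X \<le> 0")
        case True
        then show ?thesis by (simp add: gam_nonpos)
      next
        case False
        \<comment> \<open>What remains is \<open>u n > u (Suc n)\<close>; there the larger argument,
          the larger shift and the lower truncation all make the right-hand side for
          \<open>n\<close> the smaller one.\<close>
        have "\<delta> (Suc n) \<le> \<delta> n" unfolding \<delta>_def by (intro frac_le) auto
        then have "max 0 (u (Suc n) X) + \<delta> (Suc n) \<le> max 0 (u n X) + \<delta> n" using False by (auto simp: max_def)
        then have "g n (u n X) \<le> g (Suc n) (u (Suc n) X)"
          unfolding g_def using \<delta>[of "Suc n"] by (intro frac_le) (auto simp: max_def)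
        then have "F n X * g n (u n X) \<le> F (Suc n) X * g (Suc n) (u (Suc n) X)"
          using F gp Fmono by (intro mult_mono) auto
        then have "F n X * g n (u n X) * gam (?z X) \<le> F (Suc n) X * g (Suc n) (u (Suc n) X) * gam (?z X)"
          using gam_bounds by (intro mult_right_mono) auto
        then show ?thesis by simp
      qed
    qed simp
    finally show "(\<integral>X. ?Z X \<bullet> (gam' (?z X) *\<^sub>R ?Z X) \<partial>M) \<le> 0" by simp
  qed
  then have "AE X in M. \<forall>n. u n X - u (Suc n) X \<le> 0" by (simp add: AE_all_countable)
  then have mono: "AE X in M. \<forall>n m. n \<le> m \<longrightarrow> u n X \<le> u m X"
  proof eventually_elim
    case (elim X)
    have "u n X \<le> u m X" if "n \<le> m" for n m
      by (rule lift_Suc_mono_le[of "\<lambda>n. u n X", OF _ that]) (use elim in simp)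
    then show ?case by blast
  qed
  have u0': "AE X in M. \<forall>n. 0 \<le> u n X" using u0 by (simp add: AE_all_countable)
  define e where "e n = (\<integral>X. (norm (U n X))\<^sup>2 \<partial>M)" for n
  have e: "e n = (\<integral>X. F n X * g n (u n X) * u n X \<partial>M)" for n
    unfolding e_def power2_norm_eq_inner by (rule eq[OF Wu])
  \<comment> \<open>As \<open>g n t * t \<le> 1\<close> for \<open>t \<ge> 0\<close>, the energy is
    at most the L^1 norm of \<open>f\<close>: the exponent 1 of the singularity is decisive
    here.\<close>
  have ebd: "e n \<le> (\<integral>X. \<bar>f X\<bar> \<partial>M)" for n
    unfolding e
  proof (rule integral_mono_AE[OF ih[OF S(1)]])
    show "integrable M (\<lambda>X. \<bar>f X\<bar>)" using f(1) by simp
    show "AE X in M. F n X * g n (u n X) * u n X \<le> \<bar>f X\<bar>"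
      using u0[of n]
    proof eventually_elim
      case (elim X)
      have "g n (u n X) * u n X \<le> 1" using elim \<delta>[of n] by (simp add: g_def)
      then have "F n X * (g n (u n X) * u n X) \<le> \<bar>f X\<bar> * 1"
        using F elim gp by (intro mult_mono) auto
      then show ?case by (simp add: mult.assoc)
    qed
  qed
  have diff: "(\<integral>X. (norm (U m X - U n X))\<^sup>2 \<partial>M) \<le> e m - e n" if "n \<le> m" for n m
  proof -
    have "e n \<le> (\<integral>X. F n X * g n (u n X) * u m X \<partial>M)"
      unfolding e
    proof (rule integral_mono_AE[OF ih[OF S(1)] ih[OF S(1)]])
      show "AE X in M. F n X * g n (u n X) * u n X \<le> F n X * g n (u n X) * u m X"
        using mono by eventually_elim (use that hnn in \<open>simp add: mult_left_mono\<close>)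
    qed
    also have "\<dots> = (\<integral>X. U m X \<bullet> U n X \<partial>M)" using eq[OF Wu, of n m] by (simp add: inner_commute)
    finally have "e n \<le> (\<integral>X. U m X \<bullet> U n X \<partial>M)" .
    then show ?thesis using integral_norm2_add[OF S(2)[of m] S(2)[of n], of "-1"] by (simp add: e_def)
  qed
  have inc: "incseq e"
  proof (rule incseq_SucI)
    fix n
    have "0 \<le> (\<integral>X. (norm (U (Suc n) X - U n X))\<^sup>2 \<partial>M)" by simp
    also have "\<dots> \<le> e (Suc n) - e n" by (rule diff) simp
    finally show "e n \<le> e (Suc n)" by simp
  qed
  then obtain E where E: "e \<longlonglongrightarrow> E" "\<And>n. e n \<le> E"
    using incseq_convergent[OF inc] ebd by blast
  have "\<exists>N. \<forall>i\<ge>N. \<forall>j\<ge>N. (\<integral>X. (norm (U i X - U j X))\<^sup>2 \<partial>M) < d" if d: "d > 0" for d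
  proof -
    obtain N where N: "\<And>n. n \<ge> N \<Longrightarrow> E - d < e n"
      using order_tendstoD(1)[OF E(1), of "E - d"] d by (auto simp: eventually_sequentially)
    have *: "(\<integral>X. (norm (U i X - U j X))\<^sup>2 \<partial>M) < d" if "j \<ge> N" "j \<le> i" for i j
      using diff[OF that(2)] N[OF that(1)] E(2)[of i] by linarith
    have "(\<integral>X. (norm (U i X - U j X))\<^sup>2 \<partial>M) < d" if "i \<ge> N" "j \<ge> N" for i j
      using *[of j i] *[of i j] that by (cases "j \<le> i") (simp_all add: norm_minus_commute)
    then show ?thesis by blast
  qed
  note CU = this
  obtain v V where WV: "W v V" and lv: "L2_tendsto M u v" and lV: "L2_tendsto M U V"
    using W_complete[OF Wu CU] by blast
  have [measurable]: "v \<in> borel_measurable M" by (rule square_integrable_measurable[OF W_square_integrable(1)[OF WV]])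
  obtain r where r: "strict_mono r" "AE X in M. (\<lambda>n. u (r n) X) \<longlonglongrightarrow> v X"
    using L2_tendsto_AE_subseq[OF lv] by blast
  have sup: "superharmonic (u 0) (U 0)"
    unfolding superharmonic_def
  proof (intro conjI allI impI Wu u0)
    fix w V' assume w: "W w V'" "AE X in M. 0 \<le> w X"
    show "0 \<le> (\<integral>X. U 0 X \<bullet> V' X \<partial>M)"
      unfolding eq[OF w(1)]
    proof (rule integral_nonneg_AE)
      show "AE X in M. 0 \<le> F 0 X * g 0 (u 0 X) * w X"
        using w(2) by eventually_elim (use hnn[of 0] in simp)
    qed
  qed
  have nz: "\<not> (AE X in M. u 0 X = 0)"
  proof
    assume z: "AE X in M. u 0 X = 0"
    have "(\<integral>X. F 0 X * w X \<partial>M) = 0" if w: "w \<in> C10 \<Omega>" for w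
    proof -
      have "e 0 = (\<integral>X. 0 \<partial>M)"
        unfolding e by (rule integral_cong_AE) (use z ih[OF S(1), of 0 0] in auto)
      then have "AE X in M. U 0 X = 0" by (intro integral_norm2_eq_0D[OF S(2)]) (simp add: e_def)
      then have "(\<integral>X. U 0 X \<bullet> qgrad l w X \<partial>M) = (\<integral>X. 0 \<partial>M)"
        by (intro integral_cong_AE borel_measurable_integrable square_integrable_inner S C10_square_integrable w) auto
      then have 1: "(\<integral>X. F 0 X * g 0 (u 0 X) * w X \<partial>M) = 0" using eq[OF W_C10[OF w], of 0] by simp
      have [measurable]: "w \<in> borel_measurable M" by (rule continuous_M[OF C10_continuous[OF w]])
      have "(\<integral>X. F 0 X * w X \<partial>M) = (\<integral>X. F 0 X * g 0 (u 0 X) * w X \<partial>M)"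
      proof (rule integral_cong_AE)
        show "(\<lambda>X. F 0 X * g 0 (u 0 X) * w X) \<in> borel_measurable M"
          by (intro borel_measurable_integrable ih C10_square_integrable w)
        \<comment> \<open>\<open>\<delta> 0 = 1\<close>, so the nonlinearity equals 1 where
          \<open>u 0\<close> vanishes.\<close>
        show "AE X in M. F 0 X * w X = F 0 X * g 0 (u 0 X) * w X"
          using z by eventually_elim (simp add: g_def \<delta>_def)
      qed measurable
      then show ?thesis using 1 by simp
    qed
    from bump_test[OF FM F(1,2) this] have "AE X in M. F 0 X = 0" .
    then have "AE X in M. f X = 0"
      using f(2) by eventually_elim (auto simp: F_def min_def max_def split: if_splits)
    then show False using f(3) by blast
  qed
  \<comment> \<open>A bound for \<open>u 0\<close> alone is enough: by monotonicity it passes to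
    every \<open>u n\<close> and to the limit.\<close>
  have low: "\<exists>c>0. AE X in M. X \<in> K \<longrightarrow> c \<le> u 0 X" if "compact K" "K \<subseteq> \<Omega>" for K
    by (rule strong_maximum_principle[OF sup nz conn that])
  have ge: "AE X in M. u 0 X \<le> v X"
    using mono r(2)
  proof eventually_elim
    case (elim X)
    show ?case by (rule LIMSEQ_le_const[OF elim(2)]) (use elim(1) in auto)
  qed
  have "solution f v V"
    unfolding solution_def
  proof (intro conjI allI impI ballI WV)
    fix K assume K: "compact K" "K \<subseteq> \<Omega>"
    obtain c where c: "c > 0" "AE X in M. X \<in> K \<longrightarrow> c \<le> u 0 X" using low[OF K] by blast
    have "AE X in M. X \<in> K \<longrightarrow> c \<le> v X" using c(2) ge by eventually_elim auto
    then show "\<exists>c>0. AE X in M. X \<in> K \<longrightarrow> c \<le> v X" using c(1) by blast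
  next
    fix w assume w: "w \<in> C10 \<Omega>"
    have [measurable]: "w \<in> borel_measurable M" by (rule continuous_M[OF C10_continuous[OF w]])
    obtain K where K: "compact K" "K \<subseteq> \<Omega>" "\<And>X. X \<notin> K \<Longrightarrow> w X = 0" "\<And>X. X \<notin> K \<Longrightarrow> grad w X = 0"
      by (rule C10_support[OF w], rule that)
    obtain B where B: "B \<ge> 0" "\<And>X. \<bar>w X\<bar> \<le> B" "\<And>X. norm (grad w X) \<le> B" by (rule C10_bounded[OF w], rule that)
    obtain c where c: "c > 0" "AE X in M. X \<in> K \<longrightarrow> c \<le> u 0 X" using low[OF K(1,2)] by blast
    have "(\<lambda>n. \<integral>X. U (r n) X \<bullet> qgrad l w X \<partial>M) \<longlonglongrightarrow> (\<integral>X. V X \<bullet> qgrad l w X \<partial>M)"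
      by (intro L2_tendsto_inner L2_tendsto_subseq[OF lV r(1)] L2_tendsto_const C10_square_integrable w)
    then have 1: "(\<lambda>n. \<integral>X. F (r n) X * g (r n) (u (r n) X) * w X \<partial>M) \<longlonglongrightarrow> (\<integral>X. V X \<bullet> qgrad l w X \<partial>M)"
      unfolding eq0[OF w] .
    have "(\<lambda>n. \<integral>X. F (r n) X * g (r n) (u (r n) X) * w X \<partial>M) \<longlonglongrightarrow> (\<integral>X. f X * w X / v X \<partial>M)"
    proof (rule integral_dominated_convergence[where w="\<lambda>X. \<bar>f X\<bar> * (1 / c * B)"])
      show "integrable M (\<lambda>X. \<bar>f X\<bar> * (1 / c * B))" using f(1) by (intro integrable_mult_left integrable_abs)
      show "(\<lambda>X. F (r n) X * g (r n) (u (r n) X) * w X) \<in> borel_measurable M" for n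
        by (intro borel_measurable_integrable ih C10_square_integrable w)
      show "(\<lambda>X. f X * w X / v X) \<in> borel_measurable M" by measurable
      show "AE X in M. norm (F (r n) X * g (r n) (u (r n) X) * w X) \<le> \<bar>f X\<bar> * (1 / c * B)" for n
        using c(2) mono
      proof eventually_elim
        case (elim X)
        show ?case
        proof (cases "X \<in> K")
          case True
          then have "c \<le> u (r n) X" using elim by (metis le0 order_trans)
          then have "g (r n) (u (r n) X) \<le> 1 / c" unfolding g_def using c(1) \<delta>[of "r n"] by (intro frac_le) auto
          then have "F (r n) X * (g (r n) (u (r n) X) * \<bar>w X\<bar>) \<le> \<bar>f X\<bar> * (1 / c * B)"
            using F gp B c(1) by (intro mult_mono) auto
          then show ?thesis using F(1) gp(2) by (simp add: abs_mult mult.assoc)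
        next
          case False
          then show ?thesis using K(3) B c(1) by simp
        qed
      qed
      show "AE X in M. (\<lambda>n. F (r n) X * g (r n) (u (r n) X) * w X) \<longlonglongrightarrow> f X * w X / v X"
        using c(2) r(2) ge f(2)
      proof eventually_elim
        case (elim X)
        show ?case
        proof (cases "X \<in> K")
          case True
          then have vX: "v X > 0" using elim c(1) by linarith
          obtain n0 :: nat where n0: "f X \<le> real n0" using real_arch_simple by blast
          \<comment> \<open>The truncation is inactive as soon as
            \<open>r n \<ge> n \<ge> f X\<close>.\<close>
          have "F (r n) X = f X" if "n \<ge> n0" for n
          proof -
            have "real n0 \<le> real (r n)" using that seq_suble[OF r(1), of n] by linarith
            then show ?thesis using n0 elim(4) by (simp add: F_def)
          qed
          then have l1: "(\<lambda>n. F (r n) X) \<longlonglongrightarrow> f X"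
            by (intro tendsto_eventually) (auto simp: eventually_sequentially)
          have "\<delta> \<longlonglongrightarrow> 0"
            using LIMSEQ_inverse_real_of_nat by (simp add: \<delta>_def[abs_def] inverse_eq_divide add.commute)
          then have "(\<lambda>n. \<delta> (r n)) \<longlonglongrightarrow> 0" using LIMSEQ_subseq_LIMSEQ[OF _ r(1)] by (simp add: o_def)
          then have "(\<lambda>n. g (r n) (u (r n) X)) \<longlonglongrightarrow> 1 / (max 0 (v X) + 0)"
            unfolding g_def using vX by (intro tendsto_intros elim) auto
          from tendsto_mult[OF tendsto_mult[OF l1 this] tendsto_const[of "w X"]]
          show ?thesis using vX by simp
        next
          case False
          then show ?thesis using K(3) by simp
        qed
      qed
    qed
    from LIMSEQ_unique[OF 1 this] show "(\<integral>X. V X \<bullet> qgrad l w X \<partial>M) = (\<integral>X. f X * w X / v X \<partial>M)" .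
  qed
  then show ?thesis by blast
qed

end

theorem theorem3p1:
  fixes \<Omega> :: "(real \<times> (real ^ 'm)) set" and l :: real and f :: "real \<times> (real ^ 'm) \<Rightarrow> real"
  assumes "l \<ge> 1"
    and "open \<Omega>" and "bounded \<Omega>" and "Lambda_connected l \<Omega>"
    and "integrable (lebesgue_on \<Omega>) f"
    and "AE X in lebesgue_on \<Omega>. 0 \<le> f X"
    and "\<not> (AE X in lebesgue_on \<Omega>. f X = 0)"
  shows "\<exists>u. weak_solution l \<Omega> f u \<and>
           (\<forall>w. weak_solution l \<Omega> f w \<longrightarrow> (AE X in lebesgue_on \<Omega>. w X = u X))"
proof -
  interpret grushin_domain l \<Omega> using assms(1-3) by unfold_locales
  obtain u U where u: "solution f u U"
    using solution_exists[OF Lambda_connected_imp_connected[OF assms(4)] assms(5-7)] by blast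
  have "AE X in M. w X = u X" if "solution f w V" for w V
    using solution_le[OF assms(5,6) u that] solution_le[OF assms(5,6) that u]
    by eventually_elim simp
  then show ?thesis using u unfolding weak_solution_iff by blast
qed

end
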